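(* The ind-group $G$ acts algebraically on each space $\mathcal{C}_n$; that is, the action map $G\times\mathcal{C}_n\to\mathcal{C}_n$ is a morphism of ind-varieties.
   Context: $R=\mathbb{C}\langle x,y\rangle$ is the free associative $\mathbb{C}$-algebra on $x,y$, and $G$ is the group of all $\mathbb{C}$-algebra automorphisms $\sigma$ of $R$ with $\sigma([x,y])=[x,y]$, viewed as a subset of $R\times R$ via $\sigma\mapsto(\sigma(x),\sigma(y))$. An ind-variety is a set $X=\bigcup_{k\ge0}X^{(k)}$ with an increasing filtration by finite-dimensional (quasi-projective) complex varieties such that each inclusion $X^{(k)}\hookrightarrow X^{(k+1)}$ is a closed embedding. A map $f:X\to Y$ of ind-varieties is a morphism if for each $k$ there is $m$ with $f(X^{(k)})\subseteq Y^{(m)}$ and $f|_{X^{(k)}}:X^{(k)}\to Y^{(m)}$ a morphism of varieties. The product has filtration $(X\times Y)^{(k)}=X^{(k)}\times Y^{(k)}$. A variety is an ind-variety with constant filtration. Let $R^{(k)}$ be the space of elements of $R$ of degree $\le k$. $G$ is an ind-variety (and an ind-group) with filtration $G^{(k)}=G\cap(R^{(k)}\times R^{(k)})$, a Zariski closed subset of the affine space $R^{(k)}\times R^{(k)}$ with its reduced structure. For $n\ge 1$, $\tilde{\mathcal{C}}_n$ is the variety of pairs $(X,Y)$ of complex $n\times n$ matrices with $\mathrm{rank}([X,Y]+I_n)=1$, on which $\mathrm{PGL}_n(\mathbb{C})$ acts freely by simultaneous conjugation; $\mathcal{C}_n=\tilde{\mathcal{C}}_n/\mathrm{PGL}_n(\mathbb{C})$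 is the quotient variety (smooth, affine, irreducible of dimension $2n$); $\mathcal{C}_0$ is a point. $G$ acts on $\mathcal{C}_n$ by $\sigma\cdot(X,Y)=(\sigma^{-1}(X),\sigma^{-1}(Y))$, where $\tau(X),\tau(Y)$ are obtained by substituting $x=X$, $y=Y$ into $\tau(x),\tau(y)$. *)

theory Defs
  imports
    "HOL-Library.Poly_Mapping"
    "HOL-Analysis.Abstract_Topology"
    "HOL-Algebra.Group_Action"
    "Jordan_Normal_Form.DL_Rank"
begin

section \<open>Spaces with functions\<close>

text \<open>
  A complex variety is represented by its underlying space with functions: the Zariski topology
  together with, for every open set \<open>U\<close>, the set of regular functions on \<open>U\<close>. Regular functions on
  \<open>U\<close> are total HOL functions of which only the values on \<open>U\<close> matter; \<open>regular_on X U\<close> is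
  only meaningful for open \<open>U\<close>. Morphisms of varieties are exactly the morphisms of
  spaces with functions.
\<close>

record 'a fspace =
  zariski :: "'a topology"
  regular_on :: "'a set \<Rightarrow> ('a \<Rightarrow> complex) set"

abbreviation points :: "'a fspace \<Rightarrow> 'a set" where
  "points X \<equiv> topspace (zariski X)"

definition variety_morphism :: "'a fspace \<Rightarrow> 'b fspace \<Rightarrow> ('a \<Rightarrow> 'b) \<Rightarrow> bool" where
  "variety_morphism X Y f \<longleftrightarrow>
     continuous_map (zariski X) (zariski Y) f \<and>
     (\<forall>V g. openin (zariski Y) V \<longrightarrow> g \<in> regular_on Y V \<longrightarrow>
        (\<lambda>p. g (f p)) \<in> regular_on X {p \<in> points X. f p \<in> V})"

inductive_set polynomial_functions :: "('a \<Rightarrow> complex) set \<Rightarrow> ('a \<Rightarrow> complex) set"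
  for \<Phi> :: "('a \<Rightarrow> complex) set" where
  const: "(\<lambda>_. c) \<in> polynomial_functions \<Phi>"
| coordinate: "\<phi> \<in> \<Phi> \<Longrightarrow> \<phi> \<in> polynomial_functions \<Phi>"
| add: "\<lbrakk>f \<in> polynomial_functions \<Phi>; g \<in> polynomial_functions \<Phi>\<rbrakk>
    \<Longrightarrow> (\<lambda>p. f p + g p) \<in> polynomial_functions \<Phi>"
| mult: "\<lbrakk>f \<in> polynomial_functions \<Phi>; g \<in> polynomial_functions \<Phi>\<rbrakk>
    \<Longrightarrow> (\<lambda>p. f p * g p) \<in> polynomial_functions \<Phi>"

text \<open>
  The functions in \<open>\<Phi>\<close> are the coordinates of an embedding of \<open>S\<close> into an affine space; \<open>S\<close>
  gets the reduced induced structure: the principal open sets form a basis of the topology, and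
  regular functions are locally quotients of polynomials in the coordinates.
\<close>

definition affine_subspace :: "'a set \<Rightarrow> ('a \<Rightarrow> complex) set \<Rightarrow> 'a fspace" where
  "affine_subspace S \<Phi> =
    (let T = topology_generated_by {{p \<in> S. h p \<noteq> 0} | h. h \<in> polynomial_functions \<Phi>} in
     \<lparr>zariski = T,
      regular_on = (\<lambda>U. {f. \<forall>p\<in>U. \<exists>N. openin T N \<and> p \<in> N \<and> N \<subseteq> U \<and>
        (\<exists>g\<in>polynomial_functions \<Phi>. \<exists>h\<in>polynomial_functions \<Phi>.
           \<forall>q\<in>N. h q \<noteq> 0 \<and> f q = g q / h q)})\<rparr>)"

lemma points_affine_subspace: "points (affine_subspace S \<Phi>) = S"
proof -
  let ?B = "{{p \<in> S. h p \<noteq> 0} | h. h \<in> polynomial_functions \<Phi>}"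
  have "{p \<in> S. (\<lambda>_. 1 :: complex) p \<noteq> 0} \<in> ?B"
    by (intro CollectI exI[of _ "\<lambda>_. 1"] conjI refl polynomial_functions.const)
  then have "S \<in> ?B"
    by simp
  moreover have "A \<subseteq> S" if "A \<in> ?B" for A
    using that by auto
  ultimately have "\<Union>?B = S"
    by (intro subset_antisym Union_least Union_upper)
  then show ?thesis
    unfolding affine_subspace_def Let_def by simp
qed

text \<open>
  The product of varieties. The functions \<open>tensor_functions X Y U V\<close> on \<open>U \<times> V\<close> are the image of
  the tensor product of the regular functions on \<open>U\<close> and on \<open>V\<close>; their non-vanishing loci form a
  basis of the Zariski topology of the product, and regular functions are locally quotients of them.
\<close>

definition tensor_functions ::
  "'a fspace \<Rightarrow> 'b fspace \<Rightarrow> 'a set \<Rightarrow> 'b set \<Rightarrow> ('a \<times> 'b \<Rightarrow> complex) set" where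
  "tensor_functions X Y U V =
    {(\<lambda>(u, v). \<Sum>i<m. f i u * g i v) | (m :: nat) f g.
       (\<forall>i<m. f i \<in> regular_on X U) \<and> (\<forall>i<m. g i \<in> regular_on Y V)}"

definition product_variety :: "'a fspace \<Rightarrow> 'b fspace \<Rightarrow> ('a \<times> 'b) fspace" where
  "product_variety X Y =
    (let T = topology_generated_by {{p \<in> U \<times> V. t p \<noteq> 0} | U V t.
               openin (zariski X) U \<and> openin (zariski Y) V \<and> t \<in> tensor_functions X Y U V} in
     \<lparr>zariski = T,
      regular_on = (\<lambda>W. {f. \<forall>p\<in>W. \<exists>N U V. openin T N \<and> p \<in> N \<and> N \<subseteq> W \<and>
        openin (zariski X) U \<and> openin (zariski Y) V \<and> N \<subseteq> U \<times> V \<and>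
        (\<exists>s\<in>tensor_functions X Y U V. \<exists>t\<in>tensor_functions X Y U V.
           \<forall>q\<in>N. t q \<noteq> 0 \<and> f q = s q / t q)})\<rparr>)"

text \<open>
  The quotient of \<open>X\<close> by an equivalence relation \<open>r\<close> on its points (for a group action: the orbit
  relation), with the structure of a geometric quotient: the quotient topology, and as regular
  functions those whose pullback, an \<open>r\<close>-invariant function, is regular. For a set \<open>U\<close> of classes,
  \<open>\<Union>U\<close> is its preimage.
\<close>

definition quotient_topology :: "'a topology \<Rightarrow> ('a \<times> 'a) set \<Rightarrow> 'a set topology" where
  "quotient_topology T r = topology (\<lambda>U. U \<subseteq> topspace T // r \<and> openin T (\<Union>U))"

definition quotient_variety :: "'a fspace \<Rightarrow> ('a \<times> 'a) set \<Rightarrow> 'a set fspace" where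
  "quotient_variety X r =
     \<lparr>zariski = quotient_topology (zariski X) r,
      regular_on = (\<lambda>U. {f. (\<lambda>p. f (r `` {p})) \<in> regular_on X (\<Union>U)})\<rparr>"

lemma openin_quotient_topology:
  assumes r: "equiv (topspace T) r"
  shows "openin (quotient_topology T r) U \<longleftrightarrow> U \<subseteq> topspace T // r \<and> openin T (\<Union>U)"
proof -
  let ?Q = "topspace T // r"
  have "istopology (\<lambda>U. U \<subseteq> ?Q \<and> openin T (\<Union>U))"
    unfolding istopology_def
  proof (intro conjI allI impI)
    fix A B
    assume A: "A \<subseteq> ?Q \<and> openin T (\<Union>A)" and B: "B \<subseteq> ?Q \<and> openin T (\<Union>B)"
    show "A \<inter> B \<subseteq> ?Q"
      using A by blast
    have "c \<in> B" if "p \<in> c" "c \<in> A" "p \<in> d" "d \<in> B" for p c d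
    proof -
      have "c = d"
        using quotient_disj[OF r, of c d] A B that by blast
      with that show ?thesis by simp
    qed
    then have "\<Union>(A \<inter> B) = \<Union>A \<inter> \<Union>B"
      by blast
    then show "openin T (\<Union>(A \<inter> B))"
      using A B by (simp add: openin_Int)
  next
    fix K
    assume K: "\<forall>A\<in>K. A \<subseteq> ?Q \<and> openin T (\<Union>A)"
    show "\<Union>K \<subseteq> ?Q"
      using K by blast
    have "\<Union>(\<Union>K) = \<Union>((\<lambda>A. \<Union>A) ` K)"
      by blast
    then show "openin T (\<Union>(\<Union>K))"
      using K by auto
  qed
  then show ?thesis
    unfolding quotient_topology_def by (simp add: topology_inverse')
qed

section \<open>Ind-varieties\<close>

text \<open>
  An ind-variety is given by its filtration, a sequence of varieties; its underlying set is the
  union of their points. That the inclusions of the filtration are closed embeddings is a property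
  of the data that the definition of a morphism does not refer to.
\<close>

type_synonym 'a ind_space = "nat \<Rightarrow> 'a fspace"

definition ind_morphism :: "'a ind_space \<Rightarrow> 'b ind_space \<Rightarrow> ('a \<Rightarrow> 'b) \<Rightarrow> bool" where
  "ind_morphism X Y f \<longleftrightarrow>
     (\<forall>k. \<exists>m. f ` points (X k) \<subseteq> points (Y m) \<and> variety_morphism (X k) (Y m) f)"

definition ind_product :: "'a ind_space \<Rightarrow> 'b ind_space \<Rightarrow> ('a \<times> 'b) ind_space" where
  "ind_product X Y = (\<lambda>k. product_variety (X k) (Y k))"

definition ind_const :: "'a fspace \<Rightarrow> 'a ind_space" where
  "ind_const X = (\<lambda>_. X)"

section \<open>The free algebra on two generators and the automorphisms fixing the commutator\<close>

text \<open>
  Lists form the free monoid, written additively because the product of \<open>Poly_Mapping\<close> is the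
  convolution over an additive monoid of exponents. Hence \<open>free_alg\<close> is the monoid algebra of the
  free monoid on two letters.
\<close>

instantiation list :: (type) monoid_add
begin

definition zero_list :: "'a list" where "zero_list = []"

definition plus_list :: "'a list \<Rightarrow> 'a list \<Rightarrow> 'a list" where "plus_list = (@)"

instance
  by standard (simp_all add: zero_list_def plus_list_def)

end

datatype letter = LX | LY

type_synonym free_alg = "letter list \<Rightarrow>\<^sub>0 complex"

definition gen_x :: free_alg where "gen_x = Poly_Mapping.single [LX] 1"

definition gen_y :: free_alg where "gen_y = Poly_Mapping.single [LY] 1"

definition scalar :: "complex \<Rightarrow> free_alg" where "scalar c = Poly_Mapping.single [] c"

definition commutator :: "free_alg \<Rightarrow> free_alg \<Rightarrow> free_alg" where
  "commutator p q = p * q - q * p"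

definition deg_le :: "nat \<Rightarrow> free_alg set" where
  "deg_le k = {p. \<forall>w \<in> Poly_Mapping.keys p. length w \<le> k}"

definition algebra_automorphism :: "(free_alg \<Rightarrow> free_alg) \<Rightarrow> bool" where
  "algebra_automorphism \<sigma> \<longleftrightarrow> bij \<sigma> \<and>
     (\<forall>p q. \<sigma> (p + q) = \<sigma> p + \<sigma> q) \<and>
     (\<forall>p q. \<sigma> (p * q) = \<sigma> p * \<sigma> q) \<and>
     (\<forall>c. \<sigma> (scalar c) = scalar c)"

definition commutator_automorphisms :: "(free_alg \<Rightarrow> free_alg) monoid" where
  "commutator_automorphisms =
     \<lparr>carrier = {\<sigma>. algebra_automorphism \<sigma> \<and>
        \<sigma> (commutator gen_x gen_y) = commutator gen_x gen_y},
      mult = (\<circ>), one = id\<rparr>"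

text \<open>
  An automorphism \<open>\<sigma>\<close> is identified with the pair \<open>(\<sigma> x, \<sigma> y)\<close>, whose coordinates in the affine
  space of pairs of elements of degree at most \<open>k\<close> are the coefficients of the two components.
\<close>

definition G_filtration :: "(free_alg \<Rightarrow> free_alg) ind_space" where
  "G_filtration k = affine_subspace
     {\<sigma> \<in> carrier commutator_automorphisms. \<sigma> gen_x \<in> deg_le k \<and> \<sigma> gen_y \<in> deg_le k}
     ({(\<lambda>\<sigma>. Poly_Mapping.lookup (\<sigma> gen_x) w) | w. length w \<le> k} \<union>
      {(\<lambda>\<sigma>. Poly_Mapping.lookup (\<sigma> gen_y) w) | w. length w \<le> k})"

lemma UN_points_G_filtration:
  "(\<Union>k. points (G_filtration k)) = carrier commutator_automorphisms"
proof -
  have "\<exists>k. p \<in> deg_le k \<and> q \<in> deg_le k" for p q :: free_alg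
  proof
    let ?k = "Max (length ` (Poly_Mapping.keys p \<union> Poly_Mapping.keys q))"
    show "p \<in> deg_le ?k \<and> q \<in> deg_le ?k"
      unfolding deg_le_def by simp
  qed
  then show ?thesis
    unfolding G_filtration_def points_affine_subspace by (intro equalityI subsetI) auto
qed

section \<open>The Calogero-Moser spaces\<close>

type_synonym mat_pair = "complex mat \<times> complex mat"

fun word_eval :: "nat \<Rightarrow> mat_pair \<Rightarrow> letter list \<Rightarrow> complex mat" where
  "word_eval n P [] = 1\<^sub>m n"
| "word_eval n P (LX # w) = fst P * word_eval n P w"
| "word_eval n P (LY # w) = snd P * word_eval n P w"

text \<open>Substitution \<open>x = X\<close>, \<open>y = Y\<close>; matrix types carry no addition class, so the linear
  combination of the words is formed entrywise.\<close>

definition substitute :: "nat \<Rightarrow> mat_pair \<Rightarrow> free_alg \<Rightarrow> complex mat" where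
  "substitute n P p = mat n n (\<lambda>ij.
     \<Sum>w \<in> Poly_Mapping.keys p. Poly_Mapping.lookup p w * (word_eval n P w $$ ij))"

text \<open>For \<open>n = 0\<close> the rank condition is dropped: the only pair of empty matrices then makes
  the space of index 0 a point.\<close>

definition CM_pairs :: "nat \<Rightarrow> mat_pair set" where
  "CM_pairs n = {(X, Y). X \<in> carrier_mat n n \<and> Y \<in> carrier_mat n n \<and>
     (n = 0 \<or> vec_space.rank n ((X * Y - Y * X) + 1\<^sub>m n) = 1)}"

definition CM_pairs_variety :: "nat \<Rightarrow> mat_pair fspace" where
  "CM_pairs_variety n = affine_subspace (CM_pairs n)
     ({(\<lambda>P. fst P $$ (i, j)) | i j. i < n \<and> j < n} \<union> {(\<lambda>P. snd P $$ (i, j)) | i j. i < n \<and> j < n})"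

text \<open>The orbit relation of \<open>GL\<close>, equivalently of \<open>PGL\<close>, acting by simultaneous conjugation.\<close>

definition conj_rel :: "nat \<Rightarrow> (mat_pair \<times> mat_pair) set" where
  "conj_rel n = {((X, Y), (X', Y')). (X, Y) \<in> CM_pairs n \<and> (X', Y') \<in> CM_pairs n \<and>
     (\<exists>A B. similar_mat_wit X' X A B \<and> similar_mat_wit Y' Y A B)}"

lemma equiv_conj_rel: "equiv (CM_pairs n) (conj_rel n)"
proof (rule equivI)
  show "conj_rel n \<subseteq> CM_pairs n \<times> CM_pairs n"
    unfolding conj_rel_def by auto
  show "refl_on (CM_pairs n) (conj_rel n)"
  proof (rule refl_onI)
    fix P assume P: "P \<in> CM_pairs n"
    obtain X Y where XY: "P = (X, Y)"
      by (cases P)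
    have "X \<in> carrier_mat n n" "Y \<in> carrier_mat n n"
      using P unfolding XY CM_pairs_def by auto
    then have "similar_mat_wit X X (1\<^sub>m n) (1\<^sub>m n)" "similar_mat_wit Y Y (1\<^sub>m n) (1\<^sub>m n)"
      by (simp_all add: similar_mat_wit_refl)
    then show "(P, P) \<in> conj_rel n"
      using P unfolding XY conj_rel_def by auto
  qed
  show "sym (conj_rel n)"
    unfolding sym_def conj_rel_def by (clarsimp, metis similar_mat_wit_sym)
  show "trans (conj_rel n)"
    unfolding trans_def conj_rel_def by (clarsimp, metis similar_mat_wit_trans)
qed

definition CM_space :: "nat \<Rightarrow> mat_pair set fspace" where
  "CM_space n = quotient_variety (CM_pairs_variety n) (conj_rel n)"

lemma points_CM_space: "points (CM_space n) = CM_pairs n // conj_rel n"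
proof -
  have *: "points (CM_pairs_variety n) = CM_pairs n"
    unfolding CM_pairs_variety_def by (rule points_affine_subspace)
  have eq: "equiv (points (CM_pairs_variety n)) (conj_rel n)"
    unfolding * by (rule equiv_conj_rel)
  have "openin (quotient_topology (zariski (CM_pairs_variety n)) (conj_rel n)) U \<longleftrightarrow>
      U \<subseteq> CM_pairs n // conj_rel n \<and> openin (zariski (CM_pairs_variety n)) (\<Union>U)" for U
    using openin_quotient_topology[OF eq] unfolding * .
  note open_iff = this
  have "\<Union>(CM_pairs n // conj_rel n) = points (CM_pairs_variety n)"
    unfolding * by (rule Union_quotient[OF equiv_conj_rel])
  then have "openin (quotient_topology (zariski (CM_pairs_variety n)) (conj_rel n))
      (CM_pairs n // conj_rel n)"
    unfolding open_iff by simp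
  then have "topspace (quotient_topology (zariski (CM_pairs_variety n)) (conj_rel n)) =
      CM_pairs n // conj_rel n"
    using open_iff openin_subset openin_topspace by (metis subset_antisym)
  then show ?thesis
    unfolding CM_space_def quotient_variety_def by simp
qed

definition act_pair :: "nat \<Rightarrow> (free_alg \<Rightarrow> free_alg) \<Rightarrow> mat_pair \<Rightarrow> mat_pair" where
  "act_pair n \<sigma> P =
     (substitute n P (inv_into UNIV \<sigma> gen_x), substitute n P (inv_into UNIV \<sigma> gen_y))"

text \<open>Substitution commutes with simultaneous conjugation, so the image of the orbit of \<open>P\<close> is
  the orbit of \<open>act_pair n \<sigma> P\<close>.\<close>

definition act :: "nat \<Rightarrow> (free_alg \<Rightarrow> free_alg) \<Rightarrow> mat_pair set \<Rightarrow> mat_pair set" where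
  "act n \<sigma> c = act_pair n \<sigma> ` c"

end

theory Submission
  imports Defs
begin

text \<open>
The group part is formal: substitution of matrices is an algebra homomorphism, so
\<open>P \<mapsto> (\<sigma>\<inverse>(x)(P), \<sigma>\<inverse>(y)(P))\<close> is a left action, it commutes with simultaneous conjugation, and it
leaves the value of \<open>[x, y]\<close> unchanged, hence preserves the rank condition. The content is that the
action is a morphism on each piece \<open>G\<^sup>(\<^sup>k\<^sup>) \<times> \<C>\<^sub>n\<close>. Two things need an argument: that \<open>\<sigma>\<inverse>\<close>
depends regularly on \<open>\<sigma>\<close>, and that a regular function on the product with the quotient \<open>\<C>\<^sub>n\<close>
can be recognised on the product with \<open>\<C>\<^sub>n\<close> replaced by the space of pairs of matrices.

The inverse. An automorphism \<open>\<sigma>\<close> induces a polynomial bijection \<open>F\<close> of the affine space of pairs of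
\<open>n \<times> n\<close> matrices, and \<open>\<sigma>\<inverse>\<close> induces its inverse. The degree of \<open>F\<close> is at most \<open>k\<close> for \<open>\<sigma>\<close> in
\<open>G\<^sup>(\<^sup>k\<^sup>)\<close>. The degree of \<open>F\<inverse>\<close> is then bounded in terms of \<open>k\<close> and \<open>n\<close> (\<open>inverse_degree_bound\<close>):
counting dimensions, the components of \<open>F\<close> and a coordinate function \<open>x\<close> satisfy a nontrivial polynomial
relation \<open>Q(F, x) = 0\<close> of bounded degree, so the component \<open>G\<close> of \<open>F\<inverse>\<close> is a root of the polynomial
\<open>Q(z, T)\<close> in \<open>T\<close>, and such a root has bounded degree. So \<open>F\<inverse>\<close> has a number of
coefficients that is bounded on \<open>G\<^sup>(\<^sup>k\<^sup>)\<close>, and they solve the linear system that expresses \<open>F\<inverse>(F(p)) = p\<close> at finitely many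
points \<open>p\<close>. For suitable points the system is nonsingular near a given \<open>\<sigma>\<^sub>0\<close>, and Cramer's
rule shows that the coefficients are regular functions of \<open>\<sigma>\<close> there
(\<open>entry_act_pair_locally_rational\<close>).

The quotient. The projection from pairs of matrices to \<open>\<C>\<^sub>n\<close> has sections that are regular on Zariski
open sets covering \<open>\<C>\<^sub>n\<close> (\<open>CM_space_local_section\<close>). If \<open>M = [X, Y] + 1\<close> has rank one and \<open>M v \<noteq> 0\<close>, then
\<open>M v\<close> is a cyclic vector for \<open>(X, Y)\<close> (\<open>CM_pairs_cyclic\<close>): on the quotient by the invariant subspace
that it generates, \<open>X\<close> and \<open>Y\<close> induce operators with commutator \<open>-1\<close>, and the trace shows that this
quotient is zero. So there are
noncommutative polynomials \<open>p\<^sub>a\<close> for which the vectors \<open>p\<^sub>a(X, Y) M v\<close> form a basis, and they still do so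
nearby. Writing the pair in this basis removes the freedom of conjugation; changing \<open>v\<close> only
rescales the basis, because \<open>M\<close> has rank one, and so the resulting pair of matrices depends on the class alone.

Composing such a section with the action gives, locally on \<open>G\<^sup>(\<^sup>k\<^sup>) \<times> \<C>\<^sub>n\<close>, a lift of the action map to pairs
of matrices whose entries are sums of products of regular functions on the two factors. By
\<open>product_to_quotient_morphism\<close>, the existence of such lifts suffices.
\<close>

section \<open>Polynomial functions and the degree of an inverse map\<close>

text \<open>
Polynomial functions on \<open>\<complex>\<^sup>I\<close> are filtered by the largest exponent of a single variable, not by the
total degree: the monomials are then indexed by a box, which makes them easy to count.
\<close>

definition exponents :: "'i set \<Rightarrow> nat \<Rightarrow> ('i \<Rightarrow> nat) set" where
  "exponents I d = PiE I (\<lambda>_. {..d})"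

definition monomial :: "'i set \<Rightarrow> ('i \<Rightarrow> nat) \<Rightarrow> ('i \<Rightarrow> complex) \<Rightarrow> complex" where
  "monomial I e z = (\<Prod>i\<in>I. z i ^ e i)"

definition box_polys :: "'i set \<Rightarrow> nat \<Rightarrow> (('i \<Rightarrow> complex) \<Rightarrow> complex) set" where
  "box_polys I d = {f. \<exists>q. \<forall>z. f z = (\<Sum>e\<in>exponents I d. q e * monomial I e z)}"

lemma finite_exponents: "finite I \<Longrightarrow> finite (exponents I d)"
  unfolding exponents_def by (simp add: finite_PiE)

lemma card_exponents: "finite I \<Longrightarrow> card (exponents I d) = (d + 1) ^ card I"
  unfolding exponents_def by (simp add: card_PiE)

lemma box_polys_monomial:
  assumes "finite I" "\<And>i. i \<in> I \<Longrightarrow> e i \<le> d"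
  shows "monomial I e \<in> box_polys I d"
proof -
  let ?e = "restrict e I"
  have e: "?e \<in> exponents I d"
    using assms unfolding exponents_def by auto
  have "monomial I e z = (\<Sum>e'\<in>exponents I d. (if e' = ?e then 1 else 0) * monomial I e' z)" for z
  proof -
    have "(\<Sum>e'\<in>exponents I d. (if e' = ?e then 1 else 0) * monomial I e' z) =
        (\<Sum>e'\<in>exponents I d. if e' = ?e then monomial I e' z else 0)"
      by (rule sum.cong) auto
    also have "\<dots> = monomial I ?e z"
      using e finite_exponents[OF assms(1)] by simp
    also have "\<dots> = monomial I e z"
      unfolding monomial_def by (rule prod.cong) auto
    finally show ?thesis by simp
  qed
  then show ?thesis
    unfolding box_polys_def by (intro CollectI exI[of _ "\<lambda>e'. if e' = ?e then 1 else 0"] allI)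
qed

lemma box_polys_zero: "(\<lambda>_. 0) \<in> box_polys I d"
  unfolding box_polys_def by (auto intro: exI[of _ "\<lambda>_. 0"])

lemma box_polys_add:
  assumes "f \<in> box_polys I d" "g \<in> box_polys I d"
  shows "(\<lambda>z. f z + g z) \<in> box_polys I d"
proof -
  obtain q r where "\<And>z. f z = (\<Sum>e\<in>exponents I d. q e * monomial I e z)"
    "\<And>z. g z = (\<Sum>e\<in>exponents I d. r e * monomial I e z)"
    using assms unfolding box_polys_def by blast
  then have "f z + g z = (\<Sum>e\<in>exponents I d. (q e + r e) * monomial I e z)" for z
    by (simp add: sum.distrib distrib_right)
  then show ?thesis
    unfolding box_polys_def by (auto intro!: exI[of _ "\<lambda>e. q e + r e"])
qed

lemma box_polys_scale:
  assumes "f \<in> box_polys I d"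
  shows "(\<lambda>z. c * f z) \<in> box_polys I d"
proof -
  obtain q where "\<And>z. f z = (\<Sum>e\<in>exponents I d. q e * monomial I e z)"
    using assms unfolding box_polys_def by blast
  then have "c * f z = (\<Sum>e\<in>exponents I d. (c * q e) * monomial I e z)" for z
    by (simp add: sum_distrib_left mult.assoc)
  then show ?thesis
    unfolding box_polys_def by (auto intro!: exI[of _ "\<lambda>e. c * q e"])
qed

lemma box_polys_sum:
  assumes "\<And>a. a \<in> A \<Longrightarrow> f a \<in> box_polys I d"
  shows "(\<lambda>z. \<Sum>a\<in>A. f a z) \<in> box_polys I d"
  using assms
proof (induction A rule: infinite_finite_induct)
  case (insert a A)
  then show ?case
    by (simp add: box_polys_add)
qed (simp_all add: box_polys_zero)

lemma box_polys_mono: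
  assumes "finite I" "d \<le> d'" "f \<in> box_polys I d"
  shows "f \<in> box_polys I d'"
proof -
  obtain q where q: "\<And>z. f z = (\<Sum>e\<in>exponents I d. q e * monomial I e z)"
    using assms(3) unfolding box_polys_def by blast
  have "monomial I e \<in> box_polys I d'" if "e \<in> exponents I d" for e
    using that assms(2) unfolding exponents_def
    by (intro box_polys_monomial[OF assms(1)]) (auto simp: PiE_iff intro: order_trans)
  then have "(\<lambda>z. \<Sum>e\<in>exponents I d. q e * monomial I e z) \<in> box_polys I d'"
    by (intro box_polys_sum box_polys_scale)
  moreover have "f = (\<lambda>z. \<Sum>e\<in>exponents I d. q e * monomial I e z)"
    using q by blast
  ultimately show ?thesis by simp
qed

lemma box_polys_mult:
  assumes I: "finite I" and f: "f \<in> box_polys I d" and g: "g \<in> box_polys I d'"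
  shows "(\<lambda>z. f z * g z) \<in> box_polys I (d + d')"
proof -
  obtain q where q: "\<And>z. f z = (\<Sum>e\<in>exponents I d. q e * monomial I e z)"
    using f unfolding box_polys_def by blast
  obtain r where r: "\<And>z. g z = (\<Sum>e\<in>exponents I d'. r e * monomial I e z)"
    using g unfolding box_polys_def by blast
  have "(\<lambda>z. \<Sum>e\<in>exponents I d. \<Sum>e'\<in>exponents I d'.
      (q e * r e') * monomial I (\<lambda>i. e i + e' i) z) \<in> box_polys I (d + d')"
  proof (intro box_polys_sum box_polys_scale box_polys_monomial[OF I])
    fix e e' i
    assume "e \<in> exponents I d" "e' \<in> exponents I d'" "i \<in> I"
    then show "e i + e' i \<le> d + d'"
      unfolding exponents_def by (intro add_mono) (auto simp: PiE_iff)
  qed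
  moreover have "(\<lambda>z. f z * g z) = (\<lambda>z. \<Sum>e\<in>exponents I d. \<Sum>e'\<in>exponents I d'.
      (q e * r e') * monomial I (\<lambda>i. e i + e' i) z)"
    by (rule ext) (simp add: q r sum_product monomial_def power_add prod.distrib mult_ac)
  ultimately show ?thesis by simp
qed

lemma box_polys_const:
  assumes "finite I"
  shows "(\<lambda>_. c) \<in> box_polys I d"
  using box_polys_scale[OF box_polys_monomial[OF assms, of "\<lambda>_. 0" d], of c]
  by (simp add: monomial_def)

lemma box_polys_coordinate:
  assumes "finite I" "i \<in> I" "1 \<le> d"
  shows "(\<lambda>z. z i) \<in> box_polys I d"
proof -
  have "monomial I (\<lambda>j. if j = i then 1 else 0) = (\<lambda>z. z i)"
  proof
    fix z :: "'a \<Rightarrow> complex"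
    have "monomial I (\<lambda>j. if j = i then 1 else 0) z = (\<Prod>j\<in>I. if j = i then z j else 1)"
      unfolding monomial_def by (rule prod.cong) auto
    then show "monomial I (\<lambda>j. if j = i then 1 else 0) z = z i"
      using assms by simp
  qed
  then show ?thesis
    using box_polys_monomial[OF assms(1), of "\<lambda>j. if j = i then 1 else 0" d] assms(3) by simp
qed

lemma box_polys_power:
  assumes "finite I" "f \<in> box_polys I d"
  shows "(\<lambda>z. f z ^ j) \<in> box_polys I (j * d)"
proof (induction j)
  case (Suc j)
  then show ?case
    using box_polys_mult[OF assms(1,2) Suc] by (simp add: add.commute)
qed (simp add: box_polys_const[OF assms(1)])

lemma box_polys_prod:
  assumes "finite I" "finite A" "\<And>a. a \<in> A \<Longrightarrow> f a \<in> box_polys I d"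
  shows "(\<lambda>z. \<Prod>a\<in>A. f a z) \<in> box_polys I (card A * d)"
  using assms(2,3)
proof (induction A)
  case (insert a A)
  then have "f a \<in> box_polys I d" "(\<lambda>z. \<Prod>a\<in>A. f a z) \<in> box_polys I (card A * d)"
    by auto
  from box_polys_mult[OF assms(1) this] insert show ?case
    by (simp add: add.commute)
qed (simp add: box_polys_const[OF assms(1)])

text \<open>
The polynomial identity theorem over \<open>\<complex>\<close>, by induction on the number of variables: with all
variables but one fixed, the sum is a polynomial in the remaining one.
\<close>

lemma monomials_independent:
  assumes "finite I" "\<And>z. (\<Sum>e\<in>exponents I d. q e * monomial I e z) = 0"
    and "e \<in> exponents I d"
  shows "q e = 0"
  using assms
proof (induction I arbitrary: q e)
  case empty
  then show ?case by (simp add: exponents_def monomial_def)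
next
  case (insert i I)
  let ?u = "\<lambda>(j, e). e(i := j)"
  have ex: "exponents (insert i I) d = ?u ` ({..d} \<times> exponents I d)"
    unfolding exponents_def by (rule PiE_insert_eq)
  have inj: "inj_on ?u ({..d} \<times> exponents I d)"
    unfolding exponents_def by (rule inj_combinator[OF insert.hyps(2)])
  have mon: "monomial (insert i I) (e'(i := j)) (z(i := t)) = t ^ j * monomial I e' z" for e' j z t
  proof -
    have "(\<Prod>l\<in>I. (z(i := t)) l ^ (e'(i := j)) l) = monomial I e' z"
      unfolding monomial_def using insert.hyps by (intro prod.cong) auto
    then show ?thesis
      unfolding monomial_def using insert.hyps by simp
  qed
  have zero: "(\<Sum>e'\<in>exponents I d. q (e'(i := j)) * monomial I e' z) = 0" if "j \<le> d" for j z
  proof -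
    have "(\<Sum>j\<le>d. (\<Sum>e'\<in>exponents I d. q (e'(i := j)) * monomial I e' z) * t ^ j) = 0" for t
    proof -
      have "0 = (\<Sum>e\<in>exponents (insert i I) d. q e * monomial (insert i I) e (z(i := t)))"
        using insert.prems(1) by simp
      also have "\<dots> = (\<Sum>(j, e')\<in>{..d} \<times> exponents I d.
          q (e'(i := j)) * monomial (insert i I) (e'(i := j)) (z(i := t)))"
        unfolding ex by (subst sum.reindex[OF inj]) (simp add: case_prod_beta)
      also have "\<dots> = (\<Sum>j\<le>d. \<Sum>e'\<in>exponents I d. q (e'(i := j)) * (t ^ j * monomial I e' z))"
        unfolding mon by (rule sum.cartesian_product[symmetric])
      finally show ?thesis
        by (simp add: sum_distrib_right sum_distrib_left mult_ac)
    qed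
    then show ?thesis
      using that polyfun_eq_0[of "\<lambda>j. \<Sum>e'\<in>exponents I d. q (e'(i := j)) * monomial I e' z" d]
      by blast
  qed
  obtain j e' where je: "j \<le> d" "e' \<in> exponents I d" "e = e'(i := j)"
    using insert.prems(2) unfolding ex by auto
  show ?case
    using insert.IH[of "\<lambda>e'. q (e'(i := j))", OF zero[OF je(1)] je(2)] je(3) by fastforce
qed

lemma monomial_on_line:
  assumes "finite I"
  shows "\<exists>p. \<forall>s. poly p s = monomial I e (\<lambda>i. a i + s * b i)"
proof (intro exI allI)
  fix s
  show "poly (\<Prod>i\<in>I. [:a i, b i:] ^ e i) s = monomial I e (\<lambda>i. a i + s * b i)"
    by (simp add: poly_prod monomial_def)
qed

text \<open>
Restriction to lines is how properties of polynomials in one variable are brought to bear on polynomial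
functions of several variables.
\<close>

lemma monomials_on_line:
  assumes "finite I"
  shows "\<exists>p. \<forall>s. poly p s = (\<Sum>e\<in>A. q e * monomial I e (\<lambda>i. a i + s * b i))"
proof -
  obtain p where "\<And>e s. poly (p e) s = monomial I e (\<lambda>i. a i + s * b i)"
    using monomial_on_line[OF assms, of _ a b] by metis
  then show ?thesis
    by (intro exI[of _ "\<Sum>e\<in>A. Polynomial.smult (q e) (p e)"]) (simp add: poly_sum)
qed

lemma monomial_scaled:
  "monomial I e (\<lambda>i. t * z i) = t ^ (\<Sum>i\<in>I. e i) * monomial I e z"
  unfolding monomial_def by (simp add: power_mult_distrib prod.distrib power_sum)

lemma exponents_total_le:
  assumes "e \<in> exponents I d"
  shows "(\<Sum>i\<in>I. e i) \<le> card I * d"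
proof -
  have "(\<Sum>i\<in>I. e i) \<le> of_nat (card I) * d"
    using assms unfolding exponents_def by (intro sum_bounded_above) (auto simp: PiE_iff)
  then show ?thesis by simp
qed

lemma homogeneous_system_solution:
  fixes r :: "'a \<Rightarrow> 'b \<Rightarrow> 'c :: field"
  assumes "finite B" "finite A" "card B < card A"
  shows "\<exists>q. (\<exists>a\<in>A. q a \<noteq> 0) \<and> (\<forall>b\<in>B. (\<Sum>a\<in>A. q a * r a b) = 0)"
  using assms
proof (induction B arbitrary: A r)
  case empty
  then have "A \<noteq> {}" by auto
  then show ?case by (intro exI[of _ "\<lambda>_. 1"]) auto
next
  case (insert b B)
  show ?case
  proof (cases "\<forall>a\<in>A. r a b = 0")
    case True
    have "card B < card A"
      using insert by simp
    from insert.IH[OF insert.prems(1) this, of r] obtain q where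
      "\<exists>a\<in>A. q a \<noteq> 0" "\<forall>b\<in>B. (\<Sum>a\<in>A. q a * r a b) = 0" by blast
    then show ?thesis
      using True by (intro exI[of _ q]) auto
  next
    case False
    then obtain c where c: "c \<in> A" "r c b \<noteq> 0" by blast
    let ?A = "A - {c}"
    have card: "card B < card ?A" "finite ?A"
      using insert c by auto
    from insert.IH[OF card(2,1), of "\<lambda>a b'. r a b' - r a b / r c b * r c b'"]
    obtain q where q: "\<exists>a\<in>?A. q a \<noteq> 0"
      "\<And>b'. b' \<in> B \<Longrightarrow> (\<Sum>a\<in>?A. q a * (r a b' - r a b / r c b * r c b')) = 0"
      by blast
    \<comment> \<open>the elimination step: \<open>c\<close> is the pivot for the equation \<open>b\<close>\<close>
    define qc where "qc = - (\<Sum>a\<in>?A. q a * r a b) / r c b"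
    define q' where "q' = q(c := qc)"
    have sum: "(\<Sum>a\<in>A. q' a * r a b') = qc * r c b' + (\<Sum>a\<in>?A. q a * r a b')" for b'
      using c(1) insert.prems(1) by (simp add: sum.remove q'_def)
    have "(\<Sum>a\<in>A. q' a * r a b') = 0" if "b' \<in> insert b B" for b'
    proof (cases "b' = b")
      case True
      then show ?thesis
        unfolding sum qc_def using c(2) by simp
    next
      case False
      then have "0 = (\<Sum>a\<in>?A. q a * (r a b' - r a b / r c b * r c b'))"
        using q(2) that by simp
      also have "\<dots> = (\<Sum>a\<in>?A. q a * r a b') - (\<Sum>a\<in>?A. q a * r a b) / r c b * r c b'"
        by (simp add: right_diff_distrib sum_subtractf sum_distrib_left sum_distrib_right
            sum_divide_distrib mult_ac)
      finally show ?thesis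
        unfolding sum qc_def by simp
    qed
    moreover have "\<exists>a\<in>A. q' a \<noteq> 0"
      using q(1) unfolding q'_def by auto
    ultimately show ?thesis by blast
  qed
qed

text \<open>
If the coefficients of a polynomial relation for \<open>g\<close> all have smaller degree than \<open>g\<close>, then the
terms with nonzero coefficient have distinct degrees and cannot cancel.
\<close>

lemma degree_root_le:
  fixes q :: "nat \<Rightarrow> complex poly"
  assumes "(\<Sum>j\<le>m. q j * g ^ j) = 0" "\<And>j. j \<le> m \<Longrightarrow> degree (q j) \<le> D" "D < degree g" "j \<le> m"
  shows "q j = 0"
  using assms
proof (induction m arbitrary: q j)
  case 0
  then show ?case by simp
next
  case (Suc m)
  let ?r = "\<Sum>j\<le>m. q (Suc j) * g ^ j"
  have split: "(\<Sum>j\<le>Suc m. q j * g ^ j) = q 0 + g * ?r"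
    by (subst sum.atMost_Suc_shift) (simp add: sum_distrib_left mult_ac)
  have r: "?r = 0"
  proof (rule ccontr)
    assume r: "?r \<noteq> 0"
    have "g \<noteq> 0"
      using Suc.prems(3) by auto
    then have "degree g \<le> degree (g * ?r)"
      using r by (simp add: degree_mult_eq)
    moreover have "q 0 = - (g * ?r)"
      using Suc.prems(1) split by (simp add: add_eq_0_iff2)
    then have "degree (g * ?r) \<le> D"
      using Suc.prems(2)[of 0] by simp
    ultimately show False
      using Suc.prems(3) by simp
  qed
  then have "q 0 = 0"
    using Suc.prems(1) unfolding split by simp
  moreover have "q (Suc j') = 0" if "j' \<le> m" for j'
    using Suc.IH[of "\<lambda>j. q (Suc j)", OF r _ Suc.prems(3) that] Suc.prems(2) by simp
  ultimately show ?case
    using Suc.prems(4) by (cases j) auto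
qed

text \<open>
There are \<open>card I + 1\<close> functions of \<open>card I\<close> variables. The monomials in them with exponents up to \<open>D\<close>
number \<open>(D + 1) ^ (card I + 1)\<close>, while they lie in a space whose dimension grows only as the power
\<open>card I\<close> of \<open>D\<close>. The stated \<open>D\<close> is large enough for the first number to win, and it does not depend on
the functions.
\<close>

lemma algebraic_relation:
  fixes F :: "'i \<Rightarrow> ('i \<Rightarrow> complex) \<Rightarrow> complex"
  assumes I: "finite I"
    and F: "\<And>i. i \<in> I \<Longrightarrow> F i \<in> box_polys I k" and x: "x \<in> box_polys I k"
    and D: "D = ((card I + 1) * k + 1) ^ card I"
  shows "\<exists>q. (\<exists>e\<in>exponents I D. \<exists>j\<le>D. q e j \<noteq> 0) \<and>
    (\<forall>p. (\<Sum>j\<le>D. (\<Sum>e\<in>exponents I D. q e j * monomial I e (\<lambda>i. F i p)) * x p ^ j) = 0)"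
proof -
  let ?N = "card I"
  define M where "M = (?N + 1) * k * D"
  let ?A = "exponents I D \<times> {..D}"
  have "(\<lambda>p. monomial I e (\<lambda>i. F i p) * x p ^ j) \<in> box_polys I M"
    if "(e, j) \<in> ?A" for e j
  proof -
    have "(\<lambda>p. F i p ^ e i) \<in> box_polys I (D * k)" if i: "i \<in> I" for i
    proof -
      have "e i \<le> D"
        using \<open>(e, j) \<in> ?A\<close> i by (auto simp: exponents_def PiE_iff)
      then show ?thesis
        using box_polys_mono[OF I _ box_polys_power[OF I F[OF i]], of "e i" "D * k"] by simp
    qed
    then have 1: "(\<lambda>p. monomial I e (\<lambda>i. F i p)) \<in> box_polys I (?N * (D * k))"
      unfolding monomial_def by (intro box_polys_prod[OF I I])
    have "j \<le> D"
      using that by simp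
    then have 2: "(\<lambda>p. x p ^ j) \<in> box_polys I (D * k)"
      using box_polys_mono[OF I _ box_polys_power[OF I x], of j "D * k"] by simp
    show ?thesis
      using box_polys_mult[OF I 1 2] unfolding M_def by (simp add: algebra_simps)
  qed
  then have "\<forall>a\<in>?A. \<exists>r. \<forall>p. monomial I (fst a) (\<lambda>i. F i p) * x p ^ snd a =
      (\<Sum>b\<in>exponents I M. r b * monomial I b p)"
    unfolding box_polys_def by fastforce
  then obtain r where r: "\<And>a p. a \<in> ?A \<Longrightarrow> monomial I (fst a) (\<lambda>i. F i p) * x p ^ snd a =
      (\<Sum>b\<in>exponents I M. r a b * monomial I b p)"
    by metis
  have "M + 1 \<le> ((?N + 1) * k + 1) * (D + 1)"
    unfolding M_def by (simp add: algebra_simps)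
  then have "(M + 1) ^ ?N \<le> (((?N + 1) * k + 1) * (D + 1)) ^ ?N"
    by (rule power_mono) simp
  also have "\<dots> = D * (D + 1) ^ ?N"
    unfolding power_mult_distrib D ..
  also have "\<dots> < (D + 1) ^ ?N * (D + 1)"
    by simp
  finally have "card (exponents I M) < card ?A"
    using I by (simp add: card_exponents card_cartesian_product)
  from homogeneous_system_solution[OF _ _ this, of r] obtain q where
    q: "\<exists>a\<in>?A. q a \<noteq> 0" "\<And>b. b \<in> exponents I M \<Longrightarrow> (\<Sum>a\<in>?A. q a * r a b) = 0"
    using I by (auto simp: finite_exponents)
  have "(\<Sum>j\<le>D. (\<Sum>e\<in>exponents I D. q (e, j) * monomial I e (\<lambda>i. F i p)) * x p ^ j) = 0" for p
  proof -
    have "(\<Sum>j\<le>D. (\<Sum>e\<in>exponents I D. q (e, j) * monomial I e (\<lambda>i. F i p)) * x p ^ j) =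
        (\<Sum>e\<in>exponents I D. \<Sum>j\<le>D. q (e, j) * (monomial I e (\<lambda>i. F i p) * x p ^ j))"
      by (subst sum.swap) (simp add: sum_distrib_right mult.assoc)
    also have "\<dots> = (\<Sum>a\<in>?A. q a * (monomial I (fst a) (\<lambda>i. F i p) * x p ^ snd a))"
      by (simp add: sum.cartesian_product case_prod_beta)
    also have "\<dots> = (\<Sum>a\<in>?A. q a * (\<Sum>b\<in>exponents I M. r a b * monomial I b p))"
      using r by (intro sum.cong) simp_all
    also have "\<dots> = (\<Sum>a\<in>?A. \<Sum>b\<in>exponents I M. q a * r a b * monomial I b p)"
      by (simp add: sum_distrib_left mult.assoc)
    also have "\<dots> = (\<Sum>b\<in>exponents I M. (\<Sum>a\<in>?A. q a * r a b) * monomial I b p)"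
      by (subst sum.swap) (simp add: sum_distrib_right)
    also have "\<dots> = 0"
      using q(2) by simp
    finally show ?thesis .
  qed
  then show ?thesis
    using q(1) by (intro exI[of _ "\<lambda>e j. q (e, j)"]) auto
qed

text \<open>
Substituting the inverse map in the algebraic relation between \<open>F\<close> and \<open>x\<close> makes \<open>G\<close> the root of a
polynomial with coefficients of bounded degree. On a line \<open>t \<mapsto> t z\<close> on which these coefficients do not
all vanish, the degree of \<open>G\<close> is bounded by \<open>degree_root_le\<close>; in other words, the homogeneous
components of \<open>G\<close> of high degree vanish at \<open>z\<close>. This happens for generic \<open>z\<close>, hence for all \<open>z\<close>.

The hypothesis asks only that every \<open>z\<close> has a preimage \<open>p\<close> under \<open>F\<close> at which \<open>x\<close> takes the value \<open>G z\<close>; it is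
the form in which surjectivity and the equation \<open>G(F(p)) = x(p)\<close> are both available at once.
\<close>

theorem inverse_degree_bound:
  fixes F :: "'i \<Rightarrow> ('i \<Rightarrow> complex) \<Rightarrow> complex"
  assumes I: "finite I"
    and F: "\<And>i. i \<in> I \<Longrightarrow> F i \<in> box_polys I k" and x: "x \<in> box_polys I k"
    and G: "G \<in> box_polys I L"
    and inv: "\<And>z. \<exists>p. (\<forall>i\<in>I. F i p = z i) \<and> x p = G z"
  shows "G \<in> box_polys I (card I * ((card I + 1) * k + 1) ^ card I)"
proof -
  define D where "D = ((card I + 1) * k + 1) ^ card I"
  let ?D = "card I * D"
  obtain q where q: "\<exists>e\<in>exponents I D. \<exists>j\<le>D. q e j \<noteq> 0" and
    rel: "\<And>p. (\<Sum>j\<le>D. (\<Sum>e\<in>exponents I D. q e j * monomial I e (\<lambda>i. F i p)) * x p ^ j) = 0"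
    using algebraic_relation[OF I _ x D_def, of F] F by auto
  then obtain e0 j0 where q0: "e0 \<in> exponents I D" "j0 \<le> D" "q e0 j0 \<noteq> 0"
    by blast
  define A where "A j z = (\<Sum>e\<in>exponents I D. q e j * monomial I e z)" for j z
  have root: "(\<Sum>j\<le>D. A j z * G z ^ j) = 0" for z
  proof -
    obtain p where p: "\<And>i. i \<in> I \<Longrightarrow> F i p = z i" "x p = G z"
      using inv by blast
    have "monomial I e (\<lambda>i. F i p) = monomial I e z" for e
      unfolding monomial_def using p(1) by simp
    then show ?thesis
      using rel[of p] unfolding A_def p(2) by simp
  qed
  obtain z0 where z0: "A j0 z0 \<noteq> 0"
    using monomials_independent[OF I, where q = "\<lambda>e. q e j0"] q0 unfolding A_def by blast
  obtain g where g: "\<And>z. G z = (\<Sum>e\<in>exponents I L. g e * monomial I e z)"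
    using G unfolding box_polys_def by blast
  let ?deg = "\<lambda>e. \<Sum>i\<in>I. e i"
  define M where "M = card I * L"
  \<comment> \<open>the homogeneous component of degree \<open>d\<close> of \<open>G\<close>\<close>
  define H where "H d z = (\<Sum>e\<in>{e\<in>exponents I L. ?deg e = d}. g e * monomial I e z)" for d z
  have G_scaled: "G (\<lambda>i. t * z i) = (\<Sum>d\<le>M. H d z * t ^ d)" for t z
  proof -
    have "(\<Sum>d\<le>M. H d z * t ^ d) =
        (\<Sum>d\<le>M. \<Sum>e\<in>{e\<in>exponents I L. ?deg e = d}. g e * monomial I e (\<lambda>i. t * z i))"
      unfolding H_def sum_distrib_right
      by (intro sum.cong refl) (simp add: monomial_scaled)
    also have "\<dots> = (\<Sum>e\<in>exponents I L. g e * monomial I e (\<lambda>i. t * z i))"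
      using exponents_total_le[of _ I L]
      by (intro sum.group) (auto simp: M_def finite_exponents[OF I])
    finally show ?thesis
      using g by simp
  qed
  have H0: "H d z = 0" if "A j0 z \<noteq> 0" "?D < d" for d z
  proof (cases "d \<le> M")
    case True
    define \<alpha> where "\<alpha> j = (\<Sum>e\<in>exponents I D. monom (q e j * monomial I e z) (?deg e))" for j
    define \<gamma> where "\<gamma> = (\<Sum>d\<le>M. monom (H d z) d)"
    have \<alpha>: "poly (\<alpha> j) t = A j (\<lambda>i. t * z i)" for j t
      unfolding \<alpha>_def A_def by (simp add: poly_sum poly_monom monomial_scaled mult_ac)
    have \<gamma>: "poly \<gamma> t = G (\<lambda>i. t * z i)" for t
      unfolding \<gamma>_def G_scaled by (simp add: poly_sum poly_monom)
    have "poly (\<Sum>j\<le>D. \<alpha> j * \<gamma> ^ j) t = 0" for t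
      using root by (simp add: poly_sum \<alpha> \<gamma>)
    then have rel0: "(\<Sum>j\<le>D. \<alpha> j * \<gamma> ^ j) = 0"
      using poly_all_0_iff_0 by blast
    have "degree (\<alpha> j) \<le> ?D" for j
      unfolding \<alpha>_def
    proof (rule degree_sum_le[OF finite_exponents[OF I]])
      fix e assume "e \<in> exponents I D"
      then show "degree (monom (q e j * monomial I e z) (?deg e)) \<le> ?D"
        using order_trans[OF degree_monom_le exponents_total_le] by blast
    qed
    moreover have "\<alpha> j0 \<noteq> 0"
      using \<alpha>[of j0 1] that(1) by auto
    ultimately have "degree \<gamma> \<le> ?D"
      using degree_root_le[OF rel0, of ?D j0] q0(2) by force
    then have "coeff \<gamma> d = 0"
      using that(2) by (simp add: coeff_eq_0)
    then show ?thesis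
      unfolding \<gamma>_def using True by (simp add: coeff_sum)
  next
    case False
    then have "{e\<in>exponents I L. ?deg e = d} = {}"
      using exponents_total_le[of _ I L] unfolding M_def by auto
    then show ?thesis
      unfolding H_def by (simp only: sum.empty)
  qed
  \<comment> \<open>on the line from \<open>z0\<close> to \<open>z\<close> the product of \<open>A j0\<close> and \<open>H d\<close> vanishes, and \<open>A j0\<close> does not\<close>
  have H: "H d z = 0" if "?D < d" for d z
  proof -
    obtain p where p: "\<And>s. poly p s = A j0 (\<lambda>i. z0 i + s * (z i - z0 i))"
      using monomials_on_line[OF I] unfolding A_def by metis
    obtain h where h: "\<And>s. poly h s = H d (\<lambda>i. z0 i + s * (z i - z0 i))"
      using monomials_on_line[OF I] unfolding H_def by metis
    have "poly (p * h) s = 0" for s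
      using H0[OF _ that] by (auto simp: p h)
    then have "p * h = 0"
      using poly_all_0_iff_0 by blast
    moreover have "p \<noteq> 0"
      using p[of 0] z0 by auto
    ultimately have "h = 0" by simp
    then show ?thesis
      using h[of 1] by simp
  qed
  have "G z = (\<Sum>e\<in>{e\<in>exponents I L. ?deg e \<le> ?D}. g e * monomial I e z)" for z
  proof -
    have "G z = (\<Sum>d\<le>M. H d z)"
      using G_scaled[of 1 z] by simp
    also have "\<dots> = (\<Sum>d\<in>{..M} \<inter> {..?D}. H d z)"
      by (intro sum.mono_neutral_right) (auto, meson H not_le)
    also have "\<dots> = (\<Sum>d\<le>?D. H d z)"
    proof (intro sum.mono_neutral_left ballI)
      fix d assume "d \<in> {..?D} - {..M} \<inter> {..?D}"
      then have "{e\<in>exponents I L. ?deg e = d} = {}"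
        using exponents_total_le[of _ I L] unfolding M_def by auto
      then show "H d z = 0"
        unfolding H_def by (simp only: sum.empty)
    qed auto
    also have "\<dots> = (\<Sum>d\<le>?D. \<Sum>e\<in>{e\<in>{e\<in>exponents I L. ?deg e \<le> ?D}. ?deg e = d}.
        g e * monomial I e z)"
      unfolding H_def by (intro sum.cong) auto
    also have "\<dots> = (\<Sum>e\<in>{e\<in>exponents I L. ?deg e \<le> ?D}. g e * monomial I e z)"
      by (intro sum.group) (auto simp: finite_exponents[OF I])
    finally show ?thesis .
  qed
  moreover have "(\<lambda>z. \<Sum>e\<in>{e\<in>exponents I L. ?deg e \<le> ?D}. g e * monomial I e z)
      \<in> box_polys I ?D"
  proof (intro box_polys_sum box_polys_scale box_polys_monomial[OF I])
    fix e i
    assume "e \<in> {e\<in>exponents I L. ?deg e \<le> ?D}" "i \<in> I"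
    then show "e i \<le> ?D"
      using member_le_sum[of i I e] I by auto
  qed
  ultimately show ?thesis
    unfolding D_def by presburger
qed

section \<open>Substitution of matrices and the group action\<close>

definition matrix_pairs :: "nat \<Rightarrow> mat_pair set" where
  "matrix_pairs n = carrier_mat n n \<times> carrier_mat n n"

lemma matrix_pairs_iff [simp]:
  "(X, Y) \<in> matrix_pairs n \<longleftrightarrow> X \<in> carrier_mat n n \<and> Y \<in> carrier_mat n n"
  unfolding matrix_pairs_def by simp

lemma matrix_pairsD:
  assumes "P \<in> matrix_pairs n"
  shows "fst P \<in> carrier_mat n n" "snd P \<in> carrier_mat n n"
  using assms unfolding matrix_pairs_def by auto

lemma CM_pairs_subset: "CM_pairs n \<subseteq> matrix_pairs n"
  unfolding CM_pairs_def by auto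

lemma word_eval_carrier [simp]:
  assumes "P \<in> matrix_pairs n"
  shows "word_eval n P w \<in> carrier_mat n n"
proof (induction w)
  case (Cons l w)
  then show ?case
    using matrix_pairsD[OF assms] by (cases l) auto
qed simp

lemma word_eval_append:
  assumes "P \<in> matrix_pairs n"
  shows "word_eval n P (u @ w) = word_eval n P u * word_eval n P w"
proof (induction u)
  case Nil
  then show ?case
    using word_eval_carrier[OF assms, of w] by simp
next
  case (Cons l u)
  then show ?case
    using matrix_pairsD[OF assms] word_eval_carrier[OF assms, of u] word_eval_carrier[OF assms, of w]
    by (cases l) (auto simp: assoc_mult_mat[of _ n n _ n _ n])
qed

lemma substitute_carrier [simp]: "substitute n P p \<in> carrier_mat n n"
  unfolding substitute_def by simp

lemma substitute_dim [simp]: "dim_row (substitute n P p) = n" "dim_col (substitute n P p) = n"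
  unfolding substitute_def by simp_all

lemma substitute_entry:
  assumes "finite A" "Poly_Mapping.keys p \<subseteq> A" "i < n" "j < n"
  shows "substitute n P p $$ (i, j) =
    (\<Sum>w\<in>A. Poly_Mapping.lookup p w * word_eval n P w $$ (i, j))"
proof -
  have "substitute n P p $$ (i, j) =
      (\<Sum>w\<in>Poly_Mapping.keys p. Poly_Mapping.lookup p w * word_eval n P w $$ (i, j))"
    using assms unfolding substitute_def by simp
  also have "\<dots> = (\<Sum>w\<in>A. Poly_Mapping.lookup p w * word_eval n P w $$ (i, j))"
    using assms by (intro sum.mono_neutral_left) (auto simp: in_keys_iff)
  finally show ?thesis .
qed

lemma substitute_zero: "substitute n P 0 = 0\<^sub>m n n"
  by (rule eq_matI) (auto simp: substitute_entry[of "{}"])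

lemma substitute_add: "substitute n P (p + q) = substitute n P p + substitute n P q"
proof (rule eq_matI)
  fix i j assume "i < dim_row (substitute n P p + substitute n P q)"
    "j < dim_col (substitute n P p + substitute n P q)"
  then have ij: "i < n" "j < n" by auto
  let ?A = "Poly_Mapping.keys p \<union> Poly_Mapping.keys q"
  have "finite ?A" "Poly_Mapping.keys (p + q) \<subseteq> ?A"
    by (auto simp: in_keys_iff lookup_add)
  then show "substitute n P (p + q) $$ (i, j) = (substitute n P p + substitute n P q) $$ (i, j)"
    using ij by (simp add: substitute_entry[of ?A] lookup_add sum.distrib distrib_right)
qed auto

lemma substitute_single:
  assumes "P \<in> matrix_pairs n"
  shows "substitute n P (Poly_Mapping.single w c) = c \<cdot>\<^sub>m word_eval n P w"
  using word_eval_carrier[OF assms, of w]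
  by (intro eq_matI) (auto simp: substitute_entry[of "{w}"])

text \<open>
Every identity that is linear in an element of the free algebra reduces to the case of a multiple of a word.
\<close>

lemma poly_mapping_single_induct [case_names zero add_single]:
  fixes p :: "'a \<Rightarrow>\<^sub>0 'b :: comm_monoid_add"
  assumes "Q 0" "\<And>w c p. Q p \<Longrightarrow> Q (Poly_Mapping.single w c + p)"
  shows "Q p"
proof -
  have "Q (\<Sum>w\<in>A. Poly_Mapping.single w (Poly_Mapping.lookup p w))" if "finite A" for A
    using that by (induction A) (simp_all add: assms)
  moreover have "p = (\<Sum>w\<in>Poly_Mapping.keys p. Poly_Mapping.single w (Poly_Mapping.lookup p w))"
  proof (rule poly_mapping_eqI)
    fix v
    have "(\<Sum>w\<in>Poly_Mapping.keys p. Poly_Mapping.lookup p w when w = v) =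
        (\<Sum>w\<in>Poly_Mapping.keys p. if w = v then Poly_Mapping.lookup p v else 0)"
      by (intro sum.cong) auto
    then show "Poly_Mapping.lookup p v = Poly_Mapping.lookup
        (\<Sum>w\<in>Poly_Mapping.keys p. Poly_Mapping.single w (Poly_Mapping.lookup p w)) v"
      by (simp add: lookup_sum lookup_single in_keys_iff)
  qed
  ultimately show ?thesis
    by (metis finite_keys)
qed

lemma substitute_mult_single:
  assumes P: "P \<in> matrix_pairs n"
  shows "substitute n P (Poly_Mapping.single w c * q) = c \<cdot>\<^sub>m word_eval n P w * substitute n P q"
proof (induction q rule: poly_mapping_single_induct)
  case zero
  then show ?case
    using word_eval_carrier[OF P, of w] by (simp add: substitute_zero)
next
  case (add_single v d q)
  have W: "word_eval n P w \<in> carrier_mat n n" "word_eval n P v \<in> carrier_mat n n"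
    using P by simp_all
  have "substitute n P (Poly_Mapping.single w c * (Poly_Mapping.single v d + q)) =
      (c * d) \<cdot>\<^sub>m (word_eval n P w * word_eval n P v) + c \<cdot>\<^sub>m word_eval n P w * substitute n P q"
    by (simp add: distrib_left mult_single substitute_add substitute_single[OF P] add_single
        plus_list_def word_eval_append[OF P])
  also have "(c * d) \<cdot>\<^sub>m (word_eval n P w * word_eval n P v) =
      c \<cdot>\<^sub>m word_eval n P w * (d \<cdot>\<^sub>m word_eval n P v)"
    using W by (intro eq_matI) (auto simp: mult_smult_distrib[of _ n n _ n]
        mult_smult_assoc_mat[of _ n n _ n])
  also have "\<dots> + c \<cdot>\<^sub>m word_eval n P w * substitute n P q =
      c \<cdot>\<^sub>m word_eval n P w * substitute n P (Poly_Mapping.single v d + q)"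
    unfolding substitute_add substitute_single[OF P]
    using W by (intro mult_add_distrib_mat[symmetric, of _ n n _ n]) auto
  finally show ?case .
qed

lemma substitute_mult:
  assumes P: "P \<in> matrix_pairs n"
  shows "substitute n P (p * q) = substitute n P p * substitute n P q"
proof (induction p rule: poly_mapping_single_induct)
  case zero
  then show ?case by (simp add: substitute_zero)
next
  case (add_single w c p)
  have "word_eval n P w \<in> carrier_mat n n"
    using P by simp
  then show ?case
    by (simp add: distrib_right substitute_add substitute_mult_single[OF P] add_single
        substitute_single[OF P] add_mult_distrib_mat[of _ n n _ _ n])
qed

lemma substitute_diff: "substitute n P (p - q) = substitute n P p - substitute n P q"
proof (rule eq_matI)
  fix i j assume "i < dim_row (substitute n P p - substitute n P q)"
    "j < dim_col (substitute n P p - substitute n P q)"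
  then have ij: "i < n" "j < n" by auto
  let ?A = "Poly_Mapping.keys p \<union> Poly_Mapping.keys q"
  have "finite ?A" "Poly_Mapping.keys (p - q) \<subseteq> ?A"
    by (auto simp: in_keys_iff lookup_minus)
  then show "substitute n P (p - q) $$ (i, j) = (substitute n P p - substitute n P q) $$ (i, j)"
    using ij by (simp add: substitute_entry[of ?A] lookup_minus sum_subtractf left_diff_distrib)
qed auto

lemma substitute_gen:
  assumes "P \<in> matrix_pairs n"
  shows "substitute n P gen_x = fst P" "substitute n P gen_y = snd P"
  using matrix_pairsD[OF assms] unfolding gen_x_def gen_y_def substitute_single[OF assms]
  by (auto intro!: eq_matI)

lemma substitute_commutator:
  assumes "P \<in> matrix_pairs n"
  shows "substitute n P (commutator p q) =
    substitute n P p * substitute n P q - substitute n P q * substitute n P p"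
  unfolding commutator_def substitute_diff substitute_mult[OF assms] ..

lemma word_eval_conj:
  assumes AB: "A \<in> carrier_mat n n" "B \<in> carrier_mat n n" "A * B = 1\<^sub>m n" "B * A = 1\<^sub>m n"
    and XY: "X \<in> carrier_mat n n" "Y \<in> carrier_mat n n"
  shows "word_eval n (A * X * B, A * Y * B) w = A * word_eval n (X, Y) w * B"
proof (induction w)
  case Nil
  then show ?case using AB by simp
next
  case (Cons l w)
  have W: "word_eval n (X, Y) w \<in> carrier_mat n n"
    using XY by simp
  have "A * Z * B * (A * word_eval n (X, Y) w * B) = A * (Z * word_eval n (X, Y) w) * B"
    if Z: "Z \<in> carrier_mat n n" for Z
  proof -
    have "A * Z * B * (A * word_eval n (X, Y) w * B) =
        A * (Z * ((B * A) * word_eval n (X, Y) w)) * B"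
      using AB(1,2) Z W by (simp add: assoc_mult_mat[of _ n n _ n _ n])
    then show ?thesis
      using AB(4) W by simp
  qed
  then show ?case
    using Cons XY by (cases l) simp_all
qed

lemma substitute_conj:
  assumes AB: "A \<in> carrier_mat n n" "B \<in> carrier_mat n n" "A * B = 1\<^sub>m n" "B * A = 1\<^sub>m n"
    and XY: "X \<in> carrier_mat n n" "Y \<in> carrier_mat n n"
  shows "substitute n (A * X * B, A * Y * B) p = A * substitute n (X, Y) p * B"
proof (induction p rule: poly_mapping_single_induct)
  case zero
  then show ?case using AB by (simp add: substitute_zero)
next
  case (add_single w c p)
  have P: "(X, Y) \<in> matrix_pairs n" "(A * X * B, A * Y * B) \<in> matrix_pairs n"
    using AB XY by simp_all
  have W: "word_eval n (X, Y) w \<in> carrier_mat n n"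
    using P by simp
  have "A * (c \<cdot>\<^sub>m word_eval n (X, Y) w) * B = c \<cdot>\<^sub>m (A * word_eval n (X, Y) w * B)"
    using AB W by (simp add: mult_smult_distrib[of _ n n _ n] mult_smult_assoc_mat[of _ n n _ n])
  moreover have "A * (c \<cdot>\<^sub>m word_eval n (X, Y) w + substitute n (X, Y) p) * B =
      A * (c \<cdot>\<^sub>m word_eval n (X, Y) w) * B + A * substitute n (X, Y) p * B"
    using AB W by (simp add: mult_add_distrib_mat[of _ n n _ n] add_mult_distrib_mat[of _ n n _ _ n])
  ultimately show ?case
    unfolding substitute_add substitute_single[OF P(1)] substitute_single[OF P(2)]
      word_eval_conj[OF AB XY] add_single by simp
qed

definition algebra_endomorphism :: "(free_alg \<Rightarrow> free_alg) \<Rightarrow> bool" where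
  "algebra_endomorphism \<tau> \<longleftrightarrow>
     (\<forall>p q. \<tau> (p + q) = \<tau> p + \<tau> q) \<and> (\<forall>p q. \<tau> (p * q) = \<tau> p * \<tau> q) \<and>
     (\<forall>c. \<tau> (scalar c) = scalar c)"

text \<open>
The map on pairs of matrices induced by an endomorphism of the free algebra. It is contravariant in
\<open>\<tau>\<close>, which is why the group acts through inverses.
\<close>

definition pull :: "nat \<Rightarrow> (free_alg \<Rightarrow> free_alg) \<Rightarrow> mat_pair \<Rightarrow> mat_pair" where
  "pull n \<tau> P = (substitute n P (\<tau> gen_x), substitute n P (\<tau> gen_y))"

lemma pull_matrix_pairs [simp]: "pull n \<tau> P \<in> matrix_pairs n"
  unfolding pull_def by simp

lemma substitute_pull:
  assumes \<tau>: "algebra_endomorphism \<tau>" and P: "P \<in> matrix_pairs n"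
  shows "substitute n (pull n \<tau> P) p = substitute n P (\<tau> p)"
proof (induction p rule: poly_mapping_single_induct)
  case zero
  have "\<tau> 0 + \<tau> 0 = \<tau> 0 + 0"
    using \<tau> unfolding algebra_endomorphism_def by (metis add.right_neutral)
  then have "\<tau> 0 = 0"
    by (simp only: add_left_cancel)
  then show ?case
    by (simp add: substitute_zero)
next
  case (add_single w c p)
  have word: "substitute n (pull n \<tau> P) (Poly_Mapping.single w c) =
      substitute n P (\<tau> (Poly_Mapping.single w c))"
  proof (induction w)
    case Nil
    then show ?case
      using \<tau> substitute_single[OF P, of "[]" c] substitute_single[of "pull n \<tau> P" n "[]" c]
      unfolding algebra_endomorphism_def scalar_def by simp
  next
    case (Cons l w)
    have X: "Poly_Mapping.single (LX # w) c = gen_x * Poly_Mapping.single w c"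
      and Y: "Poly_Mapping.single (LY # w) c = gen_y * Poly_Mapping.single w c"
      unfolding gen_x_def gen_y_def by (simp_all add: mult_single plus_list_def)
    have "\<tau> (p * q) = \<tau> p * \<tau> q" for p q
      using \<tau> unfolding algebra_endomorphism_def by blast
    then show ?case
      by (cases l) (simp_all add: X Y substitute_mult P Cons substitute_gen,
          simp_all add: pull_def)
  qed
  have "\<tau> (p + q) = \<tau> p + \<tau> q" for p q
    using \<tau> unfolding algebra_endomorphism_def by blast
  then show ?case
    by (simp add: substitute_add word add_single)
qed

lemma pull_compose:
  assumes "algebra_endomorphism \<sigma>" "P \<in> matrix_pairs n"
  shows "pull n \<tau> (pull n \<sigma> P) = pull n (\<sigma> \<circ> \<tau>) P"
  unfolding pull_def[of n \<tau>] substitute_pull[OF assms] by (simp add: pull_def)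

lemma pull_id: "P \<in> matrix_pairs n \<Longrightarrow> pull n id P = P"
  unfolding pull_def by (simp add: substitute_gen)

lemma pull_conj:
  assumes "A \<in> carrier_mat n n" "B \<in> carrier_mat n n" "A * B = 1\<^sub>m n" "B * A = 1\<^sub>m n"
    and "X \<in> carrier_mat n n" "Y \<in> carrier_mat n n"
  shows "pull n \<tau> (A * X * B, A * Y * B) =
    (A * fst (pull n \<tau> (X, Y)) * B, A * snd (pull n \<tau> (X, Y)) * B)"
  unfolding pull_def substitute_conj[OF assms] by simp

text \<open>
The commutator of the image is the value of \<open>\<tau>([x, y]) = [x, y]\<close>, that is, the commutator of the
original pair, so the rank condition is literally the same.
\<close>

lemma pull_CM_pairs:
  assumes \<tau>: "algebra_endomorphism \<tau>" "\<tau> (commutator gen_x gen_y) = commutator gen_x gen_y"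
    and P: "P \<in> CM_pairs n"
  shows "pull n \<tau> P \<in> CM_pairs n"
proof -
  have P': "P \<in> matrix_pairs n"
    using P CM_pairs_subset by blast
  let ?P' = "pull n \<tau> P"
  have "fst ?P' * snd ?P' - snd ?P' * fst ?P' = substitute n ?P' (commutator gen_x gen_y)"
    by (simp add: substitute_commutator substitute_gen)
  also have "\<dots> = substitute n P (commutator gen_x gen_y)"
    unfolding substitute_pull[OF \<tau>(1) P'] \<tau>(2) ..
  also have "\<dots> = fst P * snd P - snd P * fst P"
    by (simp add: substitute_commutator substitute_gen P')
  finally show ?thesis
    using P matrix_pairsD[OF pull_matrix_pairs[of n \<tau> P]] unfolding CM_pairs_def
    by (auto simp: case_prod_beta)
qed

lemma conj_rel_iff:
  "((X, Y), Q) \<in> conj_rel n \<longleftrightarrow> (X, Y) \<in> CM_pairs n \<and> Q \<in> CM_pairs n \<and>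
     (\<exists>A\<in>carrier_mat n n. \<exists>B\<in>carrier_mat n n. A * B = 1\<^sub>m n \<and> B * A = 1\<^sub>m n \<and>
        Q = (A * X * B, A * Y * B))" (is "?l \<longleftrightarrow> ?r")
proof
  assume l: ?l
  obtain X' Y' where Q: "Q = (X', Y')" by (cases Q)
  obtain A B where s: "similar_mat_wit X' X A B" "similar_mat_wit Y' Y A B"
    and c: "(X, Y) \<in> CM_pairs n" "(X', Y') \<in> CM_pairs n"
    using l unfolding Q conj_rel_def by auto
  have "X' \<in> carrier_mat n n" "Y' \<in> carrier_mat n n"
    using c unfolding CM_pairs_def by auto
  from similar_mat_witD2[OF this(1) s(1)] similar_mat_witD2[OF this(2) s(2)] c
  show ?r unfolding Q by auto
next
  assume r: ?r
  then obtain A B where AB: "A \<in> carrier_mat n n" "B \<in> carrier_mat n n" "A * B = 1\<^sub>m n"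
    "B * A = 1\<^sub>m n" and Q: "Q = (A * X * B, A * Y * B)"
    by blast
  have XY: "X \<in> carrier_mat n n" "Y \<in> carrier_mat n n"
    using r unfolding CM_pairs_def by auto
  have "similar_mat_wit (A * X * B) X A B" "similar_mat_wit (A * Y * B) Y A B"
    by (rule similar_mat_witI[of _ _ n]; use AB XY in auto)+
  then show ?l
    using r unfolding Q conj_rel_def by auto
qed

lemma pull_conj_rel:
  assumes \<tau>: "algebra_endomorphism \<tau>" "\<tau> (commutator gen_x gen_y) = commutator gen_x gen_y"
    and PQ: "(P, Q) \<in> conj_rel n"
  shows "(pull n \<tau> P, pull n \<tau> Q) \<in> conj_rel n"
proof -
  obtain X Y where P: "P = (X, Y)" by (cases P)
  obtain A B where AB: "A \<in> carrier_mat n n" "B \<in> carrier_mat n n" "A * B = 1\<^sub>m n"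
    "B * A = 1\<^sub>m n" and Q: "Q = (A * X * B, A * Y * B)" and c: "P \<in> CM_pairs n" "Q \<in> CM_pairs n"
    using PQ unfolding P conj_rel_iff by blast
  have XY: "X \<in> carrier_mat n n" "Y \<in> carrier_mat n n"
    using c unfolding P CM_pairs_def by auto
  have "pull n \<tau> Q = (A * fst (pull n \<tau> P) * B, A * snd (pull n \<tau> P) * B)"
    unfolding Q P by (rule pull_conj[OF AB XY])
  then show ?thesis
    using conj_rel_iff[of "fst (pull n \<tau> P)" "snd (pull n \<tau> P)"] AB
      pull_CM_pairs[OF \<tau> c(1)] pull_CM_pairs[OF \<tau> c(2)] by auto
qed

abbreviation G_auts :: "(free_alg \<Rightarrow> free_alg) set" where
  "G_auts \<equiv> carrier commutator_automorphisms"

lemma G_auts_iff: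
  "\<sigma> \<in> G_auts \<longleftrightarrow> bij \<sigma> \<and> algebra_endomorphism \<sigma> \<and>
     \<sigma> (commutator gen_x gen_y) = commutator gen_x gen_y"
  unfolding commutator_automorphisms_def algebra_automorphism_def algebra_endomorphism_def by auto

lemma G_auts_inv:
  assumes "\<sigma> \<in> G_auts"
  shows "inv_into UNIV \<sigma> \<in> G_auts"
proof -
  have b: "bij \<sigma>" and e: "\<And>p q. \<sigma> (p + q) = \<sigma> p + \<sigma> q" "\<And>p q. \<sigma> (p * q) = \<sigma> p * \<sigma> q"
    "\<And>c. \<sigma> (scalar c) = scalar c" "\<sigma> (commutator gen_x gen_y) = commutator gen_x gen_y"
    using assms unfolding G_auts_iff algebra_endomorphism_def by auto
  have s: "\<sigma> (inv_into UNIV \<sigma> p) = p" for p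
    using b by (simp add: bij_is_surj surj_f_inv_f)
  have i: "inv_into UNIV \<sigma> p = q" if "\<sigma> q = p" for p q
    using that b by (metis bij_inv_eq_iff)
  show ?thesis
    unfolding G_auts_iff algebra_endomorphism_def
    using b by (auto intro!: i simp: e s bij_imp_bij_inv)
qed

lemma group_commutator_automorphisms: "group commutator_automorphisms"
proof (rule groupI)
  fix \<sigma> \<tau> assume "\<sigma> \<in> G_auts" "\<tau> \<in> G_auts"
  then show "\<sigma> \<otimes>\<^bsub>commutator_automorphisms\<^esub> \<tau> \<in> G_auts"
    unfolding G_auts_iff algebra_endomorphism_def
    by (simp add: commutator_automorphisms_def bij_comp)
next
  show "\<one>\<^bsub>commutator_automorphisms\<^esub> \<in> G_auts"
    unfolding G_auts_iff algebra_endomorphism_def by (simp add: commutator_automorphisms_def)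
next
  fix \<sigma> assume \<sigma>: "\<sigma> \<in> G_auts"
  then have "inv_into UNIV \<sigma> \<circ> \<sigma> = id"
    unfolding G_auts_iff by (simp add: bij_is_inj)
  then show "\<exists>\<tau>\<in>G_auts. \<tau> \<otimes>\<^bsub>commutator_automorphisms\<^esub> \<sigma> = \<one>\<^bsub>commutator_automorphisms\<^esub>"
    using G_auts_inv[OF \<sigma>] by (intro bexI) (auto simp: commutator_automorphisms_def)
qed (auto simp: commutator_automorphisms_def)

lemma act_pair_pull: "act_pair n \<sigma> P = pull n (inv_into UNIV \<sigma>) P"
  unfolding act_pair_def pull_def ..

lemma act_pair_conj_rel:
  assumes "\<sigma> \<in> G_auts" "(P, Q) \<in> conj_rel n"
  shows "(act_pair n \<sigma> P, act_pair n \<sigma> Q) \<in> conj_rel n"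
  using pull_conj_rel G_auts_inv[OF assms(1)] assms(2) unfolding act_pair_pull G_auts_iff by blast

lemma act_pair_CM_pairs:
  assumes "\<sigma> \<in> G_auts" "P \<in> CM_pairs n"
  shows "act_pair n \<sigma> P \<in> CM_pairs n"
  using pull_CM_pairs G_auts_inv[OF assms(1)] assms(2) unfolding act_pair_pull G_auts_iff by blast

lemma pull_act_pair:
  assumes "\<sigma> \<in> G_auts" "P \<in> matrix_pairs n"
  shows "pull n \<sigma> (act_pair n \<sigma> P) = P" "act_pair n \<sigma> (pull n \<sigma> P) = P"
proof -
  have "inv_into UNIV \<sigma> \<circ> \<sigma> = id" "\<sigma> \<circ> inv_into UNIV \<sigma> = id"
    using assms unfolding G_auts_iff by (auto simp: bij_is_inj surj_iff[symmetric] bij_is_surj)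
  moreover have "algebra_endomorphism (inv_into UNIV \<sigma>)" "algebra_endomorphism \<sigma>"
    using assms G_auts_inv[OF assms(1)] unfolding G_auts_iff by auto
  ultimately show "pull n \<sigma> (act_pair n \<sigma> P) = P" "act_pair n \<sigma> (pull n \<sigma> P) = P"
    unfolding act_pair_pull using assms(2) by (simp_all add: pull_compose pull_id)
qed

text \<open>
Equivariance gives one inclusion; the other is equivariance of the inverse map.
\<close>

lemma act_class:
  assumes \<sigma>: "\<sigma> \<in> G_auts" and P: "P \<in> CM_pairs n"
  shows "act n \<sigma> (conj_rel n `` {P}) = conj_rel n `` {act_pair n \<sigma> P}"
proof (intro equalityI subsetI)
  fix Q assume "Q \<in> act n \<sigma> (conj_rel n `` {P})"
  then show "Q \<in> conj_rel n `` {act_pair n \<sigma> P}"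
    unfolding act_def using act_pair_conj_rel[OF \<sigma>] by auto
next
  fix Q assume Q: "Q \<in> conj_rel n `` {act_pair n \<sigma> P}"
  have \<sigma>': "algebra_endomorphism \<sigma>" "\<sigma> (commutator gen_x gen_y) = commutator gen_x gen_y"
    using \<sigma> unfolding G_auts_iff by auto
  have "(pull n \<sigma> (act_pair n \<sigma> P), pull n \<sigma> Q) \<in> conj_rel n"
    using pull_conj_rel[OF \<sigma>'] Q by auto
  moreover have "P \<in> matrix_pairs n" "Q \<in> matrix_pairs n"
    using P Q CM_pairs_subset equiv_conj_rel[of n] by (auto simp: equiv_def)
  ultimately show "Q \<in> act n \<sigma> (conj_rel n `` {P})"
    unfolding act_def using pull_act_pair[OF \<sigma>] by (metis Image_singleton_iff image_eqI)
qed

lemma act_points: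
  assumes "\<sigma> \<in> G_auts" "c \<in> points (CM_space n)"
  shows "act n \<sigma> c \<in> points (CM_space n)"
  using assms act_pair_CM_pairs[OF assms(1)] unfolding points_CM_space quotient_def
  by (auto simp: act_class)

lemma act_comp:
  assumes \<sigma>: "\<sigma> \<in> G_auts" and \<tau>: "\<tau> \<in> G_auts" and c: "c \<in> points (CM_space n)"
  shows "act n (\<sigma> \<circ> \<tau>) c = act n \<sigma> (act n \<tau> c)"
proof -
  have inv: "inv_into UNIV (\<sigma> \<circ> \<tau>) = inv_into UNIV \<tau> \<circ> inv_into UNIV \<sigma>"
    using \<sigma> \<tau> unfolding G_auts_iff by (intro o_inv_distrib) auto
  have "algebra_endomorphism (inv_into UNIV \<tau>)"
    using G_auts_inv[OF \<tau>] unfolding G_auts_iff by blast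
  then have "act_pair n (\<sigma> \<circ> \<tau>) P = act_pair n \<sigma> (act_pair n \<tau> P)" if "P \<in> matrix_pairs n" for P
    unfolding act_pair_pull inv using that by (simp add: pull_compose)
  moreover have "P \<in> matrix_pairs n" if "P \<in> c" for P
    using c that CM_pairs_subset Union_quotient[OF equiv_conj_rel[of n]]
    unfolding points_CM_space by blast
  ultimately show ?thesis
    unfolding act_def image_image by (intro image_cong) auto
qed

theorem group_action_CM_space:
  "group_action commutator_automorphisms (points (CM_space n))
     (\<lambda>\<sigma>. \<lambda>c \<in> points (CM_space n). act n \<sigma> c)"
proof -
  let ?E = "points (CM_space n)"
  have id: "act n id c = c" if "c \<in> ?E" for c
  proof -
    have "act_pair n id P = P" if "P \<in> c" for P
      using that \<open>c \<in> ?E\<close> CM_pairs_subset Union_quotient[OF equiv_conj_rel[of n]]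
        pull_id[of P n] unfolding points_CM_space act_pair_pull inv_id by blast
    then show ?thesis
      unfolding act_def by simp
  qed
  have bij: "restrict (act n \<sigma>) ?E \<in> Bij ?E" if \<sigma>: "\<sigma> \<in> G_auts" for \<sigma>
  proof -
    let ?\<tau> = "inv_into UNIV \<sigma>"
    have \<tau>: "?\<tau> \<in> G_auts"
      by (rule G_auts_inv[OF \<sigma>])
    have "\<sigma> \<circ> ?\<tau> = id" "?\<tau> \<circ> \<sigma> = id"
      using \<sigma> unfolding G_auts_iff by (auto simp: bij_is_inj surj_iff[symmetric] bij_is_surj)
    then have "act n \<sigma> (act n ?\<tau> c) = c" "act n ?\<tau> (act n \<sigma> c) = c" if "c \<in> ?E" for c
      using act_comp[OF \<sigma> \<tau> that] act_comp[OF \<tau> \<sigma> that] id[OF that] by auto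
    then have "bij_betw (act n \<sigma>) ?E ?E"
      using act_points[OF \<sigma>] act_points[OF \<tau>]
      by (intro bij_betw_byWitness[of _ "act n ?\<tau>"]) auto
    then show ?thesis
      unfolding Bij_def by (auto simp: bij_betw_def inj_on_def)
  qed
  show ?thesis
    unfolding group_action_def
  proof (rule group_hom.intro[OF group_commutator_automorphisms group_BijGroup])
    show "group_hom_axioms commutator_automorphisms (BijGroup ?E) (\<lambda>\<sigma>. restrict (act n \<sigma>) ?E)"
    proof (rule group_hom_axioms.intro, rule homI)
      fix \<sigma> assume "\<sigma> \<in> G_auts"
      then show "restrict (act n \<sigma>) ?E \<in> carrier (BijGroup ?E)"
        using bij unfolding BijGroup_def by simp
    next
      fix \<sigma> \<tau> assume \<sigma>: "\<sigma> \<in> G_auts" and \<tau>: "\<tau> \<in> G_auts"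
      have "restrict (act n (\<sigma> \<circ> \<tau>)) ?E = compose ?E (restrict (act n \<sigma>) ?E) (restrict (act n \<tau>) ?E)"
        unfolding compose_def using act_comp[OF \<sigma> \<tau>] act_points[OF \<tau>] by (intro ext) auto
      then show "restrict (act n (\<sigma> \<otimes>\<^bsub>commutator_automorphisms\<^esub> \<tau>)) ?E =
          restrict (act n \<sigma>) ?E \<otimes>\<^bsub>BijGroup ?E\<^esub> restrict (act n \<tau>) ?E"
        using bij[OF \<sigma>] bij[OF \<tau>] unfolding BijGroup_def
        by (simp add: commutator_automorphisms_def)
    qed
  qed
qed

section \<open>Morphisms from a product to a quotient\<close>

text \<open>
Regular functions, polynomial functions and tensor functions are all closed under the same operations; the
closure properties, in particular under determinants and cofactors, are derived once for the three.
\<close>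

definition function_algebra :: "('a \<Rightarrow> complex) set \<Rightarrow> bool" where
  "function_algebra A \<longleftrightarrow> (\<forall>c. (\<lambda>_. c) \<in> A) \<and>
     (\<forall>f\<in>A. \<forall>g\<in>A. (\<lambda>p. f p + g p) \<in> A \<and> (\<lambda>p. f p * g p) \<in> A)"

context
  fixes A :: "('a \<Rightarrow> complex) set"
  assumes A: "function_algebra A"
begin

lemma function_algebra_const: "(\<lambda>_. c) \<in> A"
  using A unfolding function_algebra_def by blast

lemma function_algebra_add: "f \<in> A \<Longrightarrow> g \<in> A \<Longrightarrow> (\<lambda>p. f p + g p) \<in> A"
  using A unfolding function_algebra_def by blast

lemma function_algebra_mult: "f \<in> A \<Longrightarrow> g \<in> A \<Longrightarrow> (\<lambda>p. f p * g p) \<in> A"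
  using A unfolding function_algebra_def by blast

lemma function_algebra_sum: "(\<And>i. i \<in> I \<Longrightarrow> f i \<in> A) \<Longrightarrow> (\<lambda>p. \<Sum>i\<in>I. f i p) \<in> A"
  by (induction I rule: infinite_finite_induct)
    (simp_all add: function_algebra_const function_algebra_add)

lemma function_algebra_prod: "(\<And>i. i \<in> I \<Longrightarrow> f i \<in> A) \<Longrightarrow> (\<lambda>p. \<Prod>i\<in>I. f i p) \<in> A"
  by (induction I rule: infinite_finite_induct)
    (simp_all add: function_algebra_const function_algebra_mult)

lemma function_algebra_power: "f \<in> A \<Longrightarrow> (\<lambda>p. f p ^ k) \<in> A"
  by (induction k) (simp_all add: function_algebra_const function_algebra_mult)

lemma function_algebra_det:
  assumes "\<And>p. M p \<in> carrier_mat n n" "\<And>i j. i < n \<Longrightarrow> j < n \<Longrightarrow> (\<lambda>p. M p $$ (i, j)) \<in> A"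
  shows "(\<lambda>p. Determinant.det (M p)) \<in> A"
proof -
  have "\<pi> i < n" if "\<pi> permutes {0..<n}" "i < n" for \<pi> i
    using permutes_in_image[OF that(1), of i] that(2) by simp
  then have "(\<lambda>p. \<Sum>\<pi>\<in>{\<pi>. \<pi> permutes {0..<n}}. of_int (sign \<pi>) * (\<Prod>i = 0..<n. M p $$ (i, \<pi> i))) \<in> A"
    by (intro function_algebra_sum function_algebra_mult function_algebra_const
        function_algebra_prod assms(2)) simp_all
  then show ?thesis
    unfolding det_def'[OF assms(1)] .
qed

lemma function_algebra_cofactor:
  assumes "\<And>p. M p \<in> carrier_mat n n" "\<And>i j. i < n \<Longrightarrow> j < n \<Longrightarrow> (\<lambda>p. M p $$ (i, j)) \<in> A"
    and "i < n" "j < n"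
  shows "(\<lambda>p. cofactor (M p) i j) \<in> A"
  unfolding cofactor_def
proof (intro function_algebra_mult function_algebra_const function_algebra_det)
  show "mat_delete (M p) i j \<in> carrier_mat (n - 1) (n - 1)" for p
    using assms(1)[of p] unfolding mat_delete_def by auto
  fix i' j' assume "i' < n - 1" "j' < n - 1"
  then show "(\<lambda>p. mat_delete (M p) i j $$ (i', j')) \<in> A"
    using assms(1) unfolding mat_delete_def
    by (auto simp: carrier_matD[OF assms(1)] intro!: assms(2))
qed

lemma function_algebra_polynomial:
  assumes "h \<in> polynomial_functions \<Phi>" "\<And>\<phi>. \<phi> \<in> \<Phi> \<Longrightarrow> (\<lambda>q. \<phi> (\<Theta> q)) \<in> A"
  shows "(\<lambda>q. h (\<Theta> q)) \<in> A"
  using assms(1)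
  by induction (simp_all add: assms(2) function_algebra_const function_algebra_add
      function_algebra_mult)

end

lemma function_algebra_polynomial_functions: "function_algebra (polynomial_functions \<Phi>)"
  unfolding function_algebra_def by (simp add: polynomial_functions.intros)

lemma openin_generated_by_basis:
  assumes base: "\<And>A B p. A \<in> \<B> \<Longrightarrow> B \<in> \<B> \<Longrightarrow> p \<in> A \<inter> B \<Longrightarrow> \<exists>C\<in>\<B>. p \<in> C \<and> C \<subseteq> A \<inter> B"
  shows "openin (topology_generated_by \<B>) U \<longleftrightarrow> (\<forall>p\<in>U. \<exists>B\<in>\<B>. p \<in> B \<and> B \<subseteq> U)"
proof
  assume "openin (topology_generated_by \<B>) U"
  then have "generate_topology_on \<B> U"
    by (simp add: openin_topology_generated_by_iff)
  then show "\<forall>p\<in>U. \<exists>B\<in>\<B>. p \<in> B \<and> B \<subseteq> U"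
  proof induction
    case (Int V W)
    show ?case
    proof
      fix p assume p: "p \<in> V \<inter> W"
      obtain B where B: "B \<in> \<B>" "p \<in> B" "B \<subseteq> V"
        using Int.IH(1) p by blast
      obtain C where C: "C \<in> \<B>" "p \<in> C" "C \<subseteq> W"
        using Int.IH(2) p by blast
      obtain E where "E \<in> \<B>" "p \<in> E" "E \<subseteq> B \<inter> C"
        using base[OF B(1) C(1), of p] B(2) C(2) by blast
      then show "\<exists>B\<in>\<B>. p \<in> B \<and> B \<subseteq> V \<inter> W"
        using B(3) C(3) by blast
    qed
  next
    case (UN K)
    show ?case
    proof
      fix p assume "p \<in> \<Union>K"
      then obtain V where "V \<in> K" "p \<in> V" by blast
      moreover from this UN.IH[of V] obtain B where "B \<in> \<B>" "p \<in> B" "B \<subseteq> V" by blast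
      ultimately show "\<exists>B\<in>\<B>. p \<in> B \<and> B \<subseteq> \<Union>K"
        by (intro bexI[of _ B]) auto
    qed
  next
    case (Basis B)
    then show ?case by (intro ballI bexI[of _ B]) auto
  qed simp
next
  assume U: "\<forall>p\<in>U. \<exists>B\<in>\<B>. p \<in> B \<and> B \<subseteq> U"
  have "openin (topology_generated_by \<B>) (\<Union>{B \<in> \<B>. B \<subseteq> U})"
    by (rule openin_Union) (auto intro: topology_generated_by_Basis)
  moreover have "U = \<Union>{B \<in> \<B>. B \<subseteq> U}"
  proof
    show "U \<subseteq> \<Union>{B \<in> \<B>. B \<subseteq> U}"
    proof
      fix p assume "p \<in> U"
      then obtain B where "B \<in> \<B>" "p \<in> B" "B \<subseteq> U"
        using U by blast
      then show "p \<in> \<Union>{B \<in> \<B>. B \<subseteq> U}"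
        by (intro UnionI[of B]) simp_all
    qed
  qed auto
  ultimately show "openin (topology_generated_by \<B>) U"
    by simp
qed

lemma openin_affine_subspace:
  "openin (zariski (affine_subspace S \<Phi>)) U \<longleftrightarrow> U \<subseteq> S \<and>
    (\<forall>p\<in>U. \<exists>h\<in>polynomial_functions \<Phi>. h p \<noteq> 0 \<and> {q \<in> S. h q \<noteq> 0} \<subseteq> U)"
proof -
  let ?B = "{{p \<in> S. h p \<noteq> 0} | h. h \<in> polynomial_functions \<Phi>}"
  have "\<exists>C\<in>?B. p \<in> C \<and> C \<subseteq> A \<inter> B" if AB: "A \<in> ?B" "B \<in> ?B" "p \<in> A \<inter> B" for A B p
  proof -
    obtain g h where gh: "A = {p \<in> S. g p \<noteq> 0}" "g \<in> polynomial_functions \<Phi>"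
      "B = {p \<in> S. h p \<noteq> 0}" "h \<in> polynomial_functions \<Phi>"
      using AB by blast
    have "{p \<in> S. g p * h p \<noteq> 0} \<in> ?B"
      using polynomial_functions.mult[OF gh(2,4)]
      by (intro CollectI exI[of _ "\<lambda>p. g p * h p"] conjI refl)
    moreover have "A \<inter> B = {p \<in> S. g p * h p \<noteq> 0}"
      unfolding gh(1,3) by auto
    ultimately show ?thesis
      using AB(3) by (intro bexI[of _ "A \<inter> B"]) auto
  qed
  from openin_generated_by_basis[of ?B, OF this]
  have "openin (zariski (affine_subspace S \<Phi>)) U \<longleftrightarrow> (\<forall>p\<in>U. \<exists>B\<in>?B. p \<in> B \<and> B \<subseteq> U)"
    unfolding affine_subspace_def Let_def by simp
  moreover have "(\<exists>B\<in>?B. p \<in> B \<and> B \<subseteq> U) \<longleftrightarrow>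
      p \<in> S \<and> (\<exists>h\<in>polynomial_functions \<Phi>. h p \<noteq> 0 \<and> {q \<in> S. h q \<noteq> 0} \<subseteq> U)" for p
  proof
    assume "\<exists>B\<in>?B. p \<in> B \<and> B \<subseteq> U"
    then obtain h where "h \<in> polynomial_functions \<Phi>" "p \<in> {q \<in> S. h q \<noteq> 0}"
      "{q \<in> S. h q \<noteq> 0} \<subseteq> U"
      by auto
    then show "p \<in> S \<and> (\<exists>h\<in>polynomial_functions \<Phi>. h p \<noteq> 0 \<and> {q \<in> S. h q \<noteq> 0} \<subseteq> U)"
      by (intro conjI bexI[of _ h]) simp_all
  next
    assume "p \<in> S \<and> (\<exists>h\<in>polynomial_functions \<Phi>. h p \<noteq> 0 \<and> {q \<in> S. h q \<noteq> 0} \<subseteq> U)"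
    then obtain h where "h \<in> polynomial_functions \<Phi>" "p \<in> {q \<in> S. h q \<noteq> 0}"
      "{q \<in> S. h q \<noteq> 0} \<subseteq> U"
      by auto
    then show "\<exists>B\<in>?B. p \<in> B \<and> B \<subseteq> U"
      by (intro bexI[of _ "{q \<in> S. h q \<noteq> 0}"] conjI CollectI exI[of _ h]) simp_all
  qed
  ultimately show ?thesis
    by (simp add: ball_conj_distrib subset_eq[of U S])
qed

lemma openin_principal:
  assumes "h \<in> polynomial_functions \<Phi>"
  shows "openin (zariski (affine_subspace S \<Phi>)) {q \<in> S. h q \<noteq> 0}"
  unfolding openin_affine_subspace using assms by auto

lemma regular_on_affine_subspace:
  "f \<in> regular_on (affine_subspace S \<Phi>) U \<longleftrightarrow>
    (\<forall>p\<in>U. \<exists>N. openin (zariski (affine_subspace S \<Phi>)) N \<and> p \<in> N \<and> N \<subseteq> U \<and>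
      (\<exists>g\<in>polynomial_functions \<Phi>. \<exists>h\<in>polynomial_functions \<Phi>. \<forall>q\<in>N. h q \<noteq> 0 \<and> f q = g q / h q))"
  unfolding affine_subspace_def Let_def by simp

lemma function_algebra_regular_on_affine:
  assumes U: "openin (zariski (affine_subspace S \<Phi>)) U"
  shows "function_algebra (regular_on (affine_subspace S \<Phi>) U)"
proof -
  let ?X = "affine_subspace S \<Phi>"
  have const: "(\<lambda>_. c) \<in> regular_on ?X U" for c
    unfolding regular_on_affine_subspace
  proof (intro ballI exI[of _ U] conjI)
    show "\<exists>g\<in>polynomial_functions \<Phi>. \<exists>h\<in>polynomial_functions \<Phi>. \<forall>q\<in>U. h q \<noteq> 0 \<and> c = g q / h q"
      by (rule bexI[of _ "\<lambda>_. c"], rule bexI[of _ "\<lambda>_. 1"]) (auto intro: polynomial_functions.const)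
  qed (use U in auto)
  have "(\<lambda>p. f p + g p) \<in> regular_on ?X U \<and> (\<lambda>p. f p * g p) \<in> regular_on ?X U"
    if f: "f \<in> regular_on ?X U" and g: "g \<in> regular_on ?X U" for f g
  proof -
    have "\<exists>N. openin (zariski ?X) N \<and> p \<in> N \<and> N \<subseteq> U \<and>
        (\<exists>a\<in>polynomial_functions \<Phi>. \<exists>b\<in>polynomial_functions \<Phi>. \<exists>h\<in>polynomial_functions \<Phi>.
          \<forall>q\<in>N. h q \<noteq> 0 \<and> f q + g q = a q / h q \<and> f q * g q = b q / h q)" if p: "p \<in> U" for p
    proof -
      obtain N a b where N: "openin (zariski ?X) N" "p \<in> N" "N \<subseteq> U"
        "a \<in> polynomial_functions \<Phi>" "b \<in> polynomial_functions \<Phi>"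
        "\<And>q. q \<in> N \<Longrightarrow> b q \<noteq> 0 \<and> f q = a q / b q"
        using f p unfolding regular_on_affine_subspace by meson
      obtain N' a' b' where N': "openin (zariski ?X) N'" "p \<in> N'" "N' \<subseteq> U"
        "a' \<in> polynomial_functions \<Phi>" "b' \<in> polynomial_functions \<Phi>"
        "\<And>q. q \<in> N' \<Longrightarrow> b' q \<noteq> 0 \<and> g q = a' q / b' q"
        using g p unfolding regular_on_affine_subspace by meson
      show ?thesis
      proof (intro exI[of _ "N \<inter> N'"] conjI)
        show "openin (zariski ?X) (N \<inter> N')"
          using N N' by (simp add: openin_Int)
        show "\<exists>u\<in>polynomial_functions \<Phi>. \<exists>v\<in>polynomial_functions \<Phi>. \<exists>h\<in>polynomial_functions \<Phi>.
          \<forall>q\<in>N \<inter> N'. h q \<noteq> 0 \<and> f q + g q = u q / h q \<and> f q * g q = v q / h q"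
        proof (intro bexI ballI conjI)
          fix q assume "q \<in> N \<inter> N'"
          then have nz: "b q \<noteq> 0" "b' q \<noteq> 0" and eq: "f q = a q / b q" "g q = a' q / b' q"
            using N(6)[of q] N'(6)[of q] by auto
          show "b q * b' q \<noteq> 0" "f q + g q = (a q * b' q + a' q * b q) / (b q * b' q)"
            "f q * g q = (a q * a' q) / (b q * b' q)"
            using nz by (simp_all add: eq add_frac_eq)
        qed (intro polynomial_functions.intros N N')+
      qed (use N N' in auto)
    qed
    then show ?thesis
      unfolding regular_on_affine_subspace by meson
  qed
  then show ?thesis
    unfolding function_algebra_def using const by blast
qed

lemma quotient_of_polynomials_regular:
  assumes "openin (zariski (affine_subspace S \<Phi>)) U"
    and "g \<in> polynomial_functions \<Phi>" "h \<in> polynomial_functions \<Phi>"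
    and "\<And>q. q \<in> U \<Longrightarrow> h q \<noteq> 0 \<and> f q = g q / h q"
  shows "f \<in> regular_on (affine_subspace S \<Phi>) U"
  unfolding regular_on_affine_subspace using assms by blast

context
  fixes S :: "'a set" and \<Phi> :: "('a \<Rightarrow> complex) set" and r :: "('a \<times> 'a) set"
  assumes r: "equiv S r"
begin

lemma openin_quotient_affine:
  "openin (zariski (quotient_variety (affine_subspace S \<Phi>) r)) U \<longleftrightarrow>
    U \<subseteq> S // r \<and> openin (zariski (affine_subspace S \<Phi>)) (\<Union>U)"
  using openin_quotient_topology[of "zariski (affine_subspace S \<Phi>)" r U] r
  unfolding quotient_variety_def points_affine_subspace by simp

lemma points_quotient_affine:
  "points (quotient_variety (affine_subspace S \<Phi>) r) = S // r"
proof
  show "points (quotient_variety (affine_subspace S \<Phi>) r) \<subseteq> S // r"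
    using openin_quotient_affine openin_topspace by blast
  have "openin (zariski (affine_subspace S \<Phi>)) S"
    using openin_topspace points_affine_subspace by metis
  then have "openin (zariski (quotient_variety (affine_subspace S \<Phi>) r)) (S // r)"
    unfolding openin_quotient_affine using Union_quotient[OF r] by simp
  then show "S // r \<subseteq> points (quotient_variety (affine_subspace S \<Phi>) r)"
    by (rule openin_subset)
qed

lemma regular_on_quotient:
  "f \<in> regular_on (quotient_variety (affine_subspace S \<Phi>) r) U \<longleftrightarrow>
    (\<lambda>p. f (r `` {p})) \<in> regular_on (affine_subspace S \<Phi>) (\<Union>U)"
  unfolding quotient_variety_def by simp

lemma function_algebra_regular_on_quotient:
  assumes "openin (zariski (quotient_variety (affine_subspace S \<Phi>) r)) U"
  shows "function_algebra (regular_on (quotient_variety (affine_subspace S \<Phi>) r) U)"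
proof -
  have alg: "function_algebra (regular_on (affine_subspace S \<Phi>) (\<Union>U))"
    using function_algebra_regular_on_affine assms unfolding openin_quotient_affine by blast
  show ?thesis
    unfolding function_algebra_def[of "regular_on (quotient_variety _ _) _"]
    by (simp add: regular_on_quotient function_algebra_const[OF alg] function_algebra_add[OF alg]
        function_algebra_mult[OF alg])
qed

end

lemma tensor_functions_sumI:
  assumes "finite A" "\<And>a. a \<in> A \<Longrightarrow> f a \<in> regular_on X U" "\<And>a. a \<in> A \<Longrightarrow> g a \<in> regular_on Y V"
  shows "(\<lambda>(u, v). \<Sum>a\<in>A. f a u * g a v) \<in> tensor_functions X Y U V"
proof -
  obtain b where b: "bij_betw b {..<card A} A"
    using ex_bij_betw_nat_finite[OF assms(1)] by (auto simp: atLeast0LessThan)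
  have "b i \<in> A" if "i < card A" for i
    using b that by (auto simp: bij_betw_def)
  moreover have "(\<Sum>a\<in>A. f a u * g a v) = (\<Sum>i<card A. f (b i) u * g (b i) v)" for u v
    using sum.reindex_bij_betw[OF b, of "\<lambda>a. f a u * g a v"] by simp
  ultimately show ?thesis
    unfolding tensor_functions_def using assms(2,3)
    by (intro CollectI exI[of _ "card A"] exI[of _ "\<lambda>i. f (b i)"] exI[of _ "\<lambda>i. g (b i)"]) auto
qed

lemma function_algebra_tensor_functions:
  assumes X: "function_algebra (regular_on X U)" and Y: "function_algebra (regular_on Y V)"
  shows "function_algebra (tensor_functions X Y U V)"
proof -
  have const: "(\<lambda>_. c) \<in> tensor_functions X Y U V" for c
    using tensor_functions_sumI[of "{()}" "\<lambda>_ _. c" X U "\<lambda>_ _. 1" Y V]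
      function_algebra_const[OF X] function_algebra_const[OF Y]
    by (simp add: case_prod_beta')
  have "(\<lambda>p. s p + t p) \<in> tensor_functions X Y U V \<and> (\<lambda>p. s p * t p) \<in> tensor_functions X Y U V"
    if st: "s \<in> tensor_functions X Y U V" "t \<in> tensor_functions X Y U V" for s t
  proof -
    obtain m f g where s: "s = (\<lambda>(u, v). \<Sum>i<(m::nat). f i u * g i v)"
      "\<And>i. i < m \<Longrightarrow> f i \<in> regular_on X U" "\<And>i. i < m \<Longrightarrow> g i \<in> regular_on Y V"
      using st(1) unfolding tensor_functions_def by blast
    obtain m' f' g' where t: "t = (\<lambda>(u, v). \<Sum>i<(m'::nat). f' i u * g' i v)"
      "\<And>i. i < m' \<Longrightarrow> f' i \<in> regular_on X U" "\<And>i. i < m' \<Longrightarrow> g' i \<in> regular_on Y V"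
      using st(2) unfolding tensor_functions_def by blast
    have "(\<lambda>(u, v). \<Sum>a\<in>{..<m} <+> {..<m'}. case_sum f f' a u * case_sum g g' a v)
        \<in> tensor_functions X Y U V"
      using s t by (intro tensor_functions_sumI) auto
    moreover have "(\<lambda>(u, v). \<Sum>a\<in>{..<m} <+> {..<m'}. case_sum f f' a u * case_sum g g' a v) =
        (\<lambda>p. s p + t p)"
      unfolding s(1) t(1) by (rule ext) (auto simp: sum.Plus)
    moreover have "(\<lambda>(u, v). \<Sum>a\<in>{..<m} \<times> {..<m'}.
        (f (fst a) u * f' (snd a) u) * (g (fst a) v * g' (snd a) v)) \<in> tensor_functions X Y U V"
      using s t by (intro tensor_functions_sumI function_algebra_mult[OF X]
          function_algebra_mult[OF Y]) auto
    moreover have "(\<lambda>(u, v). \<Sum>a\<in>{..<m} \<times> {..<m'}.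
        (f (fst a) u * f' (snd a) u) * (g (fst a) v * g' (snd a) v)) = (\<lambda>p. s p * t p)"
    proof (rule ext, clarify)
      fix u v
      have "s (u, v) * t (u, v) =
          (\<Sum>(i, j)\<in>{..<m} \<times> {..<m'}. (f i u * g i v) * (f' j u * g' j v))"
        unfolding s(1) t(1) prod.case sum_product sum.cartesian_product ..
      also have "\<dots> = (\<Sum>a\<in>{..<m} \<times> {..<m'}.
          (f (fst a) u * f' (snd a) u) * (g (fst a) v * g' (snd a) v))"
        by (rule sum.cong) (auto simp: mult_ac)
      finally show "(\<Sum>a\<in>{..<m} \<times> {..<m'}.
          (f (fst a) u * f' (snd a) u) * (g (fst a) v * g' (snd a) v)) = s (u, v) * t (u, v)"
        by simp
    qed
    ultimately show ?thesis by simp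
  qed
  then show ?thesis
    unfolding function_algebra_def using const by blast
qed

lemma openin_product_variety:
  assumes "openin (zariski X) U" "openin (zariski Y) V" "t \<in> tensor_functions X Y U V"
  shows "openin (zariski (product_variety X Y)) {p \<in> U \<times> V. t p \<noteq> 0}"
  unfolding product_variety_def Let_def using assms
  by (auto intro!: topology_generated_by_Basis)

lemma points_product_variety:
  assumes X: "\<And>U. openin (zariski X) U \<Longrightarrow> function_algebra (regular_on X U)"
    and Y: "\<And>V. openin (zariski Y) V \<Longrightarrow> function_algebra (regular_on Y V)"
  shows "points (product_variety X Y) = points X \<times> points Y"
proof
  show "points (product_variety X Y) \<subseteq> points X \<times> points Y"
    unfolding product_variety_def Let_def by (auto dest: openin_subset)
  have "function_algebra (tensor_functions X Y (points X) (points Y))"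
    by (intro function_algebra_tensor_functions X Y) auto
  from function_algebra_const[OF this, of 1]
  show "points X \<times> points Y \<subseteq> points (product_variety X Y)"
    using openin_subset[OF openin_product_variety[of X "points X" Y "points Y" "\<lambda>_. 1"]] by simp
qed

lemma regular_on_product_variety:
  "f \<in> regular_on (product_variety X Y) W \<longleftrightarrow>
    (\<forall>p\<in>W. \<exists>N U V. openin (zariski (product_variety X Y)) N \<and> p \<in> N \<and> N \<subseteq> W \<and>
      openin (zariski X) U \<and> openin (zariski Y) V \<and> N \<subseteq> U \<times> V \<and>
      (\<exists>s\<in>tensor_functions X Y U V. \<exists>t\<in>tensor_functions X Y U V.
        \<forall>q\<in>N. t q \<noteq> 0 \<and> f q = s q / t q))"
  unfolding product_variety_def Let_def by simp

text \<open>
A map into a quotient is a morphism as soon as it lifts locally to a map \<open>\<Theta>\<close> into the affine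
space of \<open>S\<close> with tensor functions as coordinates. Polynomials in the coordinates pull back along
\<open>\<Theta>\<close> to tensor functions. Hence preimages of principal open sets are basic open sets of the
product, and local fractions of polynomials become local fractions of tensor functions.
\<close>

theorem product_to_quotient_morphism:
  fixes X :: "'x fspace" and Y :: "'y fspace" and S :: "'s set" and \<Phi>
  defines "Z \<equiv> affine_subspace S \<Phi>"
  assumes X: "\<And>U. openin (zariski X) U \<Longrightarrow> function_algebra (regular_on X U)"
    and Y: "\<And>V. openin (zariski Y) V \<Longrightarrow> function_algebra (regular_on Y V)"
    and r: "equiv S r"
    and lift: "\<And>p. p \<in> points X \<times> points Y \<Longrightarrow> \<exists>U V \<Theta>. openin (zariski X) U \<and> openin (zariski Y) V \<and>
      p \<in> U \<times> V \<and> (\<forall>q\<in>U \<times> V. \<Theta> q \<in> S \<and> \<mu> q = r `` {\<Theta> q}) \<and>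
      (\<forall>\<phi>\<in>\<Phi>. (\<lambda>q. \<phi> (\<Theta> q)) \<in> tensor_functions X Y U V)"
  shows "variety_morphism (product_variety X Y) (quotient_variety Z r) \<mu>"
proof -
  let ?P = "product_variety X Y" and ?Q = "quotient_variety Z r"
  have points: "points ?P = points X \<times> points Y"
    by (rule points_product_variety; rule X Y)
  have mem: "P \<in> \<Union>W \<longleftrightarrow> r `` {P} \<in> W" if P: "P \<in> S" and W: "W \<subseteq> S // r" for P W
  proof
    assume "P \<in> \<Union>W"
    then obtain c where c: "P \<in> c" "c \<in> W" by blast
    then obtain Q where Q: "c = r `` {Q}"
      using W by (auto elim!: quotientE)
    then have "c = r `` {P}"
      using c(1) equiv_class_eq[OF r, of Q P] by simp
    then show "r `` {P} \<in> W" using c by simp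
  next
    assume "r `` {P} \<in> W"
    then show "P \<in> \<Union>W"
      using equiv_class_self[OF r P] by blast
  qed
  have local: "\<exists>N U V. openin (zariski ?P) N \<and> p \<in> N \<and> N \<subseteq> {p \<in> points ?P. \<mu> p \<in> W} \<and>
      openin (zariski X) U \<and> openin (zariski Y) V \<and> N \<subseteq> U \<times> V \<and>
      (\<exists>s\<in>tensor_functions X Y U V. \<exists>t\<in>tensor_functions X Y U V.
        \<forall>q\<in>N. t q \<noteq> 0 \<and> f (\<mu> q) = s q / t q)"
    if W: "openin (zariski ?Q) W" and f: "f \<in> regular_on ?Q W"
      and p: "p \<in> {p \<in> points ?P. \<mu> p \<in> W}" for W f p
  proof -
    have W: "W \<subseteq> S // r" "openin (zariski Z) (\<Union>W)"
      using W unfolding Z_def openin_quotient_affine[OF r] by auto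
    have f: "(\<lambda>p. f (r `` {p})) \<in> regular_on Z (\<Union>W)"
      using f unfolding Z_def regular_on_quotient[OF r] .
    have "p \<in> points X \<times> points Y"
      using p unfolding points by simp
    from lift[OF this] obtain U V \<Theta> where UV: "openin (zariski X) U" "openin (zariski Y) V" "p \<in> U \<times> V"
      and \<Theta>': "\<forall>q\<in>U \<times> V. \<Theta> q \<in> S \<and> \<mu> q = r `` {\<Theta> q}"
      "\<forall>\<phi>\<in>\<Phi>. (\<lambda>q. \<phi> (\<Theta> q)) \<in> tensor_functions X Y U V"
      by (elim exE conjE) (rule that)
    note \<Theta> = bspec[OF \<Theta>'(1)] bspec[OF \<Theta>'(2)]
    have "\<Theta> p \<in> \<Union>W"
      using mem[OF _ W(1)] \<Theta>(1)[OF UV(3)] p by auto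
    then obtain N a b where N: "openin (zariski Z) N" "\<Theta> p \<in> N" "N \<subseteq> \<Union>W"
      "a \<in> polynomial_functions \<Phi>" "b \<in> polynomial_functions \<Phi>"
      "\<And>q. q \<in> N \<Longrightarrow> b q \<noteq> 0 \<and> f (r `` {q}) = a q / b q"
      using f unfolding Z_def regular_on_affine_subspace by meson
    then obtain h where h: "h \<in> polynomial_functions \<Phi>" "h (\<Theta> p) \<noteq> 0" "{q \<in> S. h q \<noteq> 0} \<subseteq> N"
      unfolding Z_def openin_affine_subspace by blast
    have poly: "(\<lambda>q. g (\<Theta> q)) \<in> tensor_functions X Y U V" if "g \<in> polynomial_functions \<Phi>" for g
      by (rule function_algebra_polynomial[OF function_algebra_tensor_functions[OF X[OF UV(1)]
            Y[OF UV(2)]] that \<Theta>(2)])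
    let ?N = "{q \<in> U \<times> V. h (\<Theta> q) \<noteq> 0}"
    have open_N: "openin (zariski ?P) ?N"
      by (rule openin_product_variety[OF UV(1,2) poly[OF h(1)]])
    have in_N: "\<Theta> q \<in> N" if "q \<in> ?N" for q
      using that \<Theta>(1) h(3) by blast
    have "\<mu> q \<in> W" if "q \<in> ?N" for q
      using in_N[OF that] N(3) \<Theta>(1)[of q] that mem[OF _ W(1), of "\<Theta> q"] by auto
    then have "?N \<subseteq> {p \<in> points ?P. \<mu> p \<in> W}"
      using openin_subset[OF open_N] by blast
    moreover have "b (\<Theta> q) \<noteq> 0 \<and> f (\<mu> q) = a (\<Theta> q) / b (\<Theta> q)" if "q \<in> ?N" for q
      using N(6)[OF in_N[OF that]] \<Theta>(1)[of q] that by auto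
    ultimately show ?thesis
      using open_N UV h(2) poly[OF N(4)] poly[OF N(5)]
      by (intro exI[of _ ?N] exI[of _ U] exI[of _ V] conjI bexI[of _ "\<lambda>q. a (\<Theta> q)"]
          bexI[of _ "\<lambda>q. b (\<Theta> q)"] ballI) auto
  qed
  show ?thesis
    unfolding variety_morphism_def continuous_map_def
  proof (intro conjI allI impI)
    show "\<mu> \<in> points ?P \<rightarrow> points ?Q"
      unfolding points Z_def points_quotient_affine[OF r]
    proof
      fix p assume "p \<in> points X \<times> points Y"
      from lift[OF this] obtain U V \<Theta> where "p \<in> U \<times> V"
        "\<forall>q\<in>U \<times> V. \<Theta> q \<in> S \<and> \<mu> q = r `` {\<Theta> q}"
        by (elim exE conjE) (rule that)
      then have "\<Theta> p \<in> S" "\<mu> p = r `` {\<Theta> p}"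
        by blast+
      then show "\<mu> p \<in> S // r"
        using quotientI[of "\<Theta> p" S r] by simp
    qed
  next
    fix W assume W: "openin (zariski ?Q) W"
    have "(\<lambda>_. 0) \<in> regular_on ?Q W"
      using function_algebra_regular_on_quotient[OF r W[unfolded Z_def]]
      unfolding Z_def by (rule function_algebra_const)
    from local[OF W this] show "openin (zariski ?P) {p \<in> points ?P. \<mu> p \<in> W}"
      by (subst openin_subopen) blast
  next
    fix W f assume "openin (zariski ?Q) W" "f \<in> regular_on ?Q W"
    then show "(\<lambda>p. f (\<mu> p)) \<in> regular_on ?P {p \<in> points ?P. \<mu> p \<in> W}"
      unfolding regular_on_product_variety by (intro ballI local)
  qed
qed

section \<open>Regular dependence of the inverse automorphism\<close>

lemma mult_mat_entry:
  assumes "A \<in> carrier_mat n m" "B \<in> carrier_mat m l" "i < n" "j < l"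
  shows "(A * B) $$ (i, j) = (\<Sum>t<m. A $$ (i, t) * B $$ (t, j))"
  using assms by (auto simp: scalar_prod_def atLeast0LessThan intro!: sum.cong)

text \<open>
Linearly independent functions are separated by as many points. The points are chosen one by one: expanding
along the new row turns the determinant into a linear combination of the functions whose last
coefficient is the previous determinant, so it is not identically zero.
\<close>

lemma nonsingular_evaluation_matrix:
  fixes b :: "nat \<Rightarrow> 'z \<Rightarrow> 'c :: field"
  assumes indep: "\<And>q i. (\<And>z. (\<Sum>i<M. q i * b i z) = 0) \<Longrightarrow> i < M \<Longrightarrow> q i = 0"
  shows "\<exists>z. Determinant.det (mat M M (\<lambda>(j, i). b i (z j))) \<noteq> 0"
proof -
  have "\<exists>z. Determinant.det (mat m m (\<lambda>(j, i). b i (z j))) \<noteq> 0" if "m \<le> M" for m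
    using that
  proof (induction m)
    case 0
    then show ?case by (simp add: det_dim_zero)
  next
    case (Suc m)
    then obtain z where z: "Determinant.det (mat m m (\<lambda>(j, i). b i (z j))) \<noteq> 0"
      by auto
    define A where "A t = mat (Suc m) (Suc m) (\<lambda>(j, i). b i ((z(m := t)) j))" for t
    define B where "B i = mat m m (\<lambda>(j, l). b (if l < i then l else Suc l) (z j))" for i
    define q where "q i = (if i \<le> m then (-1) ^ (m + i) * Determinant.det (B i) else 0)" for i
    have minor: "mat_delete (A t) m i = B i" if "i \<le> m" for t i
      using that unfolding mat_delete_def A_def B_def by (intro eq_matI) auto
    have det: "Determinant.det (A t) = (\<Sum>i<M. q i * b i t)" for t
    proof -
      have "A t \<in> carrier_mat (Suc m) (Suc m)"
        unfolding A_def by simp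
      from laplace_expansion_row[OF this, of m]
      have "Determinant.det (A t) = (\<Sum>i<Suc m. A t $$ (m, i) * cofactor (A t) m i)"
        by simp
      also have "\<dots> = (\<Sum>i<Suc m. q i * b i t)"
      proof (rule sum.cong)
        fix i assume "i \<in> {..<Suc m}"
        then show "A t $$ (m, i) * cofactor (A t) m i = q i * b i t"
          using minor[of i t] unfolding cofactor_def q_def by (simp add: A_def)
      qed simp
      also have "\<dots> = (\<Sum>i<M. q i * b i t)"
        using Suc.prems by (intro sum.mono_neutral_left) (auto simp: q_def)
      finally show ?thesis .
    qed
    have "B m = mat m m (\<lambda>(j, i). b i (z j))"
      unfolding B_def by (intro eq_matI) auto
    then have "q m \<noteq> 0"
      using z unfolding q_def by simp
    then obtain t where "Determinant.det (A t) \<noteq> 0"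
      using indep[of q m] Suc.prems unfolding det by fastforce
    then show ?case
      unfolding A_def by blast
  qed
  then show ?thesis by blast
qed

lemma cramer:
  fixes A :: "'c :: comm_ring_1 mat"
  assumes A: "A \<in> carrier_mat m m" and i: "i < m"
  shows "(\<Sum>j<m. cofactor A j i * (\<Sum>l<m. A $$ (j, l) * u l)) = Determinant.det A * u i"
proof -
  have "(\<Sum>j<m. cofactor A j i * A $$ (j, l)) = (if l = i then Determinant.det A else 0)" if l: "l < m" for l
  proof -
    have "(\<Sum>j<m. cofactor A j i * A $$ (j, l)) = (adj_mat A * A) $$ (i, l)"
      using A i l adj_mat(1)[OF A] unfolding adj_mat_def
      by (auto simp: scalar_prod_def atLeast0LessThan intro!: sum.cong)
    then show ?thesis
      unfolding adj_mat(3)[OF A] using i l by auto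
  qed
  then have "(\<Sum>l<m. (\<Sum>j<m. cofactor A j i * A $$ (j, l)) * u l) =
      (\<Sum>l<m. if l = i then Determinant.det A * u l else 0)"
    by (intro sum.cong) auto
  moreover have "(\<Sum>j<m. cofactor A j i * (\<Sum>l<m. A $$ (j, l) * u l)) =
      (\<Sum>l<m. (\<Sum>j<m. cofactor A j i * A $$ (j, l)) * u l)"
    by (simp add: sum_distrib_left sum_distrib_right mult.assoc) (rule sum.swap)
  ultimately show ?thesis
    using i by simp
qed

definition entries :: "nat \<Rightarrow> (bool \<times> nat \<times> nat) set" where
  "entries n = UNIV \<times> {..<n} \<times> {..<n}"

fun entry :: "mat_pair \<Rightarrow> bool \<times> nat \<times> nat \<Rightarrow> complex" where
  "entry P (b, i, j) = (if b then fst P else snd P) $$ (i, j)"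

text \<open>
The inverse of \<^term>\<open>entry\<close>. It is also applied to the entries of arbitrary pairs, where it truncates: this
turns an expression that is polynomial on pairs of \<open>n \<times> n\<close> matrices into one that is polynomial everywhere.
\<close>

definition pair_of_entries :: "nat \<Rightarrow> (bool \<times> nat \<times> nat \<Rightarrow> complex) \<Rightarrow> mat_pair" where
  "pair_of_entries n z =
     (mat n n (\<lambda>(i, j). z (True, i, j)), mat n n (\<lambda>(i, j). z (False, i, j)))"

lemma finite_entries [simp]: "finite (entries n)"
  unfolding entries_def by simp

lemma pair_of_entries_matrix_pairs [simp]: "pair_of_entries n z \<in> matrix_pairs n"
  unfolding pair_of_entries_def by simp

lemma entry_pair_of_entries: "c \<in> entries n \<Longrightarrow> entry (pair_of_entries n z) c = z c"
  unfolding pair_of_entries_def entries_def by (cases c) auto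

lemma pair_of_entries_entry: "P \<in> matrix_pairs n \<Longrightarrow> pair_of_entries n (entry P) = P"
  unfolding pair_of_entries_def matrix_pairs_def by (cases P) (auto intro!: eq_matI)

lemma word_eval_entry_box_polys:
  assumes "i < n" "j < n"
  shows "(\<lambda>z. word_eval n (pair_of_entries n z) w $$ (i, j)) \<in> box_polys (entries n) (length w)"
  using assms
proof (induction w arbitrary: i)
  case Nil
  then show ?case
    using box_polys_const[OF finite_entries] by simp
next
  case (Cons l w)
  define c where "c t = (l = LX, i, t)" for t :: nat
  have "word_eval n (pair_of_entries n z) (l # w) $$ (i, j) =
      (\<Sum>t<n. z (c t) * word_eval n (pair_of_entries n z) w $$ (t, j))" for z
  proof -
    have "word_eval n (pair_of_entries n z) (l # w) $$ (i, j) =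
        (\<Sum>t<n. entry (pair_of_entries n z) (c t) * word_eval n (pair_of_entries n z) w $$ (t, j))"
      using Cons.prems matrix_pairsD[OF pair_of_entries_matrix_pairs, of n z]
      by (cases l) (simp_all add: c_def mult_mat_entry[of _ n n _ n])
    also have "\<dots> = (\<Sum>t<n. z (c t) * word_eval n (pair_of_entries n z) w $$ (t, j))"
      using Cons.prems
      by (intro sum.cong refl arg_cong2[where f = times] entry_pair_of_entries)
        (auto simp: c_def entries_def)
    finally show ?thesis .
  qed
  moreover have "(\<lambda>z. \<Sum>t<n. z (c t) * word_eval n (pair_of_entries n z) w $$ (t, j))
      \<in> box_polys (entries n) (1 + length w)"
    using Cons.prems
    by (intro box_polys_sum box_polys_mult finite_entries box_polys_coordinate Cons.IH)
      (auto simp: c_def entries_def)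
  ultimately show ?case by simp
qed

definition words :: "nat \<Rightarrow> letter list set" where
  "words k = {w. length w \<le> k}"

lemma finite_words [simp]: "finite (words k)"
proof -
  have "(UNIV :: letter set) = {LX, LY}"
    using letter.exhaust by blast
  then have "finite (UNIV :: letter set)"
    by (metis finite.emptyI finite.insertI)
  from finite_lists_length_le[OF this, of k] show ?thesis
    unfolding words_def by simp
qed

lemma substitute_entry_deg_le:
  assumes "p \<in> deg_le k" "i < n" "j < n"
  shows "substitute n P p $$ (i, j) =
    (\<Sum>w\<in>words k. Poly_Mapping.lookup p w * word_eval n P w $$ (i, j))"
  using assms by (intro substitute_entry finite_words) (auto simp: deg_le_def words_def)

lemma substitute_entry_box_polys:
  assumes "p \<in> deg_le k" "i < n" "j < n"
  shows "(\<lambda>z. substitute n (pair_of_entries n z) p $$ (i, j)) \<in> box_polys (entries n) k"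
  unfolding substitute_entry_deg_le[OF assms]
proof (intro box_polys_sum box_polys_scale)
  fix w assume "w \<in> words k"
  then show "(\<lambda>z. word_eval n (pair_of_entries n z) w $$ (i, j)) \<in> box_polys (entries n) k"
    using box_polys_mono[OF finite_entries _ word_eval_entry_box_polys[OF assms(2,3)]]
    unfolding words_def by blast
qed

lemma entry_pull_box_polys:
  assumes "\<tau> gen_x \<in> deg_le k" "\<tau> gen_y \<in> deg_le k" "c \<in> entries n"
  shows "(\<lambda>z. entry (pull n \<tau> (pair_of_entries n z)) c) \<in> box_polys (entries n) k"
proof -
  obtain b i j where c: "c = (b, i, j)" "i < n" "j < n"
    using assms(3) unfolding entries_def by auto
  then show ?thesis
    using substitute_entry_box_polys[OF assms(1) c(2,3)] substitute_entry_box_polys[OF assms(2) c(2,3)]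
    by (cases b) (simp_all add: pull_def)
qed

lemma deg_le_exists: "\<exists>k. p \<in> deg_le k \<and> q \<in> deg_le k"
proof
  let ?k = "Max (length ` (Poly_Mapping.keys p \<union> Poly_Mapping.keys q))"
  show "p \<in> deg_le ?k \<and> q \<in> deg_le ?k"
    unfolding deg_le_def by simp
qed

lemma deg_le_mono: "k \<le> l \<Longrightarrow> p \<in> deg_le k \<Longrightarrow> p \<in> deg_le l"
  unfolding deg_le_def by auto

lemma points_G_filtration:
  "points (G_filtration k) = {\<sigma> \<in> G_auts. \<sigma> gen_x \<in> deg_le k \<and> \<sigma> gen_y \<in> deg_le k}"
  unfolding G_filtration_def points_affine_subspace ..

text \<open>
The bound of \<open>inverse_degree_bound\<close> for maps of degree \<open>Suc k\<close>. The successor accounts for the coordinate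
functions, which have degree 1 even if \<open>k = 0\<close>.
\<close>

definition inverse_degree :: "nat \<Rightarrow> nat \<Rightarrow> nat" where
  "inverse_degree n k =
     card (entries n) * ((card (entries n) + 1) * Suc k + 1) ^ card (entries n)"

text \<open>
The maps of pairs of matrices induced by \<open>\<sigma>\<close> and by its inverse are mutually inverse, so
\<open>inverse_degree_bound\<close> applies. The point is that the bound is the same for all \<open>\<sigma>\<close> in one piece of
the filtration.
\<close>

theorem entry_act_pair_box_polys:
  assumes \<sigma>: "\<sigma> \<in> points (G_filtration k)" and c: "c \<in> entries n"
  shows "(\<lambda>z. entry (act_pair n \<sigma> (pair_of_entries n z)) c)
    \<in> box_polys (entries n) (inverse_degree n k)"
proof -
  have G: "\<sigma> \<in> G_auts" and deg: "\<sigma> gen_x \<in> deg_le k" "\<sigma> gen_y \<in> deg_le k"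
    using \<sigma> unfolding points_G_filtration by auto
  let ?F = "\<lambda>c z. entry (pull n \<sigma> (pair_of_entries n z)) c"
  obtain L where "inv_into UNIV \<sigma> gen_x \<in> deg_le L" "inv_into UNIV \<sigma> gen_y \<in> deg_le L"
    using deg_le_exists by blast
  from entry_pull_box_polys[OF this c]
  have L: "(\<lambda>z. entry (act_pair n \<sigma> (pair_of_entries n z)) c) \<in> box_polys (entries n) L"
    unfolding act_pair_pull .
  have F: "?F c \<in> box_polys (entries n) (Suc k)" if "c \<in> entries n" for c
    using deg_le_mono[of k "Suc k"] deg that by (intro entry_pull_box_polys) auto
  have x: "(\<lambda>z. z c) \<in> box_polys (entries n) (Suc k)"
    using c by (intro box_polys_coordinate) auto
  show ?thesis
    unfolding inverse_degree_def
  proof (rule inverse_degree_bound[OF finite_entries F x L])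
    fix z
    let ?p = "entry (act_pair n \<sigma> (pair_of_entries n z))"
    have "act_pair n \<sigma> (pair_of_entries n z) \<in> matrix_pairs n"
      unfolding act_pair_pull by simp
    then have "pull n \<sigma> (pair_of_entries n ?p) = pair_of_entries n z"
      using pull_act_pair(1)[OF G] by (simp add: pair_of_entries_entry)
    then show "\<exists>p. (\<forall>c\<in>entries n. ?F c p = z c) \<and>
        p c = entry (act_pair n \<sigma> (pair_of_entries n z)) c"
      by (intro exI[of _ ?p]) (simp add: entry_pair_of_entries)
  qed
qed

definition G_coordinates :: "nat \<Rightarrow> ((free_alg \<Rightarrow> free_alg) \<Rightarrow> complex) set" where
  "G_coordinates k =
     {(\<lambda>\<sigma>. Poly_Mapping.lookup (\<sigma> gen_x) w) | w. length w \<le> k} \<union>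
     {(\<lambda>\<sigma>. Poly_Mapping.lookup (\<sigma> gen_y) w) | w. length w \<le> k}"

lemma G_filtration_affine:
  "G_filtration k = affine_subspace (points (G_filtration k)) (G_coordinates k)"
  unfolding points_G_filtration unfolding G_filtration_def G_coordinates_def ..

text \<open>
The entries of the induced map as functions of \<open>\<sigma>\<close>. The sum is cut off at words of length \<open>k\<close>, so that the
function is polynomial in the coefficients for every \<open>\<sigma>\<close>, not only for those of degree at most \<open>k\<close>.
\<close>

definition pull_entry ::
  "nat \<Rightarrow> nat \<Rightarrow> mat_pair \<Rightarrow> bool \<times> nat \<times> nat \<Rightarrow> (free_alg \<Rightarrow> free_alg) \<Rightarrow> complex" where
  "pull_entry n k P = (\<lambda>(b, i, j) \<sigma>. \<Sum>w\<in>words k.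
     Poly_Mapping.lookup (\<sigma> (if b then gen_x else gen_y)) w * word_eval n P w $$ (i, j))"

lemma pull_entry_polynomial: "pull_entry n k P c \<in> polynomial_functions (G_coordinates k)"
proof -
  obtain b i j where c: "c = (b, i, j)" by (cases c)
  show ?thesis
    unfolding pull_entry_def c prod.case
  proof (intro function_algebra_sum[OF function_algebra_polynomial_functions] polynomial_functions.mult
      polynomial_functions.const polynomial_functions.coordinate)
    fix w assume "w \<in> words k"
    then show "(\<lambda>\<sigma>. Poly_Mapping.lookup (\<sigma> (if b then gen_x else gen_y)) w) \<in> G_coordinates k"
      unfolding G_coordinates_def words_def by (cases b) auto
  qed
qed

lemma pull_entry_eq:
  assumes "\<sigma> \<in> points (G_filtration k)" "c \<in> entries n"
  shows "pull_entry n k P c \<sigma> = entry (pull n \<sigma> P) c"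
  using assms unfolding points_G_filtration entries_def pull_entry_def
  by (auto simp: pull_def substitute_entry_deg_le)

text \<open>
Let \<open>q\<^sub>e\<close> be the coefficients of an entry of the map induced by \<open>\<sigma>\<inverse>\<close>, indexed by
the finitely many monomials \<open>m\<^sub>e\<close> of bounded degree, and let \<open>F\<close> be the map induced by \<open>\<sigma>\<close>. For each pair
of matrices \<open>p\<close> they satisfy the linear equation \<open>\<Sum> q\<^sub>e m\<^sub>e(F(p)) = p\<close> (the entry of \<open>p\<close> is
meant on the right), whose coefficients are polynomial in \<open>\<sigma>\<close>. For \<open>\<sigma> = \<sigma>\<^sub>0\<close> the points
\<open>F(p)\<close> are arbitrary, so as many points \<open>p\<close> as there are monomials can be chosen that make the system
nonsingular at \<open>\<sigma>\<^sub>0\<close>. Cramer's rule then gives the coefficients as fractions with the common denominator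
\<open>h\<close>, the determinant of the system.
\<close>

theorem entry_act_pair_locally_rational:
  assumes \<sigma>0: "\<sigma>0 \<in> points (G_filtration k)"
  shows "\<exists>h m E g. h \<in> polynomial_functions (G_coordinates k) \<and> h \<sigma>0 \<noteq> 0 \<and>
    (\<forall>l c. g l c \<in> polynomial_functions (G_coordinates k)) \<and>
    (\<forall>\<sigma>\<in>points (G_filtration k). h \<sigma> \<noteq> 0 \<longrightarrow> (\<forall>P\<in>matrix_pairs n. \<forall>c\<in>entries n.
      entry (act_pair n \<sigma> P) c = (\<Sum>l<(m::nat). g l c \<sigma> / h \<sigma> * monomial (entries n) (E l) (entry P))))"
proof -
  let ?I = "entries n"
  let ?D = "inverse_degree n k"
  let ?poly = "polynomial_functions (G_coordinates k)"
  note alg = function_algebra_polynomial_functions[of "G_coordinates k"]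
  define m where "m = card (exponents ?I ?D)"
  obtain E where E: "bij_betw E {..<m} (exponents ?I ?D)"
    using ex_bij_betw_nat_finite[OF finite_exponents[OF finite_entries]]
    unfolding m_def atLeast0LessThan by blast
  have reindex: "(\<Sum>e\<in>exponents ?I ?D. f e) = (\<Sum>l<m. f (E l))" for f :: "_ \<Rightarrow> complex"
    by (rule sum.reindex_bij_betw[OF E, symmetric])
  have indep: "q l = 0" if q: "\<And>z. (\<Sum>l<m. q l * monomial ?I (E l) z) = 0" and l: "l < m" for q l
  proof -
    let ?E' = "inv_into {..<m} E"
    have inv: "?E' (E l) = l" if "l < m" for l
      using E that by (simp add: bij_betw_def inv_into_f_f)
    have "(\<Sum>e\<in>exponents ?I ?D. q (?E' e) * monomial ?I e z) = 0" for z
      unfolding reindex using q[of z] by (simp add: inv)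
    from monomials_independent[OF finite_entries this, of "E l"] show ?thesis
      using inv[OF l] l E by (auto simp: bij_betw_def)
  qed
  have "\<exists>z. Determinant.det (mat m m (\<lambda>(j, l). monomial ?I (E l) (z j))) \<noteq> 0"
    by (rule nonsingular_evaluation_matrix) (rule indep)
  then obtain z where z: "Determinant.det (mat m m (\<lambda>(j, l). monomial ?I (E l) (z j))) \<noteq> 0"
    by blast
  define p where "p j = act_pair n \<sigma>0 (pair_of_entries n (z j))" for j
  have p: "p j \<in> matrix_pairs n" for j
    unfolding p_def act_pair_pull by simp
  define A where "A \<sigma> = mat m m (\<lambda>(j, l). \<Prod>c\<in>?I. pull_entry n k (p j) c \<sigma> ^ E l c)" for \<sigma>
  define h where "h \<sigma> = Determinant.det (A \<sigma>)" for \<sigma>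
  define g where "g l c \<sigma> = (if l < m then \<Sum>j<m. cofactor (A \<sigma>) j l * entry (p j) c else 0)" for l c \<sigma>
  have A: "A \<sigma> \<in> carrier_mat m m" for \<sigma>
    unfolding A_def by simp
  have A_poly: "(\<lambda>\<sigma>. A \<sigma> $$ (j, l)) \<in> ?poly" if "j < m" "l < m" for j l
    using that unfolding A_def
    by (auto intro!: function_algebra_prod[OF alg] function_algebra_power[OF alg]
        pull_entry_polynomial)
  have A_eq: "A \<sigma> $$ (j, l) = monomial ?I (E l) (entry (pull n \<sigma> (p j)))"
    if "\<sigma> \<in> points (G_filtration k)" "j < m" "l < m" for \<sigma> j l
    using that(2,3) unfolding A_def monomial_def by (simp add: pull_entry_eq[OF that(1)])
  show ?thesis
  proof (intro exI conjI allI ballI impI)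
    show "h \<in> ?poly"
      unfolding h_def by (rule function_algebra_det[OF alg A A_poly])
    show "g l c \<in> ?poly" for l c
    proof (cases "l < m")
      case True
      have "(\<lambda>\<sigma>. \<Sum>j<m. cofactor (A \<sigma>) j l * entry (p j) c) \<in> ?poly"
        using True by (intro function_algebra_sum[OF alg] polynomial_functions.mult
            polynomial_functions.const function_algebra_cofactor[OF alg A A_poly]) auto
      then show ?thesis
        using True unfolding g_def by simp
    next
      case False
      then show ?thesis
        using polynomial_functions.const[of 0] unfolding g_def by simp
    qed
    have "\<sigma>0 \<in> G_auts"
      using \<sigma>0 unfolding points_G_filtration by simp
    then have "pull n \<sigma>0 (p j) = pair_of_entries n (z j)" for j
      unfolding p_def by (simp add: pull_act_pair)
    then have "monomial ?I e (entry (pull n \<sigma>0 (p j))) = monomial ?I e (z j)" for e j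
      unfolding monomial_def by (intro prod.cong) (auto simp: entry_pair_of_entries)
    then have "A \<sigma>0 = mat m m (\<lambda>(j, l). monomial ?I (E l) (z j))"
      using A[of \<sigma>0] by (intro eq_matI) (auto simp: A_eq[OF \<sigma>0])
    then show "h \<sigma>0 \<noteq> 0"
      using z unfolding h_def by simp
  next
    fix \<sigma> P c
    assume \<sigma>: "\<sigma> \<in> points (G_filtration k)" "h \<sigma> \<noteq> 0" and P: "P \<in> matrix_pairs n" and c: "c \<in> ?I"
    have G: "\<sigma> \<in> G_auts"
      using \<sigma>(1) unfolding points_G_filtration by simp
    obtain q where "\<And>z. entry (act_pair n \<sigma> (pair_of_entries n z)) c =
        (\<Sum>e\<in>exponents ?I ?D. q e * monomial ?I e z)"
      using entry_act_pair_box_polys[OF \<sigma>(1) c] unfolding box_polys_def by blast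
    then have q: "entry (act_pair n \<sigma> Q) c = (\<Sum>l<m. q (E l) * monomial ?I (E l) (entry Q))"
      if "Q \<in> matrix_pairs n" for Q
      unfolding reindex using that by (metis pair_of_entries_entry)
    have "(\<Sum>l<m. A \<sigma> $$ (j, l) * q (E l)) = entry (p j) c" if "j < m" for j
      using q[OF pull_matrix_pairs, of \<sigma> "p j"] pull_act_pair(2)[OF G p] A_eq[OF \<sigma>(1) that]
      by (simp add: mult.commute)
    then have "g l c \<sigma> = h \<sigma> * q (E l)" if "l < m" for l
      using cramer[OF A that, of \<sigma> "\<lambda>l. q (E l)"] that unfolding g_def h_def by simp
    then show "entry (act_pair n \<sigma> P) c =
        (\<Sum>l<m. g l c \<sigma> / h \<sigma> * monomial ?I (E l) (entry P))"
      unfolding q[OF P] using \<sigma>(2) by (intro sum.cong) auto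
  qed
qed

section \<open>Projectors, traces and rank one\<close>

definition mat_trace :: "'a :: comm_ring_1 mat \<Rightarrow> 'a" where
  "mat_trace A = (\<Sum>i<dim_row A. A $$ (i, i))"

lemma mat_trace_add:
  assumes "A \<in> carrier_mat n n" "B \<in> carrier_mat n n"
  shows "mat_trace (A + B) = mat_trace A + mat_trace B"
  using assms unfolding mat_trace_def by (simp add: sum.distrib)

lemma mat_trace_diff:
  assumes "A \<in> carrier_mat n n" "B \<in> carrier_mat n n"
  shows "mat_trace (A - B) = mat_trace A - mat_trace B"
  using assms unfolding mat_trace_def by (simp add: sum_subtractf)

lemma mat_trace_one: "mat_trace (1\<^sub>m n) = of_nat n"
  unfolding mat_trace_def by simp

lemma mat_trace_mult_commute:
  assumes A: "A \<in> carrier_mat n n" and B: "B \<in> carrier_mat n n"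
  shows "mat_trace (A * B) = mat_trace (B * A)"
proof -
  have "mat_trace (A * B) = (\<Sum>i<n. \<Sum>t<n. A $$ (i, t) * B $$ (t, i))"
    using A unfolding mat_trace_def by (simp add: mult_mat_entry[OF A B] del: index_mult_mat(1))
  also have "\<dots> = (\<Sum>t<n. \<Sum>i<n. B $$ (t, i) * A $$ (i, t))"
    by (subst sum.swap) (simp add: mult.commute)
  also have "\<dots> = mat_trace (B * A)"
    using B unfolding mat_trace_def by (simp add: mult_mat_entry[OF B A] del: index_mult_mat(1))
  finally show ?thesis .
qed

lemma mat_eq_on_vec:
  fixes A :: "'a :: comm_ring_1 mat"
  assumes A: "A \<in> carrier_mat n m" and B: "B \<in> carrier_mat n m"
    and eq: "\<And>v. v \<in> carrier_vec m \<Longrightarrow> A *\<^sub>v v = B *\<^sub>v v"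
  shows "A = B"
proof (rule eq_matI)
  fix i j assume "i < dim_row B" "j < dim_col B"
  then have ij: "i < n" "j < m" using B by auto
  have "C $$ (i, j) = (C *\<^sub>v unit_vec m j) $ i" if "C \<in> carrier_mat n m" for C :: "'a mat"
    using that ij by simp
  then show "A $$ (i, j) = B $$ (i, j)"
    using A B eq[of "unit_vec m j"] by simp
qed (use A B in auto)

text \<open>
A projector onto \<open>V\<close> whose trace counts the dimension. It is built by downward induction on \<open>k\<close> for the
subspaces \<open>W k\<close> of vectors in \<open>V\<close> whose first \<open>k\<close> coordinates vanish: if \<open>W k\<close> is larger than \<open>W (Suc k)\<close>,
a vector \<open>u'\<close> in \<open>W k\<close> with \<open>k\<close>-th coordinate 1 that the old projector kills is added as \<open>k\<close>-th column,
which raises the trace by 1.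
\<close>

lemma subspace_projector:
  fixes V :: "'a :: field vec set"
  assumes V: "V \<subseteq> carrier_vec n" "0\<^sub>v n \<in> V"
    and add: "\<And>u v. u \<in> V \<Longrightarrow> v \<in> V \<Longrightarrow> u + v \<in> V"
    and smult: "\<And>c v. v \<in> V \<Longrightarrow> c \<cdot>\<^sub>v v \<in> V"
  shows "\<exists>E m. E \<in> carrier_mat n n \<and> (\<forall>v\<in>carrier_vec n. E *\<^sub>v v \<in> V) \<and>
    (\<forall>v\<in>V. E *\<^sub>v v = v) \<and> mat_trace E = of_nat m \<and> (m = 0 \<longrightarrow> E = 0\<^sub>m n n)"
proof -
  define W where "W k = {v \<in> V. \<forall>j<k. v $ j = 0}" for k
  have "\<exists>E m. E \<in> carrier_mat n n \<and> (\<forall>v\<in>carrier_vec n. E *\<^sub>v v \<in> W k) \<and>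
      (\<forall>v\<in>W k. E *\<^sub>v v = v) \<and> mat_trace E = of_nat m \<and> (m = 0 \<longrightarrow> E = 0\<^sub>m n n)"
    if "k \<le> n" for k
    using that
  proof (induction k rule: inc_induct)
    case base
    have "v = 0\<^sub>v n" if "v \<in> W n" for v
      using that V(1) unfolding W_def by (intro eq_vecI) auto
    moreover have "0\<^sub>v n \<in> W n"
      using V(2) unfolding W_def by auto
    ultimately have Wn: "W n = {0\<^sub>v n}"
      by blast
    have "0\<^sub>m n n *\<^sub>v v = 0\<^sub>v n" if "v \<in> carrier_vec n" for v :: "'a vec"
      using that by (intro eq_vecI) auto
    then show ?case
      unfolding Wn by (intro exI[of _ "0\<^sub>m n n"] exI[of _ 0]) (auto simp: mat_trace_def)
  next
    case (step k)
    obtain E m where E: "E \<in> carrier_mat n n" "\<And>v. v \<in> carrier_vec n \<Longrightarrow> E *\<^sub>v v \<in> W (Suc k)"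
      "\<And>v. v \<in> W (Suc k) \<Longrightarrow> E *\<^sub>v v = v" "mat_trace E = of_nat m" "m = 0 \<longrightarrow> E = 0\<^sub>m n n"
      using step.IH by blast
    have k: "k < n" by (rule step.hyps)
    have sub: "W (Suc k) \<subseteq> W k"
      unfolding W_def by auto
    show ?case
    proof (cases "W k \<subseteq> W (Suc k)")
      case True
      then show ?thesis
        using E sub by (intro exI[of _ E] exI[of _ m]) blast
    next
      case False
      then obtain w where w: "w \<in> W k" "w $ k \<noteq> 0"
        unfolding W_def by (auto simp: less_Suc_eq)
      have wV: "w \<in> V" "w \<in> carrier_vec n"
        using w V(1) unfolding W_def by auto
      define u where "u = (1 / w $ k) \<cdot>\<^sub>v w"
      have u: "u \<in> V" "u \<in> carrier_vec n" "u $ k = 1" "\<And>j. j < k \<Longrightarrow> u $ j = 0"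
        using w wV smult k unfolding u_def W_def by auto
      have Euk: "E *\<^sub>v u \<in> W (Suc k)"
        using E(2) u(2) by blast
      \<comment> \<open>\<open>E\<close> kills \<open>u'\<close>, and as \<open>E *\<^sub>v u\<close> lies in \<open>W (Suc k)\<close>, \<open>u'\<close> has the coordinates of \<open>u\<close> up to the \<open>k\<close>-th\<close>
      define u' where "u' = u + (- 1) \<cdot>\<^sub>v (E *\<^sub>v u)"
      have u': "u' \<in> V" "u' \<in> carrier_vec n" "u' $ k = 1" "\<And>j. j < k \<Longrightarrow> u' $ j = 0"
        using u Euk add smult E(1) k unfolding u'_def W_def by auto
      define E' where "E' = E + mat n n (\<lambda>(i, j). if j = k then u' $ i else 0)"
      have E': "E' \<in> carrier_mat n n"
        using E(1) unfolding E'_def by simp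
      have E'v: "E' *\<^sub>v v = E *\<^sub>v v + (v $ k) \<cdot>\<^sub>v u'" if v: "v \<in> carrier_vec n" for v
      proof -
        have "mat n n (\<lambda>(i, j). if j = k then u' $ i else 0) *\<^sub>v v = (v $ k) \<cdot>\<^sub>v u'"
        proof (rule eq_vecI)
          fix i assume "i < dim_vec (v $ k \<cdot>\<^sub>v u')"
          then have i: "i < n" using u'(2) by simp
          have "(if j = k then u' $ i else 0) * v $ j = (if j = k then u' $ i * v $ j else 0)" for j
            by simp
          then have "(mat n n (\<lambda>(i, j). if j = k then u' $ i else 0) *\<^sub>v v) $ i = u' $ i * v $ k"
            using v i k by (simp add: scalar_prod_def)
          then show "(mat n n (\<lambda>(i, j). if j = k then u' $ i else 0) *\<^sub>v v) $ i = (v $ k \<cdot>\<^sub>v u') $ i"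
            using i u'(2) by (simp add: mult.commute)
        qed (use u' in simp)
        then show ?thesis
          unfolding E'_def using E(1) v by (simp add: add_mult_distrib_mat_vec[of _ n n])
      qed
      have range: "E' *\<^sub>v v \<in> W k" if v: "v \<in> carrier_vec n" for v
      proof -
        have "E *\<^sub>v v \<in> V" "\<And>j. j < Suc k \<Longrightarrow> (E *\<^sub>v v) $ j = 0"
          using E(2)[OF v] unfolding W_def by auto
        then show ?thesis
          unfolding E'v[OF v] W_def using u' add smult E(1) v k by auto
      qed
      have fixed: "E' *\<^sub>v v = v" if v: "v \<in> W k" for v
      proof -
        have vV: "v \<in> V" "v \<in> carrier_vec n" "\<And>j. j < k \<Longrightarrow> v $ j = 0"
          using v V(1) unfolding W_def by auto
        define y where "y = v + (- (v $ k)) \<cdot>\<^sub>v u"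
        have "y \<in> W (Suc k)"
          using vV u add smult k unfolding y_def W_def by (auto simp: less_Suc_eq)
        then have Ey: "E *\<^sub>v y = y"
          by (rule E(3))
        have "E *\<^sub>v y = E *\<^sub>v v + (- (v $ k)) \<cdot>\<^sub>v (E *\<^sub>v u)"
          unfolding y_def using E(1) vV(2) u(2)
          by (simp add: mult_add_distrib_mat_vec[of _ n n] mult_mat_vec[of _ n n])
        then have "E *\<^sub>v v + (- (v $ k)) \<cdot>\<^sub>v (E *\<^sub>v u) = v + (- (v $ k)) \<cdot>\<^sub>v u"
          using Ey unfolding y_def by simp
        then have "(E *\<^sub>v v) $ i + - (v $ k) * (E *\<^sub>v u) $ i = v $ i + - (v $ k) * u $ i" if "i < n" for i
          using that E(1) vV(2) u(2) by (metis carrier_matD(1) carrier_vecD dim_mult_mat_vec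
              index_add_vec(1) index_smult_vec(1) index_smult_vec(2))
        then have "(E' *\<^sub>v v) $ i = v $ i" if "i < n" for i
          using that E(1) vV(2) u(2) unfolding E'v[OF vV(2)] u'_def by (force simp: algebra_simps)
        then show ?thesis
          using E' vV(2) by (intro eq_vecI) auto
      qed
      have "mat_trace E' = mat_trace E + (\<Sum>i<n. if i = k then u' $ i else 0)"
        unfolding E'_def mat_trace_def using E(1) by (simp add: sum.distrib)
      then have "mat_trace E' = of_nat (Suc m)"
        using k u'(3) E(4) by simp
      then show ?thesis
        using E' range fixed by (intro exI[of _ E'] exI[of _ "Suc m"]) auto
    qed
  qed
  from this[of 0] show ?thesis
    unfolding W_def by simp
qed

text \<open>
The trace of an idempotent matrix is the dimension of its image: \<open>F\<close> and the projector \<open>E\<close> onto that image satisfy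
\<open>F E = E\<close> and \<open>E F = F\<close>.
\<close>

lemma idempotent_trace_zero:
  fixes F :: "'a :: field_char_0 mat"
  assumes F: "F \<in> carrier_mat n n" "F * F = F" "mat_trace F = 0"
  shows "F = 0\<^sub>m n n"
proof -
  let ?V = "{v \<in> carrier_vec n. F *\<^sub>v v = v}"
  have "\<exists>E m. E \<in> carrier_mat n n \<and> (\<forall>v\<in>carrier_vec n. E *\<^sub>v v \<in> ?V) \<and>
      (\<forall>v\<in>?V. E *\<^sub>v v = v) \<and> mat_trace E = of_nat m \<and> (m = 0 \<longrightarrow> E = 0\<^sub>m n n)"
    using F(1) by (intro subspace_projector)
      (auto simp: mult_add_distrib_mat_vec[of _ n n] mult_mat_vec[of _ n n])
  then obtain E m where E: "E \<in> carrier_mat n n" "\<And>v. v \<in> carrier_vec n \<Longrightarrow> E *\<^sub>v v \<in> ?V"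
    "\<And>v. v \<in> ?V \<Longrightarrow> E *\<^sub>v v = v" "mat_trace E = of_nat m" "m = 0 \<longrightarrow> E = 0\<^sub>m n n"
    by blast
  have FE: "F * E = E"
    using F(1) E(1,2) by (intro mat_eq_on_vec[of _ n n]) (auto simp: assoc_mult_mat_vec[of _ n n _ n])
  have "F *\<^sub>v v \<in> ?V" if "v \<in> carrier_vec n" for v
    using that F(1,2) by (auto simp: assoc_mult_mat_vec[of _ n n _ n, symmetric])
  then have EF: "E * F = F"
    using F(1) E(1,3) by (intro mat_eq_on_vec[of _ n n]) (auto simp: assoc_mult_mat_vec[of _ n n _ n])
  have "mat_trace F = mat_trace E"
    using mat_trace_mult_commute[OF F(1) E(1)] FE EF by simp
  then have "m = 0"
    using F(3) E(4) by simp
  then show ?thesis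
    using E(5) EF F(1) by auto
qed

text \<open>
The columns are combinations of a maximal independent set of columns, which has \<open>rank A\<close> elements.
\<close>

lemma rank_columns:
  fixes A :: "complex mat"
  assumes A: "A \<in> carrier_mat n n"
  shows "\<exists>S. finite S \<and> card S = vec_space.rank n A \<and>
    (\<forall>j<n. \<exists>a. \<forall>i<n. A $$ (i, j) = (\<Sum>x\<in>S. a x * x $ i))"
proof -
  interpret vec_space "TYPE(complex)" n .
  have cols: "set (cols A) \<subseteq> carrier_vec n"
    using cols_dim[of A] A by simp
  let ?P = "\<lambda>T. T \<subseteq> set (cols A) \<and> lin_indpt T"
  have "?P {}"
    by (simp add: lin_dep_def)
  then obtain S where S: "finite S" "maximal S ?P"
    using maximal_exists_superset[of "set (cols A)" ?P "{}"] by blast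
  have SP: "S \<subseteq> set (cols A)" "lin_indpt S"
    using S(2) unfolding maximal_def by auto
  have S_carrier: "S \<subseteq> carrier_vec n"
    using SP(1) cols by blast
  have "\<exists>a. \<forall>i<n. A $$ (i, j) = (\<Sum>x\<in>S. a x * x $ i)" if j: "j < n" for j
  proof -
    have c: "col A j \<in> set (cols A)"
      using j A by (metis carrier_matD(2) cols_length cols_nth nth_mem)
    have "col A j \<in> span S"
    proof (cases "col A j \<in> S")
      case True
      then show ?thesis
        using in_own_span[of S] S_carrier by auto
    next
      case False
      have "lin_dep (S \<union> {col A j})"
      proof (rule ccontr)
        assume "\<not> lin_dep (S \<union> {col A j})"
        then have "?P (S \<union> {col A j})"
          using SP c by simp
        then have "S \<union> {col A j} = S"
          using S(2) unfolding maximal_def by blast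
        then show False
          using False by blast
      qed
      then show ?thesis
        using lin_dep_iff_in_span[of S "col A j"] S_carrier SP(2) False c cols by auto
    qed
    then obtain a where "col A j = lincomb a S"
      using finite_in_span[OF S(1), of "col A j"] S_carrier by (auto intro: that[OF sym])
    then have "A $$ (i, j) = (\<Sum>x\<in>S. a x * x $ i)" if "i < n" for i
      using lincomb_index[OF that S_carrier, of a] A that j by (metis carrier_matD index_col)
    then show ?thesis by blast
  qed
  then show ?thesis
    using S(1) rank_card_indpt[OF A S(2)] by metis
qed

lemma rank_one_iff:
  fixes A :: "complex mat"
  assumes A: "A \<in> carrier_mat n n"
  shows "vec_space.rank n A = 1 \<longleftrightarrow>
    A \<noteq> 0\<^sub>m n n \<and> (\<exists>f g. \<forall>i<n. \<forall>j<n. A $$ (i, j) = f i * g j)"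
proof -
  interpret vec_space "TYPE(complex)" n .
  obtain S where S: "finite S" "card S = rank A"
    "\<And>j. j < n \<Longrightarrow> \<exists>a. \<forall>i<n. A $$ (i, j) = (\<Sum>x\<in>S. a x * x $ i)"
    using rank_columns[OF A] by blast
  show ?thesis
  proof
    assume r: "rank A = 1"
    then obtain x where x: "S = {x}"
      using S(1,2) card_1_singletonE by metis
    have "\<forall>j. \<exists>b. j < n \<longrightarrow> (\<forall>i<n. A $$ (i, j) = b * x $ i)"
      using S(3) unfolding x by fastforce
    then obtain a where "\<And>i j. j < n \<Longrightarrow> i < n \<Longrightarrow> A $$ (i, j) = a j * x $ i"
      by metis
    then have "\<forall>i<n. \<forall>j<n. A $$ (i, j) = x $ i * a j"
      by (simp add: mult.commute)
    then show "A \<noteq> 0\<^sub>m n n \<and> (\<exists>f g. \<forall>i<n. \<forall>j<n. A $$ (i, j) = f i * g j)"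
      using r rank_0I[of n] by (intro conjI exI[of _ "\<lambda>i. x $ i"] exI[of _ a]) auto
  next
    assume prod: "A \<noteq> 0\<^sub>m n n \<and> (\<exists>f g. \<forall>i<n. \<forall>j<n. A $$ (i, j) = f i * g j)"
    then obtain f g where "\<And>i j. i < n \<Longrightarrow> j < n \<Longrightarrow> A $$ (i, j) = f i * g j"
      by blast
    then have "rank A \<le> 1"
      using A by (intro rank_le_1_product_entries[of A n f g]) auto
    moreover have "rank A \<noteq> 0"
    proof
      assume "rank A = 0"
      then have "S = {}"
        using S(1,2) by simp
      then have "A = 0\<^sub>m n n"
        using S(3) A by (intro eq_matI) auto
      then show False
        using prod by simp
    qed
    ultimately show "rank A = 1" by simp
  qed
qed

section \<open>Cyclic vectors and local sections of the quotient\<close>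

text \<open>
Its value on a pair of matrices is \<open>[X, Y] + 1\<close>. Treating this matrix as the value of an element of the
free algebra makes its behaviour under conjugation and products an instance of the general rules.
\<close>

definition kappa :: free_alg where
  "kappa = commutator gen_x gen_y + scalar 1"

lemma substitute_kappa:
  assumes "P \<in> matrix_pairs n"
  shows "substitute n P kappa = fst P * snd P - snd P * fst P + 1\<^sub>m n"
proof -
  have "substitute n P (scalar 1) = 1\<^sub>m n"
    unfolding scalar_def substitute_single[OF assms] by (auto intro!: eq_matI)
  then show ?thesis
    unfolding kappa_def substitute_add by (simp add: substitute_commutator substitute_gen assms)
qed

lemma CM_pairs_iff:
  "P \<in> CM_pairs n \<longleftrightarrow> P \<in> matrix_pairs n \<and> (n = 0 \<or> vec_space.rank n (substitute n P kappa) = 1)"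
proof (cases "P \<in> matrix_pairs n")
  case True
  then show ?thesis
    unfolding substitute_kappa[OF True] by (cases P) (auto simp: CM_pairs_def)
next
  case False
  then show ?thesis
    using CM_pairs_subset by blast
qed

lemma substitute_scalar_mult:
  assumes "P \<in> matrix_pairs n"
  shows "substitute n P (scalar c * q) = c \<cdot>\<^sub>m substitute n P q"
  unfolding scalar_def substitute_mult_single[OF assms]
  by (simp add: mult_smult_assoc_mat[of _ n n _ n])

text \<open>
A matrix has rank one if it is nonzero and the product of a column and a row; both properties survive
multiplication by invertible matrices.
\<close>

lemma CM_pairs_conj:
  assumes XY: "(X, Y) \<in> CM_pairs n"
    and AB: "A \<in> carrier_mat n n" "B \<in> carrier_mat n n" "A * B = 1\<^sub>m n" "B * A = 1\<^sub>m n"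
  shows "(A * X * B, A * Y * B) \<in> CM_pairs n"
proof (cases "n = 0")
  case True
  then show ?thesis
    using XY AB unfolding CM_pairs_iff by auto
next
  case False
  have c: "X \<in> carrier_mat n n" "Y \<in> carrier_mat n n"
    using XY unfolding CM_pairs_iff by auto
  let ?M = "substitute n (X, Y) kappa"
  have M: "?M \<in> carrier_mat n n" by simp
  obtain f g where fg: "\<And>i j. i < n \<Longrightarrow> j < n \<Longrightarrow> ?M $$ (i, j) = f i * g j" and nz: "?M \<noteq> 0\<^sub>m n n"
    using XY False rank_one_iff[OF M] unfolding CM_pairs_iff by auto
  have entry: "(A * ?M * B) $$ (i, j) = (\<Sum>s<n. A $$ (i, s) * f s) * (\<Sum>t<n. g t * B $$ (t, j))"
    if ij: "i < n" "j < n" for i j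
  proof -
    have AM: "(A * ?M) $$ (i, t) = (\<Sum>s<n. A $$ (i, s) * f s) * g t" if "t < n" for t
      using that ij fg unfolding mult_mat_entry[OF AB(1) M ij(1) that]
      by (simp add: sum_distrib_right mult.assoc)
    have "A * ?M \<in> carrier_mat n n"
      using AB M by simp
    from mult_mat_entry[OF this AB(2) ij] show ?thesis
      by (simp add: AM sum_distrib_left mult.assoc)
  qed
  have "A * ?M * B \<noteq> 0\<^sub>m n n"
  proof
    assume 0: "A * ?M * B = 0\<^sub>m n n"
    have "?M = (B * A) * ?M * (B * A)"
      unfolding AB(4) using M by simp
    also have "\<dots> = B * (A * ?M * B) * A"
      using AB(1,2) M by (simp only: assoc_mult_mat[of _ n n _ n _ n] mult_carrier_mat[of _ n n _ n])
    finally show False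
      using nz AB(1,2) unfolding 0 by simp
  qed
  moreover have "A * ?M * B \<in> carrier_mat n n"
    by (intro mult_carrier_mat[of _ n n _ n] AB(1,2) M)
  moreover have "\<exists>f g. \<forall>i<n. \<forall>j<n. (A * ?M * B) $$ (i, j) = f i * g j"
    by (intro exI[of _ "\<lambda>i. \<Sum>s<n. A $$ (i, s) * f s"] exI[of _ "\<lambda>j. \<Sum>t<n. g t * B $$ (t, j)"]
        allI impI entry)
  ultimately have "vec_space.rank n (A * ?M * B) = 1"
    by (simp only: rank_one_iff simp_thms)
  then show ?thesis
    using AB(1,2) c unfolding CM_pairs_iff substitute_conj[OF AB c] by auto
qed

lemma rank_one_image:
  fixes M :: "complex mat"
  assumes M: "M \<in> carrier_mat n n" "vec_space.rank n M = 1"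
    and uv: "u \<in> carrier_vec n" "v \<in> carrier_vec n" "M *\<^sub>v v \<noteq> 0\<^sub>v n"
  shows "\<exists>c. M *\<^sub>v u = c \<cdot>\<^sub>v (M *\<^sub>v v)"
proof -
  obtain f g where fg: "\<And>i j. i < n \<Longrightarrow> j < n \<Longrightarrow> M $$ (i, j) = f i * g j"
    using M(2) unfolding rank_one_iff[OF M(1)] by blast
  define \<gamma> where "\<gamma> w = (\<Sum>j<n. g j * w $ j)" for w
  have Mw: "(M *\<^sub>v w) $ i = f i * \<gamma> w" if "w \<in> carrier_vec n" "i < n" for w i
    using that M(1) fg unfolding \<gamma>_def
    by (auto simp: scalar_prod_def atLeast0LessThan sum_distrib_left mult.assoc intro!: sum.cong)
  have "\<gamma> v \<noteq> 0"
  proof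
    assume "\<gamma> v = 0"
    then have "M *\<^sub>v v = 0\<^sub>v n"
      using Mw[OF uv(2)] M(1) by (intro eq_vecI) (auto simp del: index_mult_mat_vec)
    then show False
      using uv(3) by simp
  qed
  then have "M *\<^sub>v u = (\<gamma> u / \<gamma> v) \<cdot>\<^sub>v (M *\<^sub>v v)"
    using Mw[OF uv(1)] Mw[OF uv(2)] M(1) by (intro eq_vecI) (auto simp del: index_mult_mat_vec)
  then show ?thesis by blast
qed

lemma smult_mult_mat_vec:
  fixes A :: "'a :: comm_ring_1 mat"
  assumes "A \<in> carrier_mat n m" "v \<in> carrier_vec m"
  shows "(c \<cdot>\<^sub>m A) *\<^sub>v v = c \<cdot>\<^sub>v (A *\<^sub>v v)"
  using assms by (intro eq_vecI) (auto simp: scalar_prod_def sum_distrib_left mult.assoc)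

text \<open>
Write \<open>M = [X, Y] + 1\<close> and let \<open>E\<close> be a projector onto the space \<open>V\<close> of all \<open>p(X, Y) M v\<close>. It is stable under \<open>X\<close> and
\<open>Y\<close>, and it contains the image of \<open>M\<close>, which is a line. From \<open>X E = E X E\<close> and \<open>Y E = E Y E\<close> the
traces of \<open>X Y E\<close> and \<open>Y X E\<close> agree, so \<open>M E\<close> has the trace of \<open>E\<close>. From \<open>E M = M\<close> it also has the trace of
\<open>M\<close>, which is \<open>n\<close>. So the idempotent \<open>1 - E\<close> has trace 0 and vanishes.
\<close>

theorem CM_pairs_cyclic:
  assumes P: "P \<in> CM_pairs n" and v: "v \<in> carrier_vec n"
    and nz: "substitute n P kappa *\<^sub>v v \<noteq> 0\<^sub>v n" and w: "w \<in> carrier_vec n"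
  shows "\<exists>p. substitute n P (p * kappa) *\<^sub>v v = w"
proof -
  let ?S = "substitute n P"
  let ?M = "?S kappa"
  have P': "P \<in> matrix_pairs n" and rank: "n = 0 \<or> vec_space.rank n ?M = 1"
    using P unfolding CM_pairs_iff by auto
  have "n \<noteq> 0"
  proof
    assume "n = 0"
    then have "?M *\<^sub>v v = 0\<^sub>v n"
      by (intro eq_vecI) auto
    then show False
      using nz by simp
  qed
  then have rank: "vec_space.rank n ?M = 1"
    using rank by simp
  obtain X Y where XY: "P = (X, Y)" "X \<in> carrier_mat n n" "Y \<in> carrier_mat n n"
    using P' by (cases P) auto
  define V where "V = {?S (p * kappa) *\<^sub>v v | p. True}"
  have mem: "?S (p * kappa) *\<^sub>v v \<in> V" for p
    unfolding V_def by blast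
  have S_mult: "?S (q * p) *\<^sub>v u = ?S q *\<^sub>v (?S p *\<^sub>v u)" if "u \<in> carrier_vec n" for p q u
    unfolding substitute_mult[OF P'] using that by (simp add: assoc_mult_mat_vec[of _ n n _ n])
  have "\<exists>E m. E \<in> carrier_mat n n \<and> (\<forall>v\<in>carrier_vec n. E *\<^sub>v v \<in> V) \<and>
    (\<forall>v\<in>V. E *\<^sub>v v = v) \<and> mat_trace E = of_nat m \<and> (m = 0 \<longrightarrow> E = 0\<^sub>m n n)"
  proof (rule subspace_projector)
    show "V \<subseteq> carrier_vec n"
      unfolding V_def using v by (auto intro!: mult_mat_vec_carrier[of _ n n])
    have "0\<^sub>m n n *\<^sub>v v = 0\<^sub>v n"
      using v by (intro eq_vecI) auto
    then show "0\<^sub>v n \<in> V"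
      using mem[of 0] by (simp add: substitute_zero)
  next
    fix a b assume "a \<in> V" "b \<in> V"
    then obtain p q where "a = ?S (p * kappa) *\<^sub>v v" "b = ?S (q * kappa) *\<^sub>v v"
      unfolding V_def by blast
    then have "a + b = ?S ((p + q) * kappa) *\<^sub>v v"
      using v by (simp add: distrib_right substitute_add add_mult_distrib_mat_vec[of _ n n])
    then show "a + b \<in> V"
      using mem by simp
  next
    fix c a assume "a \<in> V"
    then obtain p where "a = ?S (p * kappa) *\<^sub>v v"
      unfolding V_def by blast
    then have "c \<cdot>\<^sub>v a = ?S ((scalar c * p) * kappa) *\<^sub>v v"
      using v by (simp add: mult.assoc substitute_scalar_mult[OF P'] smult_mult_mat_vec[of _ n n])
    then show "c \<cdot>\<^sub>v a \<in> V"
      using mem by simp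
  qed
  then obtain E where E: "E \<in> carrier_mat n n" "\<And>u. u \<in> carrier_vec n \<Longrightarrow> E *\<^sub>v u \<in> V"
    "\<And>u. u \<in> V \<Longrightarrow> E *\<^sub>v u = u"
    by blast
  have EE: "E * (Z * E) = Z * E"
    if Z: "Z \<in> carrier_mat n n" "\<And>u. u \<in> V \<Longrightarrow> Z *\<^sub>v u \<in> V" for Z
    using Z E by (intro mat_eq_on_vec[of _ n n]) (auto simp: assoc_mult_mat_vec[of _ n n _ n])
  have stable: "Z *\<^sub>v u \<in> V" if Z: "Z = ?S z" and u: "u \<in> V" for Z z u
  proof -
    obtain p where "u = ?S (p * kappa) *\<^sub>v v"
      using u unfolding V_def by blast
    then have "Z *\<^sub>v u = ?S ((z * p) * kappa) *\<^sub>v v"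
      unfolding Z using S_mult[OF v, of z "p * kappa"] by (simp add: mult.assoc)
    then show ?thesis
      using mem by simp
  qed
  have gens: "X = ?S gen_x" "Y = ?S gen_y"
    using substitute_gen[OF P'] XY(1) by simp_all
  have EX: "E * (X * E) = X * E" and EY: "E * (Y * E) = Y * E"
    by (rule EE[OF XY(2) stable[OF gens(1)]], assumption)
      (rule EE[OF XY(3) stable[OF gens(2)]], assumption)
  have "?M *\<^sub>v u \<in> V" if u: "u \<in> carrier_vec n" for u
  proof -
    obtain c where "?M *\<^sub>v u = c \<cdot>\<^sub>v (?M *\<^sub>v v)"
      using rank_one_image[OF substitute_carrier rank u v nz] by blast
    also have "\<dots> = ?S (scalar c * kappa) *\<^sub>v v"
      using v by (simp add: substitute_scalar_mult[OF P'] smult_mult_mat_vec[of _ n n])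
    finally show ?thesis
      using mem by simp
  qed
  then have EM: "E * ?M = ?M"
    using E by (intro mat_eq_on_vec[of _ n n]) (auto simp: assoc_mult_mat_vec[of _ n n _ n])
  have M: "?M = X * Y - Y * X + 1\<^sub>m n"
    using substitute_kappa[OF P'] XY(1) by simp
  have XYc: "X * Y \<in> carrier_mat n n" "Y * X \<in> carrier_mat n n"
    using XY by simp_all
  have "mat_trace (?M * E) = mat_trace (X * Y * E) - mat_trace (Y * X * E) + mat_trace E"
  proof -
    have c: "X * Y - Y * X \<in> carrier_mat n n" "X * Y * E \<in> carrier_mat n n"
      "Y * X * E \<in> carrier_mat n n" "X * Y * E - Y * X * E \<in> carrier_mat n n"
      by (intro minus_carrier_mat mult_carrier_mat[of _ n n _ n] XYc E(1))+
    have "?M * E = X * Y * E - Y * X * E + E"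
      unfolding M add_mult_distrib_mat[OF c(1) one_carrier_mat E(1)]
        minus_mult_distrib_mat[OF XYc E(1)] left_mult_one_mat[OF E(1)] ..
    then show ?thesis
      by (simp only: mat_trace_add[OF c(4) E(1)] mat_trace_diff[OF c(2,3)])
  qed
  moreover have "X * Y * E = (X * E) * (Y * E)" "Y * X * E = (Y * E) * (X * E)"
    using XY(2,3) E(1) EX EY by (simp_all add: assoc_mult_mat[of _ n n _ n _ n])
  moreover have "mat_trace ((X * E) * (Y * E)) = mat_trace ((Y * E) * (X * E))"
    using XY(2,3) E(1) by (intro mat_trace_mult_commute[of _ n]) auto
  ultimately have "mat_trace (?M * E) = mat_trace E"
    by simp
  moreover have "mat_trace ?M = mat_trace (?M * E)"
    using mat_trace_mult_commute[OF E(1) substitute_carrier, of P kappa] EM by simp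
  moreover have "mat_trace ?M = of_nat n"
    unfolding M mat_trace_add[OF minus_carrier_mat[OF XYc(2)] one_carrier_mat]
      mat_trace_diff[OF XYc] mat_trace_mult_commute[OF XY(2,3)] mat_trace_one by simp
  ultimately have tr: "mat_trace E = of_nat n"
    by simp
  let ?F = "1\<^sub>m n - E"
  have EE': "E * E = E"
  proof (rule mat_eq_on_vec[OF mult_carrier_mat[OF E(1) E(1)] E(1)])
    fix u :: "complex vec" assume u: "u \<in> carrier_vec n"
    show "E * E *\<^sub>v u = E *\<^sub>v u"
      using E(3)[OF E(2)[OF u]] assoc_mult_mat_vec[OF E(1) E(1) u] by simp
  qed
  have Fc: "?F \<in> carrier_mat n n"
    by (rule minus_carrier_mat[OF E(1)])
  have "E * ?F = 0\<^sub>m n n"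
    unfolding mult_minus_distrib_mat[OF E(1) one_carrier_mat E(1)] EE'
    using E(1) by simp
  then have "?F * ?F = ?F - 0\<^sub>m n n"
    unfolding minus_mult_distrib_mat[OF one_carrier_mat E(1) Fc] left_mult_one_mat[OF Fc] by simp
  then have "?F * ?F = ?F"
    using E(1) by (simp only:) (intro eq_matI, auto)
  moreover have "mat_trace ?F = 0"
    unfolding mat_trace_diff[OF one_carrier_mat E(1)] mat_trace_one tr by simp
  ultimately have F: "?F = 0\<^sub>m n n"
    using E(1) by (intro idempotent_trace_zero) auto
  have "E = 1\<^sub>m n"
  proof (rule eq_matI)
    fix i j assume "i < dim_row (1\<^sub>m n :: complex mat)" "j < dim_col (1\<^sub>m n :: complex mat)"
    then have ij: "i < n" "j < n" by auto
    have "?F $$ (i, j) = 0"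
      unfolding F using ij by simp
    then show "E $$ (i, j) = 1\<^sub>m n $$ (i, j)"
      using ij E(1) by simp
  qed (use E(1) in auto)
  then have "w \<in> V"
    using E(2)[OF w] w by simp
  then show ?thesis
    unfolding V_def by blast
qed

text \<open>
The matrix with columns \<open>p\<^sub>a(X, Y) M v\<close>, where \<open>M = [X, Y] + 1\<close>.
\<close>

definition frame :: "nat \<Rightarrow> (nat \<Rightarrow> free_alg) \<Rightarrow> complex vec \<Rightarrow> mat_pair \<Rightarrow> complex mat" where
  "frame n p v P = mat n n (\<lambda>(i, a). (substitute n P (p a * kappa) *\<^sub>v v) $ i)"

lemma frame_carrier [simp]: "frame n p v P \<in> carrier_mat n n"
  unfolding frame_def by simp

lemma frame_dim [simp]: "dim_row (frame n p v P) = n" "dim_col (frame n p v P) = n"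
  unfolding frame_def by simp_all

text \<open>
Conjugating the pair by \<open>A\<close> moves the frame by \<open>A\<close>, at the price of replacing \<open>v\<close>; this is why \<open>v\<close> is kept variable.
\<close>

lemma frame_conj:
  assumes AB: "A \<in> carrier_mat n n" "B \<in> carrier_mat n n" "A * B = 1\<^sub>m n" "B * A = 1\<^sub>m n"
    and XY: "X \<in> carrier_mat n n" "Y \<in> carrier_mat n n" and v: "v \<in> carrier_vec n"
  shows "frame n p v (A * X * B, A * Y * B) = A * frame n p (B *\<^sub>v v) (X, Y)"
proof (rule eq_matI)
  fix i a assume "i < dim_row (A * frame n p (B *\<^sub>v v) (X, Y))" "a < dim_col (A * frame n p (B *\<^sub>v v) (X, Y))"
  then have ia: "i < n" "a < n" using AB by auto
  let ?S = "substitute n (X, Y) (p a * kappa)"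
  have col: "col (frame n p (B *\<^sub>v v) (X, Y)) a = ?S *\<^sub>v (B *\<^sub>v v)"
    unfolding frame_def using ia by (intro eq_vecI) auto
  have "A * ?S * B *\<^sub>v v = A *\<^sub>v (?S *\<^sub>v (B *\<^sub>v v))"
    using AB(1,2) v by (simp only: assoc_mult_mat_vec[of _ n n _ n] mult_carrier_mat[of _ n n _ n]
        substitute_carrier mult_mat_vec_carrier[of _ n n])
  then have "frame n p v (A * X * B, A * Y * B) $$ (i, a) = (A *\<^sub>v (?S *\<^sub>v (B *\<^sub>v v))) $ i"
    using ia unfolding frame_def substitute_conj[OF AB XY] by simp
  also have "\<dots> = (A * frame n p (B *\<^sub>v v) (X, Y)) $$ (i, a)"
    using ia AB(1) by (simp add: col)
  finally show "frame n p v (A * X * B, A * Y * B) $$ (i, a) = (A * frame n p (B *\<^sub>v v) (X, Y)) $$ (i, a)" .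
qed (use AB in auto)

text \<open>
As \<open>M v\<close> is cyclic for some \<open>v\<close>, the frame can even be made the identity matrix at the given pair.
\<close>

lemma frame_exists:
  assumes P: "P \<in> CM_pairs n"
  shows "\<exists>p. \<exists>v\<in>carrier_vec n. Determinant.det (frame n p v P) \<noteq> 0"
proof (cases "n = 0")
  case True
  then show ?thesis
    by (intro exI[of _ "\<lambda>_. 0"] bexI[of _ "0\<^sub>v n"]) (simp_all add: det_dim_zero)
next
  case False
  let ?M = "substitute n P kappa"
  have "?M \<noteq> 0\<^sub>m n n"
    using P False rank_one_iff[OF substitute_carrier] unfolding CM_pairs_iff by auto
  then obtain v where v: "v \<in> carrier_vec n" "?M *\<^sub>v v \<noteq> 0\<^sub>m n n *\<^sub>v v"
    using mat_eq_on_vec[of ?M n n "0\<^sub>m n n"] by auto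
  have "0\<^sub>m n n *\<^sub>v v = 0\<^sub>v n"
    using v(1) by (intro eq_vecI) auto
  then have "\<exists>q. substitute n P (q * kappa) *\<^sub>v v = unit_vec n a" for a
    using CM_pairs_cyclic[OF P v(1) _ unit_vec_carrier] v(2) by simp
  then obtain p where p: "\<And>a. substitute n P (p a * kappa) *\<^sub>v v = unit_vec n a"
    by metis
  have "frame n p v P = 1\<^sub>m n"
    unfolding frame_def p by (intro eq_matI) auto
  then show ?thesis
    using v(1) by (intro exI[of _ p] bexI[of _ v]) auto
qed

text \<open>
The image of a matrix of rank one is a line, so another choice of \<open>v\<close> rescales \<open>M v\<close> and with it the
whole frame.
\<close>

lemma frame_proportional:
  assumes P: "P \<in> CM_pairs n" and uv: "u \<in> carrier_vec n" "v \<in> carrier_vec n"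
    and det: "Determinant.det (frame n p v P) \<noteq> 0"
  shows "\<exists>c. frame n p u P = c \<cdot>\<^sub>m frame n p v P"
proof (cases "n = 0")
  case True
  then show ?thesis
    by (intro exI[of _ 0] eq_matI) auto
next
  case False
  let ?M = "substitute n P kappa"
  have P': "P \<in> matrix_pairs n" and rank: "vec_space.rank n ?M = 1"
    using P False unfolding CM_pairs_iff by auto
  have S: "substitute n P (p a * kappa) *\<^sub>v w = substitute n P (p a) *\<^sub>v (?M *\<^sub>v w)"
    if "w \<in> carrier_vec n" for a w
    unfolding substitute_mult[OF P'] using that by (simp add: assoc_mult_mat_vec[of _ n n _ n])
  have scale: "frame n p w P = c \<cdot>\<^sub>m frame n p v P"
    if w: "w \<in> carrier_vec n" and c: "?M *\<^sub>v w = c \<cdot>\<^sub>v (?M *\<^sub>v v)" for w c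
  proof (rule eq_matI)
    fix i a assume "i < dim_row (c \<cdot>\<^sub>m frame n p v P)" "a < dim_col (c \<cdot>\<^sub>m frame n p v P)"
    then have ia: "i < n" "a < n" by auto
    have "substitute n P (p a) *\<^sub>v (c \<cdot>\<^sub>v (?M *\<^sub>v v)) = c \<cdot>\<^sub>v (substitute n P (p a) *\<^sub>v (?M *\<^sub>v v))"
      using uv(2) by (intro mult_mat_vec[of _ n n] mult_mat_vec_carrier[of _ n n]) auto
    then show "frame n p w P $$ (i, a) = (c \<cdot>\<^sub>m frame n p v P) $$ (i, a)"
      using ia by (simp add: frame_def S[OF w] S[OF uv(2)] c del: index_mult_mat_vec)
  qed auto
  have "?M *\<^sub>v v \<noteq> 0\<^sub>v n"
  proof
    assume "?M *\<^sub>v v = 0\<^sub>v n"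
    then have "?M *\<^sub>v v = 0 \<cdot>\<^sub>v (?M *\<^sub>v v)"
      by auto
    from scale[OF uv(2) this] have "Determinant.det (frame n p v P) = 0"
      using False det_smult[of 0 "frame n p v P"] by (simp add: power_0_left)
    then show False
      using det by simp
  qed
  from rank_one_image[OF substitute_carrier rank uv this] scale[OF uv(1)] show ?thesis
    by blast
qed

definition conj_by :: "complex mat \<Rightarrow> mat_pair \<Rightarrow> mat_pair" where
  "conj_by K P = ((1 / Determinant.det K) \<cdot>\<^sub>m adj_mat K * fst P * K,
     (1 / Determinant.det K) \<cdot>\<^sub>m adj_mat K * snd P * K)"

lemma adj_mat_inverse:
  fixes K :: "complex mat"
  assumes K: "K \<in> carrier_mat n n" "Determinant.det K \<noteq> 0"
  defines "J \<equiv> (1 / Determinant.det K) \<cdot>\<^sub>m adj_mat K"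
  shows "J \<in> carrier_mat n n" "J * K = 1\<^sub>m n" "K * J = 1\<^sub>m n"
proof -
  note adj = adj_mat[OF K(1)]
  show "J \<in> carrier_mat n n"
    unfolding J_def using adj by simp
  have "(1 / Determinant.det K) \<cdot>\<^sub>m (Determinant.det K \<cdot>\<^sub>m 1\<^sub>m n) = 1\<^sub>m n"
    using K(2) by (intro eq_matI) auto
  then show "J * K = 1\<^sub>m n" "K * J = 1\<^sub>m n"
    unfolding J_def using adj K(1)
    by (simp_all add: mult_smult_assoc_mat[of _ n n _ n] mult_smult_distrib[of _ n n _ n])
qed

lemma conj_by_conj_rel:
  assumes P: "P \<in> CM_pairs n" and K: "K \<in> carrier_mat n n" "Determinant.det K \<noteq> 0"
  shows "(P, conj_by K P) \<in> conj_rel n"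
proof -
  obtain X Y where XY: "P = (X, Y)" by (cases P)
  note J = adj_mat_inverse[OF K]
  show ?thesis
    unfolding conj_by_def XY conj_rel_iff fst_conv snd_conv
    using CM_pairs_conj[OF P[unfolded XY] J(1) K(1) J(2,3)] P J K(1) unfolding XY by blast
qed

lemma conj_by_eqI:
  assumes K: "K \<in> carrier_mat n n" "Determinant.det K \<noteq> 0"
    and c: "P \<in> matrix_pairs n" "Q \<in> matrix_pairs n"
    and eq: "fst P * K = K * fst Q" "snd P * K = K * snd Q"
  shows "conj_by K P = Q"
proof -
  define J where "J = (1 / Determinant.det K) \<cdot>\<^sub>m adj_mat K"
  note J = adj_mat_inverse[OF K, folded J_def]
  have "J * Z * K = Z'" if "Z \<in> carrier_mat n n" "Z' \<in> carrier_mat n n" "Z * K = K * Z'" for Z Z'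
  proof -
    have "J * Z * K = J * (K * Z')"
      using that J(1) K(1) by (simp add: assoc_mult_mat[of _ n n _ n _ n])
    also have "\<dots> = (J * K) * Z'"
      using that(2) J(1) K(1) by (simp only: assoc_mult_mat[of _ n n _ n _ n])
    finally show ?thesis
      using that(2) J(2) by simp
  qed
  then show ?thesis
    unfolding conj_by_def J_def[symmetric] using matrix_pairsD[OF c(1)] matrix_pairsD[OF c(2)] eq
    by (cases Q) simp
qed

lemma conj_by_intertwines:
  assumes K: "K \<in> carrier_mat n n" "Determinant.det K \<noteq> 0" and P: "P \<in> matrix_pairs n"
  shows "conj_by K P \<in> matrix_pairs n"
    "fst P * K = K * fst (conj_by K P)" "snd P * K = K * snd (conj_by K P)"
proof -
  define J where "J = (1 / Determinant.det K) \<cdot>\<^sub>m adj_mat K"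
  note J = adj_mat_inverse[OF K, folded J_def]
  have "K * (J * Z * K) = Z * K" if "Z \<in> carrier_mat n n" for Z
  proof -
    have "K * (J * Z * K) = (K * J) * (Z * K)"
      using that J(1) K(1) by (simp only: assoc_mult_mat[of _ n n _ n _ n] mult_carrier_mat[of _ n n _ n])
    then show ?thesis
      using that K(1) J(3) by simp
  qed
  then show "fst P * K = K * fst (conj_by K P)" "snd P * K = K * snd (conj_by K P)"
    unfolding conj_by_def J_def[symmetric] using matrix_pairsD[OF P] by simp_all
  show "conj_by K P \<in> matrix_pairs n"
    unfolding conj_by_def J_def[symmetric] using matrix_pairsD[OF P] J(1) K(1) by simp
qed

text \<open>
The pair written in the basis given by a frame. The choice of \<open>v\<close> does not matter where the frame is
a basis for some \<open>v\<close> (\<open>normal_form_eq\<close>); elsewhere the value is meaningless.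
\<close>

definition normal_form :: "nat \<Rightarrow> (nat \<Rightarrow> free_alg) \<Rightarrow> mat_pair \<Rightarrow> mat_pair" where
  "normal_form n p P = conj_by
     (frame n p (SOME v. v \<in> carrier_vec n \<and> Determinant.det (frame n p v P) \<noteq> 0) P) P"

lemma normal_form_eq:
  assumes P: "P \<in> CM_pairs n" and v: "v \<in> carrier_vec n" and det: "Determinant.det (frame n p v P) \<noteq> 0"
  shows "normal_form n p P = conj_by (frame n p v P) P"
proof -
  define u where "u = (SOME v. v \<in> carrier_vec n \<and> Determinant.det (frame n p v P) \<noteq> 0)"
  have "u \<in> carrier_vec n \<and> Determinant.det (frame n p u P) \<noteq> 0"
    unfolding u_def by (rule someI[of _ v]) (use v det in simp)
  then have u: "u \<in> carrier_vec n" "Determinant.det (frame n p u P) \<noteq> 0" by auto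
  obtain c where c: "frame n p u P = c \<cdot>\<^sub>m frame n p v P"
    using frame_proportional[OF P u(1) v det] by blast
  have P': "P \<in> matrix_pairs n"
    using P CM_pairs_subset by blast
  let ?K = "frame n p v P"
  note Q = conj_by_intertwines[OF frame_carrier det P']
  have "Z * (c \<cdot>\<^sub>m ?K) = c \<cdot>\<^sub>m ?K * Z'"
    if "Z \<in> carrier_mat n n" "Z' \<in> carrier_mat n n" "Z * ?K = ?K * Z'" for Z Z'
    using that by (simp add: mult_smult_distrib[of _ n n _ n] mult_smult_assoc_mat[of _ n n _ n])
  then have "conj_by (frame n p u P) P = conj_by ?K P"
    using matrix_pairsD[OF P'] matrix_pairsD[OF Q(1)] Q(2,3) c
    by (intro conj_by_eqI[OF frame_carrier u(2) P' Q(1)]) auto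
  then show ?thesis
    unfolding normal_form_def u_def by simp
qed

definition frame_domain :: "nat \<Rightarrow> (nat \<Rightarrow> free_alg) \<Rightarrow> mat_pair set" where
  "frame_domain n p =
     {P \<in> CM_pairs n. \<exists>v\<in>carrier_vec n. Determinant.det (frame n p v P) \<noteq> 0}"

text \<open>
If \<open>P'\<close> is the conjugate of \<open>P\<close> by \<open>A\<close>, then the frame of \<open>P'\<close> for the vector \<open>A v\<close> is \<open>A\<close> times the frame of
\<open>P\<close> for \<open>v\<close>, and the two changes of basis give the same pair.
\<close>

lemma normal_form_invariant:
  assumes P: "P \<in> frame_domain n p" and PP': "(P, P') \<in> conj_rel n"
  shows "P' \<in> frame_domain n p" "normal_form n p P' = normal_form n p P"
proof -
  obtain X Y where XY: "P = (X, Y)" by (cases P)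
  obtain A B where AB: "A \<in> carrier_mat n n" "B \<in> carrier_mat n n" "A * B = 1\<^sub>m n"
    "B * A = 1\<^sub>m n" and P': "P' = (A * X * B, A * Y * B)" and CM: "P \<in> CM_pairs n" "P' \<in> CM_pairs n"
    using PP' unfolding XY conj_rel_iff by blast
  have c: "X \<in> carrier_mat n n" "Y \<in> carrier_mat n n" "P \<in> matrix_pairs n" "P' \<in> matrix_pairs n"
    using CM unfolding CM_pairs_iff XY by auto
  obtain v where v: "v \<in> carrier_vec n" "Determinant.det (frame n p v P) \<noteq> 0"
    using P unfolding frame_domain_def by blast
  let ?K = "frame n p v P"
  have Av: "A *\<^sub>v v \<in> carrier_vec n"
    using AB v by simp
  have "B *\<^sub>v (A *\<^sub>v v) = v"
    using AB v(1) by (simp add: assoc_mult_mat_vec[of _ n n _ n, symmetric])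
  then have K': "frame n p (A *\<^sub>v v) P' = A * ?K"
    using frame_conj[OF AB c(1,2) Av, of p] unfolding P' XY by simp
  have "Determinant.det A * Determinant.det B = 1"
    using det_mult[OF AB(1,2)] AB(3) by simp
  then have det': "Determinant.det (frame n p (A *\<^sub>v v) P') \<noteq> 0"
    unfolding K' using det_mult[OF AB(1) frame_carrier] v(2) by auto
  show "P' \<in> frame_domain n p"
    unfolding frame_domain_def using CM(2) Av det' by blast
  note Q = conj_by_intertwines[OF frame_carrier v(2) c(3)]
  have "A * Z * B * (A * ?K) = A * ?K * Z'"
    if "Z \<in> carrier_mat n n" "Z' \<in> carrier_mat n n" "Z * ?K = ?K * Z'" for Z Z'
  proof -
    have "A * Z * B * (A * ?K) = A * (Z * ((B * A) * ?K))"
      using that(1) AB(1,2) by (simp only: assoc_mult_mat[of _ n n _ n _ n] mult_carrier_mat[of _ n n _ n]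
          frame_carrier)
    also have "\<dots> = A * (?K * Z')"
      using AB(4) that(3) by simp
    also have "\<dots> = A * ?K * Z'"
      using that(2) AB(1) by (simp only: assoc_mult_mat[of _ n n _ n _ n] frame_carrier)
    finally show ?thesis .
  qed
  then have "conj_by (frame n p (A *\<^sub>v v) P') P' = conj_by ?K P"
    using c(1,2) matrix_pairsD[OF Q(1)] Q(2,3) K' unfolding P' XY
    by (intro conj_by_eqI[OF frame_carrier det'[unfolded P'] _ Q(1)[unfolded XY]])
      (use c(4) P' in auto)
  then show "normal_form n p P' = normal_form n p P"
    using normal_form_eq[OF CM(2) Av det'] normal_form_eq[OF CM(1) v] by simp
qed

lemma normal_form_conj_rel:
  assumes "P \<in> frame_domain n p"
  shows "(P, normal_form n p P) \<in> conj_rel n"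
proof -
  obtain v where "P \<in> CM_pairs n" "v \<in> carrier_vec n" "Determinant.det (frame n p v P) \<noteq> 0"
    using assms unfolding frame_domain_def by blast
  then show ?thesis
    using normal_form_eq conj_by_conj_rel[OF _ frame_carrier] by simp
qed

definition CM_coordinates :: "nat \<Rightarrow> (mat_pair \<Rightarrow> complex) set" where
  "CM_coordinates n = (\<lambda>c P. entry P c) ` entries n"

lemma CM_pairs_variety_affine:
  "CM_pairs_variety n = affine_subspace (CM_pairs n) (CM_coordinates n)"
proof -
  have "{(\<lambda>P. fst P $$ (i, j)) | i j. i < n \<and> j < n} \<union> {(\<lambda>P. snd P $$ (i, j)) | i j. i < n \<and> j < n} =
      CM_coordinates n" (is "?X \<union> ?Y = _")
  proof (intro equalityI subsetI)
    fix \<phi> :: "mat_pair \<Rightarrow> complex" assume "\<phi> \<in> ?X \<union> ?Y"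
    then consider i j where "\<phi> = (\<lambda>P. entry P (True, i, j))" "i < n" "j < n"
      | i j where "\<phi> = (\<lambda>P. entry P (False, i, j))" "i < n" "j < n"
      by auto
    then obtain b i j where "\<phi> = (\<lambda>P. entry P (b, i, j))" "i < n" "j < n"
      by cases metis+
    then show "\<phi> \<in> CM_coordinates n"
      unfolding CM_coordinates_def entries_def by (intro image_eqI[of _ _ "(b, i, j)"]) auto
  next
    fix \<phi> assume "\<phi> \<in> CM_coordinates n"
    then obtain b i j where "\<phi> = (\<lambda>P. entry P (b, i, j))" "i < n" "j < n"
      unfolding CM_coordinates_def entries_def by auto
    then show "\<phi> \<in> ?X \<union> ?Y"
      by (cases b) auto
  qed
  then show ?thesis
    unfolding CM_pairs_variety_def by simp
qed

lemma CM_space_affine: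
  "CM_space n = quotient_variety (affine_subspace (CM_pairs n) (CM_coordinates n)) (conj_rel n)"
  unfolding CM_space_def CM_pairs_variety_affine ..

lemma entry_polynomial:
  "c \<in> entries n \<Longrightarrow> (\<lambda>P. entry P c) \<in> polynomial_functions (CM_coordinates n)"
  unfolding CM_coordinates_def by (intro polynomial_functions.coordinate) auto

lemma box_polys_polynomial:
  assumes "f \<in> box_polys (entries n) d"
  shows "(\<lambda>P. f (entry P)) \<in> polynomial_functions (CM_coordinates n)"
proof -
  note alg = function_algebra_polynomial_functions[of "CM_coordinates n"]
  obtain q where q: "\<And>z. f z = (\<Sum>e\<in>exponents (entries n) d. q e * monomial (entries n) e z)"
    using assms unfolding box_polys_def by blast
  show ?thesis
    unfolding q monomial_def
    by (intro function_algebra_sum[OF alg] function_algebra_mult[OF alg] function_algebra_const[OF alg]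
        function_algebra_prod[OF alg] function_algebra_power[OF alg] entry_polynomial)
qed

text \<open>
The frame with entries that are polynomial on all pairs of matrices, of whatever dimensions.
\<close>

definition poly_frame :: "nat \<Rightarrow> (nat \<Rightarrow> free_alg) \<Rightarrow> complex vec \<Rightarrow> mat_pair \<Rightarrow> complex mat" where
  "poly_frame n p v P = frame n p v (pair_of_entries n (entry P))"

lemma poly_frame_polynomial:
  assumes v: "v \<in> carrier_vec n" and ij: "i < n" "a < n"
  shows "(\<lambda>P. poly_frame n p v P $$ (i, a)) \<in> polynomial_functions (CM_coordinates n)"
proof -
  obtain d where d: "p a * kappa \<in> deg_le d"
    using deg_le_exists by blast
  have "poly_frame n p v P $$ (i, a) =
      (\<Sum>j<n. v $ j * substitute n (pair_of_entries n (entry P)) (p a * kappa) $$ (i, j))" for P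
    using v ij unfolding poly_frame_def frame_def
    by (auto simp: scalar_prod_def atLeast0LessThan mult.commute intro!: sum.cong)
  moreover have "(\<lambda>P. \<Sum>j<n. v $ j * substitute n (pair_of_entries n (entry P)) (p a * kappa) $$ (i, j))
      \<in> polynomial_functions (CM_coordinates n)"
    using ij substitute_entry_box_polys[OF d]
    by (intro box_polys_polynomial[where f = "\<lambda>z. \<Sum>j<n. v $ j *
          substitute n (pair_of_entries n z) (p a * kappa) $$ (i, j)" and d = d]
        box_polys_sum box_polys_scale) auto
  ultimately show ?thesis by simp
qed

lemma poly_frame_carrier: "poly_frame n p v P \<in> carrier_mat n n"
  unfolding poly_frame_def by (rule frame_carrier)

lemma poly_frame_det_polynomial:
  assumes "v \<in> carrier_vec n"
  shows "(\<lambda>P. Determinant.det (poly_frame n p v P)) \<in> polynomial_functions (CM_coordinates n)"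
  by (rule function_algebra_det[OF function_algebra_polynomial_functions poly_frame_carrier
        poly_frame_polynomial[OF assms]])

lemma poly_frame_eq: "P \<in> matrix_pairs n \<Longrightarrow> poly_frame n p v P = frame n p v P"
  unfolding poly_frame_def by (simp add: pair_of_entries_entry)

lemma conj_by_entry:
  assumes K: "K \<in> carrier_mat n n" and P: "P \<in> matrix_pairs n" and ij: "i < n" "j < n"
  shows "entry (conj_by K P) (b, i, j) =
    (\<Sum>t<n. (\<Sum>s<n. cofactor K s i * entry P (b, s, t)) * K $$ (t, j)) / Determinant.det K"
proof -
  define J where "J = (1 / Determinant.det K) \<cdot>\<^sub>m adj_mat K"
  have J: "J \<in> carrier_mat n n"
    unfolding J_def using adj_mat(1)[OF K] by simp
  have J_entry: "J $$ (i, s) = cofactor K s i / Determinant.det K" if "s < n" for s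
    unfolding J_def adj_mat_def using K ij that by simp
  have "(J * Z * K) $$ (i, j) =
      (\<Sum>t<n. (\<Sum>s<n. cofactor K s i * Z $$ (s, t)) * K $$ (t, j)) / Determinant.det K"
    if Z: "Z \<in> carrier_mat n n" for Z
  proof -
    have JZ: "(J * Z) $$ (i, t) = (\<Sum>s<n. cofactor K s i * Z $$ (s, t)) / Determinant.det K"
      if "t < n" for t
      unfolding mult_mat_entry[OF J Z ij(1) that] by (simp add: J_entry sum_divide_distrib)
    show ?thesis
      unfolding mult_mat_entry[OF mult_carrier_mat[OF J Z] K ij]
      by (simp add: JZ sum_divide_distrib[symmetric])
  qed
  from this[OF matrix_pairsD(1)[OF P]] this[OF matrix_pairsD(2)[OF P]] show ?thesis
    unfolding conj_by_def J_def[symmetric] by simp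
qed

lemma frame_domain_open:
  "openin (zariski (affine_subspace (CM_pairs n) (CM_coordinates n))) (frame_domain n p)"
  unfolding openin_affine_subspace
proof (intro conjI ballI)
  show "frame_domain n p \<subseteq> CM_pairs n"
    unfolding frame_domain_def by blast
  fix P assume P: "P \<in> frame_domain n p"
  then obtain v where v: "v \<in> carrier_vec n" "Determinant.det (frame n p v P) \<noteq> 0"
    unfolding frame_domain_def by blast
  have eq: "poly_frame n p v Q = frame n p v Q" if "Q \<in> CM_pairs n" for Q
    using that CM_pairs_subset poly_frame_eq by blast
  show "\<exists>h\<in>polynomial_functions (CM_coordinates n). h P \<noteq> 0 \<and>
      {Q \<in> CM_pairs n. h Q \<noteq> 0} \<subseteq> frame_domain n p"
  proof (intro bexI[of _ "\<lambda>P. Determinant.det (poly_frame n p v P)"] conjI)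
    show "Determinant.det (poly_frame n p v P) \<noteq> 0"
      using P v(2) eq unfolding frame_domain_def by simp
    show "{Q \<in> CM_pairs n. Determinant.det (poly_frame n p v Q) \<noteq> 0} \<subseteq> frame_domain n p"
      unfolding frame_domain_def using v(1) eq by auto
  qed (rule poly_frame_det_polynomial[OF v(1)])
qed

text \<open>
Near a given pair one vector \<open>v\<close> serves for the frame, and the entries of the conjugated pair are, by the cofactor
formula for the inverse, fractions with the determinant of the frame as denominator.
\<close>

lemma normal_form_regular:
  assumes c: "c \<in> entries n"
  shows "(\<lambda>P. entry (normal_form n p P) c)
    \<in> regular_on (affine_subspace (CM_pairs n) (CM_coordinates n)) (frame_domain n p)"
  unfolding regular_on_affine_subspace
proof
  note alg = function_algebra_polynomial_functions[of "CM_coordinates n"]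
  obtain b i j where bij: "c = (b, i, j)" "i < n" "j < n"
    using c unfolding entries_def by auto
  fix P assume P: "P \<in> frame_domain n p"
  then obtain v where v: "v \<in> carrier_vec n" "Determinant.det (frame n p v P) \<noteq> 0"
    unfolding frame_domain_def by blast
  have eq: "poly_frame n p v Q = frame n p v Q" if "Q \<in> CM_pairs n" for Q
    using that CM_pairs_subset poly_frame_eq by blast
  let ?K = "poly_frame n p v"
  note K = poly_frame_carrier[of n p v]
  define h where "h Q = Determinant.det (?K Q)" for Q
  define g where "g Q = (\<Sum>t<n. (\<Sum>s<n. cofactor (?K Q) s i * entry Q (b, s, t)) * ?K Q $$ (t, j))" for Q
  have h: "h \<in> polynomial_functions (CM_coordinates n)"
    unfolding h_def by (rule poly_frame_det_polynomial[OF v(1)])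
  have g: "g \<in> polynomial_functions (CM_coordinates n)"
    unfolding g_def using bij
    by (intro function_algebra_sum[OF alg] function_algebra_mult[OF alg] entry_polynomial
        function_algebra_cofactor[OF alg K poly_frame_polynomial[OF v(1)]]
        poly_frame_polynomial[OF v(1)]) (auto simp: entries_def)
  let ?N = "{Q \<in> CM_pairs n. h Q \<noteq> 0}"
  show "\<exists>N. openin (zariski (affine_subspace (CM_pairs n) (CM_coordinates n))) N \<and> P \<in> N \<and>
      N \<subseteq> frame_domain n p \<and> (\<exists>g\<in>polynomial_functions (CM_coordinates n).
        \<exists>h\<in>polynomial_functions (CM_coordinates n).
          \<forall>Q\<in>N. h Q \<noteq> 0 \<and> entry (normal_form n p Q) c = g Q / h Q)"
  proof (intro exI[of _ ?N] conjI)
    show "openin (zariski (affine_subspace (CM_pairs n) (CM_coordinates n))) ?N"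
      by (rule openin_principal[OF h])
    show "P \<in> ?N"
      using P v(2) eq unfolding frame_domain_def h_def by simp
    show "?N \<subseteq> frame_domain n p"
      unfolding frame_domain_def h_def using v(1) eq by auto
    have "h Q \<noteq> 0 \<and> entry (normal_form n p Q) c = g Q / h Q" if Q: "Q \<in> ?N" for Q
    proof
      show "h Q \<noteq> 0" using Q by simp
      have CM: "Q \<in> CM_pairs n" "Q \<in> matrix_pairs n" and det: "Determinant.det (frame n p v Q) \<noteq> 0"
        using Q eq[of Q] subsetD[OF CM_pairs_subset, of Q n] unfolding h_def by simp_all
      have "entry (normal_form n p Q) c = entry (conj_by (?K Q) Q) c"
        unfolding normal_form_eq[OF CM(1) v(1) det] eq[OF CM(1)] ..
      also have "\<dots> = g Q / h Q"
        unfolding bij(1) conj_by_entry[OF K CM(2) bij(2,3)] g_def h_def ..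
      finally show "entry (normal_form n p Q) c = g Q / h Q" .
    qed
    then show "\<exists>g\<in>polynomial_functions (CM_coordinates n).
        \<exists>h\<in>polynomial_functions (CM_coordinates n).
          \<forall>Q\<in>?N. h Q \<noteq> 0 \<and> entry (normal_form n p Q) c = g Q / h Q"
      by (intro bexI[of _ g] bexI[of _ h] ballI g h)
  qed
qed

text \<open>
The normal form depends only on the class of a pair, and so it descends to the quotient.
\<close>

theorem CM_space_local_section:
  assumes c0: "c0 \<in> points (CM_space n)"
  shows "\<exists>V s. openin (zariski (CM_space n)) V \<and> c0 \<in> V \<and> (\<forall>c\<in>V. s c \<in> c) \<and>
    (\<forall>\<iota>\<in>entries n. (\<lambda>c. entry (s c) \<iota>) \<in> regular_on (CM_space n) V)"
proof -
  let ?r = "conj_rel n"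
  note equiv = equiv_conj_rel[of n]
  obtain P0 where P0: "P0 \<in> CM_pairs n" "c0 = ?r `` {P0}"
    using c0 unfolding points_CM_space by (auto elim: quotientE)
  obtain p where p: "P0 \<in> frame_domain n p"
    using frame_exists[OF P0(1)] P0(1) unfolding frame_domain_def by auto
  let ?U = "frame_domain n p"
  have U: "?U \<subseteq> CM_pairs n"
    unfolding frame_domain_def by blast
  define V where "V = (\<lambda>P. ?r `` {P}) ` ?U"
  define s where "s c = normal_form n p (SOME P. P \<in> c)" for c
  have s: "s (?r `` {P}) = normal_form n p P" if P: "P \<in> ?U" for P
  proof -
    have "P \<in> ?r `` {P}"
      using equiv_class_self[OF equiv] U P by blast
    then have "(SOME Q. Q \<in> ?r `` {P}) \<in> ?r `` {P}"
      by (rule someI)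
    then show ?thesis
      unfolding s_def using normal_form_invariant(2)[OF P] by simp
  qed
  have UV: "\<Union>V = ?U"
  proof
    show "\<Union>V \<subseteq> ?U"
      unfolding V_def using normal_form_invariant(1) by blast
    show "?U \<subseteq> \<Union>V"
      unfolding V_def using equiv_class_self[OF equiv] U by blast
  qed
  have "V \<subseteq> CM_pairs n // ?r"
    unfolding V_def using U by (auto intro: quotientI)
  then have "openin (zariski (CM_space n)) V"
    unfolding CM_space_affine openin_quotient_affine[OF equiv] UV using frame_domain_open by blast
  moreover have "c0 \<in> V"
    unfolding V_def P0(2) using p by blast
  moreover have "s c \<in> c" if "c \<in> V" for c
    using that normal_form_conj_rel unfolding V_def by (auto simp: s)
  moreover have "(\<lambda>c. entry (s c) \<iota>) \<in> regular_on (CM_space n) V" if \<iota>: "\<iota> \<in> entries n" for \<iota>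
  proof -
    let ?X = "affine_subspace (CM_pairs n) (CM_coordinates n)"
    have "(\<lambda>P. entry (s (?r `` {P})) \<iota>) \<in> regular_on ?X ?U"
      unfolding regular_on_affine_subspace
    proof
      fix P assume "P \<in> ?U"
      then obtain N g h where N: "openin (zariski ?X) N" "P \<in> N" "N \<subseteq> ?U"
        and gh: "g \<in> polynomial_functions (CM_coordinates n)" "h \<in> polynomial_functions (CM_coordinates n)"
        "\<forall>Q\<in>N. h Q \<noteq> 0 \<and> entry (normal_form n p Q) \<iota> = g Q / h Q"
        using normal_form_regular[OF \<iota>, of p] unfolding regular_on_affine_subspace by meson
      have "\<forall>Q\<in>N. h Q \<noteq> 0 \<and> entry (s (?r `` {Q})) \<iota> = g Q / h Q"
        using gh(3) N(3) s by auto
      then show "\<exists>N. openin (zariski ?X) N \<and> P \<in> N \<and> N \<subseteq> ?U \<and>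
          (\<exists>g\<in>polynomial_functions (CM_coordinates n). \<exists>h\<in>polynomial_functions (CM_coordinates n).
            \<forall>Q\<in>N. h Q \<noteq> 0 \<and> entry (s (?r `` {Q})) \<iota> = g Q / h Q)"
        using N gh(1,2) by (intro exI[of _ N] conjI bexI[of _ g] bexI[of _ h])
    qed
    then show ?thesis
      unfolding CM_space_affine regular_on_quotient[OF equiv] UV .
  qed
  ultimately show ?thesis
    by (intro exI[of _ V] exI[of _ s]) blast
qed

section \<open>The action is a morphism of ind-varieties\<close>

text \<open>
The lift is \<open>(\<sigma>, c) \<mapsto> act_pair n \<sigma> (s c)\<close> for a local section \<open>s\<close>. Its entries are sums of products of a
coefficient, regular in \<open>\<sigma>\<close>, and a monomial in the entries of \<open>s c\<close>, regular in \<open>c\<close>. Tensor functions are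
equal only if they agree everywhere, so \<open>\<Theta>\<close> is defined by these sums and coincides with the
lift just on \<open>U \<times> V\<close>.
\<close>

lemma act_local_lift:
  assumes \<sigma>0: "\<sigma>0 \<in> points (G_filtration k)" and c0: "c0 \<in> points (CM_space n)"
  shows "\<exists>U V \<Theta>. openin (zariski (G_filtration k)) U \<and> openin (zariski (CM_space n)) V \<and>
    (\<sigma>0, c0) \<in> U \<times> V \<and>
    (\<forall>q\<in>U \<times> V. \<Theta> q \<in> CM_pairs n \<and> (\<lambda>(\<sigma>, c). act n \<sigma> c) q = conj_rel n `` {\<Theta> q}) \<and>
    (\<forall>\<phi>\<in>CM_coordinates n. (\<lambda>q. \<phi> (\<Theta> q)) \<in> tensor_functions (G_filtration k) (CM_space n) U V)"
proof -
  let ?X = "G_filtration k" and ?Y = "CM_space n" and ?I = "entries n"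
  obtain h m E g where h: "h \<in> polynomial_functions (G_coordinates k)" "h \<sigma>0 \<noteq> 0"
    and g: "\<forall>l c. g l c \<in> polynomial_functions (G_coordinates k)"
    and act: "\<forall>\<sigma>\<in>points ?X. h \<sigma> \<noteq> 0 \<longrightarrow> (\<forall>P\<in>matrix_pairs n. \<forall>c\<in>?I.
      entry (act_pair n \<sigma> P) c = (\<Sum>l<(m::nat). g l c \<sigma> / h \<sigma> * monomial ?I (E l) (entry P)))"
    using entry_act_pair_locally_rational[OF \<sigma>0, of n] by (elim exE conjE) (rule that)
  obtain V s where V: "openin (zariski ?Y) V" "c0 \<in> V" "\<forall>c\<in>V. s c \<in> c"
    and s: "\<forall>\<iota>\<in>?I. (\<lambda>c. entry (s c) \<iota>) \<in> regular_on ?Y V"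
    using CM_space_local_section[OF c0] by (elim exE conjE) (rule that)
  define U where "U = {\<sigma> \<in> points ?X. h \<sigma> \<noteq> 0}"
  have U: "openin (zariski ?X) U"
    unfolding U_def by (subst (1) G_filtration_affine) (rule openin_principal[OF h(1)])
  have algX: "function_algebra (regular_on ?X U)"
    using function_algebra_regular_on_affine[of "points ?X" "G_coordinates k" U] U
    unfolding G_filtration_affine[symmetric] .
  have algY: "function_algebra (regular_on ?Y V)"
    using function_algebra_regular_on_quotient[OF equiv_conj_rel V(1)[unfolded CM_space_affine]]
    unfolding CM_space_affine .
  define \<theta> where "\<theta> q \<iota> = (\<Sum>l<m. g l \<iota> (fst q) / h (fst q) * monomial ?I (E l) (entry (s (snd q))))"
    for q \<iota>
  define \<Theta> where "\<Theta> q = pair_of_entries n (\<theta> q)" for q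
  have \<theta>: "(\<lambda>q. \<theta> q \<iota>) \<in> tensor_functions ?X ?Y U V" for \<iota>
  proof -
    have "(\<lambda>\<sigma>. g l \<iota> \<sigma> / h \<sigma>) \<in> regular_on ?X U" for l
    proof -
      have "(\<lambda>\<sigma>. g l \<iota> \<sigma> / h \<sigma>) \<in> regular_on (affine_subspace (points ?X) (G_coordinates k)) U"
      proof (rule quotient_of_polynomials_regular[OF _ g[rule_format, of l \<iota>] h(1)])
        show "openin (zariski (affine_subspace (points ?X) (G_coordinates k))) U"
          using U unfolding G_filtration_affine[symmetric] .
        show "h \<sigma> \<noteq> 0 \<and> g l \<iota> \<sigma> / h \<sigma> = g l \<iota> \<sigma> / h \<sigma>" if "\<sigma> \<in> U" for \<sigma>
          using that unfolding U_def by simp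
      qed
      then show ?thesis
        unfolding G_filtration_affine[symmetric] .
    qed
    moreover have "(\<lambda>c. monomial ?I (E l) (entry (s c))) \<in> regular_on ?Y V" for l
      unfolding monomial_def
      by (intro function_algebra_prod[OF algY] function_algebra_power[OF algY] s[rule_format])
    ultimately have "(\<lambda>(u, v). \<Sum>l<m. g l \<iota> u / h u * monomial ?I (E l) (entry (s v)))
        \<in> tensor_functions ?X ?Y U V"
      by (intro tensor_functions_sumI) auto
    then show ?thesis
      unfolding \<theta>_def by (simp add: case_prod_beta')
  qed
  show ?thesis
  proof (intro exI[of _ U] exI[of _ V] exI[of _ \<Theta>] conjI ballI)
    show "(\<sigma>0, c0) \<in> U \<times> V"
      using \<sigma>0 h(2) V(2) unfolding U_def by simp
  next
    fix q assume "q \<in> U \<times> V"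
    then obtain \<sigma> c where q: "q = (\<sigma>, c)" "\<sigma> \<in> points ?X" "h \<sigma> \<noteq> 0" "c \<in> V"
      unfolding U_def by auto
    have G: "\<sigma> \<in> G_auts"
      using q(2) unfolding points_G_filtration by simp
    have c: "c \<in> CM_pairs n // conj_rel n"
      using openin_subset[OF V(1)] q(4) unfolding points_CM_space by blast
    then obtain P where P: "c = conj_rel n `` {P}"
      by (auto elim: quotientE)
    have sc: "(P, s c) \<in> conj_rel n"
      using V(3) q(4) unfolding P by blast
    have cs: "c = conj_rel n `` {s c}"
      unfolding P by (rule equiv_class_eq[OF equiv_conj_rel sc[unfolded P]])
    have CM: "s c \<in> CM_pairs n"
      using sc unfolding conj_rel_def by auto
    have CM': "s c \<in> matrix_pairs n"
      using CM CM_pairs_subset by blast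
    have "\<Theta> q = pair_of_entries n (entry (act_pair n \<sigma> (s c)))"
    proof -
      have "\<theta> q (b, i, j) = entry (act_pair n \<sigma> (s c)) (b, i, j)" if "i < n" "j < n" for b i j
        using act q(2,3) CM' that unfolding \<theta>_def q(1) by (simp add: entries_def del: entry.simps)
      then show ?thesis
        unfolding \<Theta>_def pair_of_entries_def by (auto simp del: entry.simps intro!: eq_matI)
    qed
    also have "\<dots> = act_pair n \<sigma> (s c)"
      unfolding act_pair_pull by (simp add: pair_of_entries_entry)
    finally have eq: "\<Theta> q = act_pair n \<sigma> (s c)" .
    show "\<Theta> q \<in> CM_pairs n"
      unfolding eq by (rule act_pair_CM_pairs[OF G CM])
    show "(\<lambda>(\<sigma>, c). act n \<sigma> c) q = conj_rel n `` {\<Theta> q}"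
      unfolding eq unfolding q(1) prod.case using act_class[OF G CM] cs by simp
  next
    fix \<phi> assume "\<phi> \<in> CM_coordinates n"
    then obtain \<iota> where "\<iota> \<in> ?I" "\<phi> = (\<lambda>P. entry P \<iota>)"
      unfolding CM_coordinates_def by blast
    then show "(\<lambda>q. \<phi> (\<Theta> q)) \<in> tensor_functions ?X ?Y U V"
      using \<theta>[of \<iota>] unfolding \<Theta>_def by (simp add: entry_pair_of_entries)
  qed (use U V(1) in auto)
qed

theorem theorem15:
  fixes n :: nat
  shows "group_action commutator_automorphisms (points (CM_space n))
           (\<lambda>\<sigma>. \<lambda>c \<in> points (CM_space n). act n \<sigma> c) \<and>
         ind_morphism (ind_product G_filtration (ind_const (CM_space n))) (ind_const (CM_space n))
           (\<lambda>(\<sigma>, c). act n \<sigma> c)"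
proof
  show "group_action commutator_automorphisms (points (CM_space n))
      (\<lambda>\<sigma>. \<lambda>c \<in> points (CM_space n). act n \<sigma> c)"
    by (rule group_action_CM_space)
  show "ind_morphism (ind_product G_filtration (ind_const (CM_space n))) (ind_const (CM_space n))
      (\<lambda>(\<sigma>, c). act n \<sigma> c)"
    unfolding ind_morphism_def ind_product_def ind_const_def
  proof (intro allI exI conjI)
    fix k
    have X: "function_algebra (regular_on (G_filtration k) U)"
      if "openin (zariski (G_filtration k)) U" for U
      using function_algebra_regular_on_affine[of "points (G_filtration k)" "G_coordinates k" U] that
      unfolding G_filtration_affine[symmetric] .
    have Y: "function_algebra (regular_on (CM_space n) V)" if "openin (zariski (CM_space n)) V" for V
      using function_algebra_regular_on_quotient[OF equiv_conj_rel that[unfolded CM_space_affine]]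
      unfolding CM_space_affine .
    have "variety_morphism (product_variety (G_filtration k) (CM_space n))
        (quotient_variety (affine_subspace (CM_pairs n) (CM_coordinates n)) (conj_rel n))
        (\<lambda>(\<sigma>, c). act n \<sigma> c)"
    proof (rule product_to_quotient_morphism)
      fix q assume "q \<in> points (G_filtration k) \<times> points (CM_space n)"
      then obtain \<sigma> c where q: "q = (\<sigma>, c)" "\<sigma> \<in> points (G_filtration k)" "c \<in> points (CM_space n)"
        by blast
      show "\<exists>U V \<Theta>. openin (zariski (G_filtration k)) U \<and> openin (zariski (CM_space n)) V \<and>
          q \<in> U \<times> V \<and>
          (\<forall>q\<in>U \<times> V. \<Theta> q \<in> CM_pairs n \<and> (\<lambda>(\<sigma>, c). act n \<sigma> c) q = conj_rel n `` {\<Theta> q}) \<and>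
          (\<forall>\<phi>\<in>CM_coordinates n. (\<lambda>q. \<phi> (\<Theta> q)) \<in> tensor_functions (G_filtration k) (CM_space n) U V)"
        unfolding q(1) by (rule act_local_lift[OF q(2,3)])
    qed (rule equiv_conj_rel | erule X Y)+
    then show "variety_morphism (product_variety (G_filtration k) (CM_space n)) (CM_space n)
        (\<lambda>(\<sigma>, c). act n \<sigma> c)"
      unfolding CM_space_affine[symmetric] .
    have "points (product_variety (G_filtration k) (CM_space n)) =
        points (G_filtration k) \<times> points (CM_space n)"
      by (rule points_product_variety; rule X Y)
    then show "(\<lambda>(\<sigma>, c). act n \<sigma> c) ` points (product_variety (G_filtration k) (CM_space n)) \<subseteq>
        points (CM_space n)"
      using act_points unfolding points_G_filtration by auto
  qed
qed

end
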